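(* Let $-A$ generate a bounded analytic semigroup on a Hilbert space $\mathcal{H}$. Let $\beta\in(-\infty,1)$ and $f\in L^2(0,\infty;t^\beta dt,\mathcal{H})$. Let $u$ be a weak solution to $\dot u(t)+Au(t)=f(t)$, $t>0$. Then there exists $h\in\mathcal{H}$ such that $$u(t)=e^{-tA}h+v(t)\quad\text{in }L^2_{loc}(0,\infty;dt,\mathcal{H}),\qquad\text{where } v(t)=\int_0^te^{-(t-s)A}f(s)\,ds.$$ In particular, $t\mapsto u(t)$ can be redefined on a null set to be in $C^0([0,\infty);\mathcal{H})$ with trace $h$ at $t=0$.
   Context: $\mathcal{H}$ is a Hilbert space with norm $\|\cdot\|$ and inner product $(\cdot,\cdot)$. "$-A$ generates a bounded analytic semigroup" means that $A$ is a densely defined closed linear operator on $\mathcal{H}$ and $-A$ generates a bounded analytic semigroup $\{e^{-zA}:|\arg z|<\delta\}$ for some $0<\delta<\pi/2$. $\mathsf{D}(A^* )$ is the domain of the adjoint $A^*$ (with graph norm). $L^2(0,\infty;t^\beta dt,\mathcal{H})$ is the space of strongly measurable $f:(0,\infty)\to\mathcal{H}$ with $\int_0^\infty\|f(t)\|^2t^\beta\,dt<\infty$. The subscript $c$ means compact support in $(0,\infty)$, and $L^2_{loc}(0,\infty;dt,\mathcal{H})$ means square integrable on compact subsets of $(0,\infty)$. Weak solution: for $f\in L^2_{loc}(0,\infty;dt,\mathcal{H})$, $u$ is a weak solution to $\dot u(t)+Au(t)=f(t)$, $t>0$, if $u\in L^2_{loc}(0,\infty;dt,\mathcal{H})$,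 $$\sup_{0<\tau<1}\frac1\tau\int_\tau^{2\tau}\|u(s)\|\,ds<\infty,$$ and for all $\phi\in C^1_c(0,\infty;\mathcal{H})\cap C^0_c(0,\infty;\mathsf{D}(A^* ))$, $$\int_0^\infty(u(s),-\dot\phi(s)+A^*\phi(s))\,ds=\int_0^\infty(f(s),\phi(s))\,ds.$$ *)

theory Defs
  imports "HOL-Analysis.Analysis"
begin

section \<open>Complex Hilbert spaces\<close>

text \<open>The inner product is linear in the first argument. Separability is not assumed.\<close>

class complex_hilbert_space = real_normed_vector + complete_space +
  fixes scaleC :: "complex \<Rightarrow> 'a \<Rightarrow> 'a"  (infixr \<open>*\<^sub>C\<close> 75)
    and cinner :: "'a \<Rightarrow> 'a \<Rightarrow> complex"
  assumes scaleC_add_right: "c *\<^sub>C (x + y) = c *\<^sub>C x + c *\<^sub>C y"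
    and scaleC_add_left: "(c + d) *\<^sub>C x = c *\<^sub>C x + d *\<^sub>C x"
    and scaleC_scaleC: "c *\<^sub>C (d *\<^sub>C x) = (c * d) *\<^sub>C x"
    and scaleC_of_real: "complex_of_real r *\<^sub>C x = r *\<^sub>R x"
    and cinner_commute: "cinner x y = cnj (cinner y x)"
    and cinner_add_left: "cinner (x + y) z = cinner x z + cinner y z"
    and cinner_scaleC_left: "cinner (c *\<^sub>C x) y = c * cinner x y"
    and cinner_self: "cinner x x = complex_of_real ((norm x)\<^sup>2)"

section \<open>Unbounded operators and analytic semigroups\<close>

text \<open>An unbounded operator is given by its domain \<open>D\<close> and a function \<open>A\<close>
  of which only the values on \<open>D\<close> are relevant.\<close>

definition clinear_operator ::
  "'a::complex_hilbert_space set \<Rightarrow> ('a \<Rightarrow> 'a) \<Rightarrow> bool" where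
  "clinear_operator D A \<longleftrightarrow>
     0 \<in> D \<and>
     (\<forall>x\<in>D. \<forall>y\<in>D. x + y \<in> D \<and> A (x + y) = A x + A y) \<and>
     (\<forall>c. \<forall>x\<in>D. c *\<^sub>C x \<in> D \<and> A (c *\<^sub>C x) = c *\<^sub>C A x)"

definition closed_densely_defined ::
  "'a::complex_hilbert_space set \<Rightarrow> ('a \<Rightarrow> 'a) \<Rightarrow> bool" where
  "closed_densely_defined D A \<longleftrightarrow>
     clinear_operator D A \<and> closure D = UNIV \<and> closed ((\<lambda>x. (x, A x)) ` D)"

definition adjoint_dom ::
  "'a::complex_hilbert_space set \<Rightarrow> ('a \<Rightarrow> 'a) \<Rightarrow> 'a set" where
  "adjoint_dom D A = {y. \<exists>z. \<forall>x\<in>D. cinner (A x) y = cinner x z}"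

text \<open>The vector \<open>z\<close> below is unique if \<open>D\<close> is dense and \<open>y\<close> is in the domain of the adjoint.\<close>

definition adjoint_op ::
  "'a::complex_hilbert_space set \<Rightarrow> ('a \<Rightarrow> 'a) \<Rightarrow> 'a \<Rightarrow> 'a" where
  "adjoint_op D A y = (THE z. \<forall>x\<in>D. cinner (A x) y = cinner x z)"

definition sector :: "real \<Rightarrow> complex set" where
  "sector \<delta> = {z. z \<noteq> 0 \<and> \<bar>Arg z\<bar> < \<delta>}"

text \<open>Analyticity is complex differentiability of every orbit; the Frechet derivative of an
  orbit has to be complex linear.\<close>

definition bounded_analytic_semigroup ::
  "real \<Rightarrow> (complex \<Rightarrow> 'a::complex_hilbert_space \<Rightarrow> 'a) \<Rightarrow> bool" where
  "bounded_analytic_semigroup \<delta> S \<longleftrightarrow>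
     (\<forall>z\<in>sector \<delta>. clinear_operator UNIV (S z)) \<and>
     (\<exists>C. \<forall>z\<in>sector \<delta>. \<forall>x. norm (S z x) \<le> C * norm x) \<and>
     (\<forall>x. S 0 x = x) \<and>
     (\<forall>z\<in>sector \<delta>. \<forall>w\<in>sector \<delta>. \<forall>x. S (z + w) x = S z (S w x)) \<and>
     (\<forall>x. \<forall>z\<in>sector \<delta>. \<exists>d. ((\<lambda>w. S w x) has_derivative (\<lambda>h. h *\<^sub>C d)) (at z)) \<and>
     (\<forall>x. ((\<lambda>z. S z x) \<longlongrightarrow> x) (at 0 within sector \<delta>))"

text \<open>\<open>S z\<close> is the operator \<open>exp (- z A)\<close>. The last conjunct says that the infinitesimal generator
  of \<open>S\<close>, with its maximal domain, is exactly \<open>- A\<close> with domain \<open>D\<close>.\<close>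

definition neg_generates_bounded_analytic_semigroup ::
  "'a::complex_hilbert_space set \<Rightarrow> ('a \<Rightarrow> 'a) \<Rightarrow> (complex \<Rightarrow> 'a \<Rightarrow> 'a) \<Rightarrow> bool" where
  "neg_generates_bounded_analytic_semigroup D A S \<longleftrightarrow>
     closed_densely_defined D A \<and>
     (\<exists>\<delta>. 0 < \<delta> \<and> \<delta> < pi / 2 \<and> bounded_analytic_semigroup \<delta> S) \<and>
     (\<forall>x y. ((\<lambda>t. (1 / t) *\<^sub>R (S (complex_of_real t) x - x)) \<longlongrightarrow> y) (at_right 0)
        \<longleftrightarrow> x \<in> D \<and> y = - A x)"

section \<open>Strong measurability and the Bochner integral\<close>

text \<open>The Bochner integral of the library requires a second countable range type; the following
  is the same construction for functions that are almost everywhere limits of simple functions.\<close>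

definition strongly_measurable ::
  "'b measure \<Rightarrow> ('b \<Rightarrow> 'a::real_normed_vector) \<Rightarrow> bool" where
  "strongly_measurable M f \<longleftrightarrow>
     (\<exists>s. (\<forall>i. simple_function M (s i)) \<and> (AE x in M. (\<lambda>i. s i x) \<longlonglongrightarrow> f x))"

definition bochner_has_integral ::
  "'b measure \<Rightarrow> ('b \<Rightarrow> 'a::real_normed_vector) \<Rightarrow> 'a \<Rightarrow> bool" where
  "bochner_has_integral M f I \<longleftrightarrow>
     strongly_measurable M f \<and>
     (\<exists>s. (\<forall>i. Bochner_Integration.simple_bochner_integrable M (s i)) \<and>
          (\<lambda>i. \<integral>\<^sup>+ x. ennreal (norm (f x - s i x)) \<partial>M) \<longlonglongrightarrow> 0 \<and>
          (\<lambda>i. Bochner_Integration.simple_bochner_integral M (s i)) \<longlonglongrightarrow> I)"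

definition bochner_integrable ::
  "'b measure \<Rightarrow> ('b \<Rightarrow> 'a::real_normed_vector) \<Rightarrow> bool" where
  "bochner_integrable M f \<longleftrightarrow> (\<exists>I. bochner_has_integral M f I)"

definition bochner_integral ::
  "'b measure \<Rightarrow> ('b \<Rightarrow> 'a::real_normed_vector) \<Rightarrow> 'a" where
  "bochner_integral M f = (THE I. bochner_has_integral M f I)"

section \<open>Function spaces on the half line and weak solutions\<close>

text \<open>Functions on the open half line are represented by functions on the reals, whose values
  outside the open half line are irrelevant.\<close>

definition L2_weighted :: "real \<Rightarrow> (real \<Rightarrow> 'a::real_normed_vector) set" where
  "L2_weighted \<beta> =
     {f. strongly_measurable (lebesgue_on {0<..}) f \<and>
         integrable (lebesgue_on {0<..}) (\<lambda>t. (norm (f t))\<^sup>2 * t powr \<beta>)}"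

definition L2_loc :: "(real \<Rightarrow> 'a::real_normed_vector) set" where
  "L2_loc =
     {f. strongly_measurable (lebesgue_on {0<..}) f \<and>
         (\<forall>K. compact K \<and> K \<subseteq> {0<..} \<longrightarrow> integrable (lebesgue_on K) (\<lambda>t. (norm (f t))\<^sup>2))}"

text \<open>Continuity into the domain of the adjoint is with respect to the graph norm, that is,
  continuity of both \<open>\<phi>\<close> and its image under the adjoint.\<close>

definition test_functions ::
  "'a::complex_hilbert_space set \<Rightarrow> ('a \<Rightarrow> 'a) \<Rightarrow> (real \<Rightarrow> 'a) set" where
  "test_functions D A =
     {\<phi>. \<phi> C1_differentiable_on {0<..} \<and>
         (\<forall>t>0. \<phi> t \<in> adjoint_dom D A) \<and>
         continuous_on {0<..} \<phi> \<and>
         continuous_on {0<..} (\<lambda>t. adjoint_op D A (\<phi> t)) \<and>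
         (\<exists>K. compact K \<and> K \<subseteq> {0<..} \<and> (\<forall>t\<in>{0<..} - K. \<phi> t = 0))}"

definition weak_solution ::
  "'a::complex_hilbert_space set \<Rightarrow> ('a \<Rightarrow> 'a) \<Rightarrow> (real \<Rightarrow> 'a) \<Rightarrow> (real \<Rightarrow> 'a) \<Rightarrow> bool" where
  "weak_solution D A f u \<longleftrightarrow>
     u \<in> L2_loc \<and>
     bdd_above ((\<lambda>\<tau>. (1 / \<tau>) * (\<integral>s. norm (u s) \<partial>lebesgue_on {\<tau>..2 * \<tau>})) ` {0<..<1}) \<and>
     (\<forall>\<phi>\<in>test_functions D A.
        (\<integral>s. cinner (u s) (- vector_derivative \<phi> (at s) + adjoint_op D A (\<phi> s))
           \<partial>lebesgue_on {0<..})
        = (\<integral>s. cinner (f s) (\<phi> s) \<partial>lebesgue_on {0<..}))"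

end

theory Submission
  imports Defs "HOL-Complex_Analysis.Complex_Analysis"
begin

text \<open>Fix \<open>t > 0\<close> and a vector \<open>y\<close>. By analyticity \<open>r \<mapsto> S(r)\<^sup>* y\<close> is continuously differentiable
  for \<open>r > 0\<close> with values in the domain of \<open>A\<^sup>*\<close>, so for scalar \<open>\<eta>\<close> supported in \<open>(0, t)\<close> the
  function \<open>\<eta>(s) S(t - s)\<^sup>* y\<close> is a test function, and the terms with \<open>A\<^sup>*\<close> cancel. The weak
  equation then says that \<open>s \<mapsto> (S(t - s) u(s), y)\<close> has the weak derivative \<open>(S(t - s) f(s), y)\<close>;
  equivalently \<open>(S(t - s) (u - v)(s), y)\<close> is almost everywhere equal to a constant \<open>c\<close>. Since
  \<open>S(t - s)\<^sup>* y\<close> tends to \<open>S(t)\<^sup>* y\<close> in norm as \<open>s\<close> tends to \<open>0\<close>, and the means of \<open>u - v\<close> over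
  \<open>[\<tau>, 2\<tau>]\<close> are bounded, the pairings of these means with \<open>S(t)\<^sup>* y\<close> converge to \<open>c\<close>. The limit
  functional is bounded on the subspace where it exists, so Riesz' theorem gives a vector \<open>h\<close> with
  \<open>c = (S(t) h, y)\<close> for all \<open>t\<close> and \<open>y\<close>. Hence \<open>S(t - s)\<close> annihilates
  \<open>u(s) - v(s) - S(s) h\<close>, and \<open>t\<close> decreasing to \<open>s\<close> finishes the proof; countably many \<open>t\<close> and \<open>y\<close>
  suffice because strongly measurable functions are essentially separably valued.\<close>

section \<open>Riesz representation in complex Hilbert spaces\<close>

text \<open>Analyticity enters where a general bounded semigroup may fail: a test function must take
  values in the domain of the adjoint and be continuously differentiable in norm. Cauchy's estimates
  bound the scalar orbits with constants proportional to \<open>norm x\<close>, and duality turns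
  this into norm differentiability of the adjoint orbits. Norm continuity at \<open>t\<close> is
  also what the trace needs: near \<open>0\<close> only the means of the norm of
  \<open>u - v\<close> are known to be bounded, so errors are controlled by a supremum of
  \<open>norm (adj y t - adj y (t - s))\<close> times that bound. The limit functional lives on a
  subspace chosen independently of \<open>t\<close> and \<open>y\<close>, hence a single
  \<open>h\<close> represents all the constants. The weight enters through Cauchy-Schwarz:
  \<open>\<beta> < 1\<close> makes \<open>f\<close> integrable up to \<open>0\<close>, so that its
  Duhamel integral is continuous and vanishes at \<open>0\<close>. As no separability is available,
  vector-valued integrals are handled through their pairings. These are the real parts
  \<open>rinner\<close> of the inner product; complex linearity is recovered from \<open>x\<close>
  and \<open>\<i> *\<^sub>C x\<close>.\<close>

definition rinner :: "'a::complex_hilbert_space \<Rightarrow> 'a \<Rightarrow> real" where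
  "rinner x y = Re (cinner x y)"

lemma cinner_scaleR_left: "cinner (r *\<^sub>R x) y = of_real r * cinner x y"
  by (metis scaleC_of_real cinner_scaleC_left)

lemma cinner_add_right: "cinner x (y + z) = cinner x y + cinner x z"
  by (metis cinner_commute cinner_add_left complex_cnj_add)

lemma cinner_scaleC_right: "cinner x (c *\<^sub>C y) = cnj c * cinner x y"
  by (metis cinner_commute cinner_scaleC_left complex_cnj_mult)

lemma cinner_scaleR_right: "cinner x (r *\<^sub>R y) = of_real r * cinner x y"
  by (metis scaleC_of_real cinner_scaleC_right complex_cnj_complex_of_real)

lemma cinner_minus_left: "cinner (- x) y = - cinner x y"
  using cinner_scaleR_left[of "-1" x y] by simp

lemma cinner_minus_right: "cinner x (- y) = - cinner x y"
  using cinner_scaleR_right[of x "-1" y] by simp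

lemma cinner_diff_left: "cinner (x - y) z = cinner x z - cinner y z"
  by (metis cinner_add_left cinner_minus_left diff_conv_add_uminus)

lemma cinner_diff_right: "cinner x (y - z) = cinner x y - cinner x z"
  by (metis cinner_add_right cinner_minus_right diff_conv_add_uminus)

lemma rinner_commute: "rinner x y = rinner y x"
  unfolding rinner_def by (subst cinner_commute) simp

lemma rinner_simps:
  "rinner (x + y) z = rinner x z + rinner y z"
  "rinner z (x + y) = rinner z x + rinner z y"
  "rinner (x - y) z = rinner x z - rinner y z"
  "rinner z (x - y) = rinner z x - rinner z y"
  "rinner (- x) z = - rinner x z"
  "rinner z (- x) = - rinner z x"
  "rinner (r *\<^sub>R x) z = r * rinner x z"
  "rinner z (r *\<^sub>R x) = r * rinner z x"
  by (simp_all add: rinner_def cinner_add_left cinner_add_right cinner_diff_left cinner_diff_right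
      cinner_minus_left cinner_minus_right cinner_scaleR_left cinner_scaleR_right)

lemma rinner_zero: "rinner 0 z = 0" "rinner z 0 = 0"
  using rinner_simps(3,4)[of 0 0 z] rinner_simps(4)[of z 0 0] by simp_all

lemma rinner_self: "rinner x x = (norm x)\<^sup>2"
  by (simp add: rinner_def cinner_self)

lemma norm_scaleC: "norm (c *\<^sub>C x) = cmod c * norm x"
proof -
  have "cinner (c *\<^sub>C x) (c *\<^sub>C x) = (c * cnj c) * cinner x x"
    by (simp only: cinner_scaleC_left cinner_scaleC_right mult_ac)
  also have "\<dots> = of_real ((cmod c * norm x)\<^sup>2)"
    unfolding complex_norm_square[symmetric] cinner_self by (simp add: power_mult_distrib)
  finally have "cinner (c *\<^sub>C x) (c *\<^sub>C x) = of_real ((cmod c * norm x)\<^sup>2)" .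
  hence "(norm (c *\<^sub>C x))\<^sup>2 = (cmod c * norm x)\<^sup>2"
    using cinner_self[of "c *\<^sub>C x"] of_real_eq_iff by metis
  thus ?thesis by (simp add: power2_eq_iff_nonneg)
qed

lemma abs_rinner_le: "\<bar>rinner x y\<bar> \<le> norm x * norm y"
proof (cases "y = 0")
  case True
  thus ?thesis using rinner_simps(7)[of 0 y x] rinner_commute[of x y] by simp
next
  case False
  \<comment> \<open>The coefficient of the orthogonal projection of \<open>x\<close> onto the real
    line through \<open>y\<close>.\<close>
  define r where "r = rinner x y / (norm y)\<^sup>2"
  have "0 \<le> rinner (x - r *\<^sub>R y) (x - r *\<^sub>R y)" by (simp add: rinner_self)
  also have "\<dots> = (norm x)\<^sup>2 - 2 * r * rinner x y + r\<^sup>2 * (norm y)\<^sup>2"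
    unfolding rinner_self[symmetric] rinner_simps rinner_commute[of y x]
    by (simp add: algebra_simps power2_eq_square)
  also have "\<dots> = (norm x)\<^sup>2 - (rinner x y)\<^sup>2 / (norm y)\<^sup>2"
    using False by (simp add: r_def field_simps power2_eq_square)
  finally have "(rinner x y)\<^sup>2 \<le> (norm x * norm y)\<^sup>2"
    using False by (simp add: field_simps power_mult_distrib)
  thus ?thesis by (simp add: abs_le_square_iff[symmetric])
qed

text \<open>A factor \<open>c\<close> of modulus one rotates the pairing onto the positive real
  axis, where the real Cauchy-Schwarz inequality applies.\<close>

lemma norm_cinner_le: "cmod (cinner x y) \<le> norm x * norm y"
proof (cases "cinner x y = 0")
  case False
  define c where "c = cnj (cinner x y) / of_real (cmod (cinner x y))"
  have "c * cinner x y = of_real (cmod (cinner x y) ^ 2) / of_real (cmod (cinner x y))"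
    unfolding c_def unfolding complex_norm_square by (simp add: c_def)
  hence "c * cinner x y = of_real (cmod (cinner x y))" using False by (simp add: power2_eq_square)
  hence "cmod (cinner x y) = rinner (c *\<^sub>C x) y" by (simp add: rinner_def cinner_scaleC_left)
  also have "\<dots> \<le> norm (c *\<^sub>C x) * norm y" using abs_rinner_le[of "c *\<^sub>C x" y] by linarith
  also have "\<dots> = norm x * norm y" using False by (simp add: norm_scaleC c_def norm_divide)
  finally show ?thesis .
qed simp

lemma bounded_linear_cinner_left: "bounded_linear (\<lambda>x. cinner x y)"
  by (rule bounded_linear_intro[where K="norm y"])
    (simp_all add: cinner_add_left cinner_scaleR_left scaleR_conv_of_real norm_cinner_le)

lemma bounded_bilinear_rinner: "bounded_bilinear rinner"
  by (rule bounded_bilinear.intro)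
    (auto simp: rinner_simps abs_rinner_le intro!: exI[of _ 1])

lemmas tendsto_rinner = bounded_bilinear.tendsto[OF bounded_bilinear_rinner]

lemma bounded_linear_rinner_left: "bounded_linear (\<lambda>x. rinner x y)"
  by (rule bounded_bilinear.bounded_linear_left[OF bounded_bilinear_rinner])

lemma bounded_linear_rinner_right: "bounded_linear (rinner x)"
  by (rule bounded_bilinear.bounded_linear_right[OF bounded_bilinear_rinner])

lemma cinner_left_eqI: "(\<And>x. cinner x y = cinner x z) \<Longrightarrow> y = z"
  by (metis cinner_diff_right cinner_self eq_iff_diff_eq_0 norm_eq_zero of_real_eq_0_iff
      power_eq_0_iff)

text \<open>The representing vector is the limit of a minimising sequence of \<open>\<parallel>x\<parallel>\<^sup>2 - 2 L x\<close> in \<open>Z\<close>; it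
  need not lie in \<open>Z\<close>, which is therefore not assumed to be closed.\<close>

lemma riesz_real_subspace:
  fixes Z :: "'a::complex_hilbert_space set" and L :: "'a \<Rightarrow> real"
  assumes Z0: "0 \<in> Z" and Zadd: "\<And>x y. x \<in> Z \<Longrightarrow> y \<in> Z \<Longrightarrow> x + y \<in> Z"
    and Zsc: "\<And>r x. x \<in> Z \<Longrightarrow> r *\<^sub>R x \<in> Z"
    and Ladd: "\<And>x y. x \<in> Z \<Longrightarrow> y \<in> Z \<Longrightarrow> L (x + y) = L x + L y"
    and Lsc: "\<And>r x. x \<in> Z \<Longrightarrow> L (r *\<^sub>R x) = r * L x"
    and Lb: "\<And>x. x \<in> Z \<Longrightarrow> \<bar>L x\<bar> \<le> K * norm x"
  shows "\<exists>h. \<forall>z\<in>Z. L z = rinner z h"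
proof -
  define J where "J x = (norm x)\<^sup>2 - 2 * L x" for x
  define m where "m = Inf (J ` Z)"
  \<comment> \<open>Completing the square: the linear term is at most
    \<open>2 * K * norm x\<close>.\<close>
  have Jlow: "J x \<ge> - K\<^sup>2" if "x \<in> Z" for x
  proof -
    have "2 * L x \<le> 2 * (K * norm x)" using Lb[OF that] by linarith
    moreover have "0 \<le> (norm x - K)\<^sup>2" by simp
    ultimately show ?thesis unfolding J_def by (simp add: power2_diff algebra_simps)
  qed
  have bdd: "bdd_below (J ` Z)" using Jlow by (auto intro!: bdd_belowI[of _ "- K\<^sup>2"])
  have mle: "m \<le> J x" if "x \<in> Z" for x
    unfolding m_def by (rule cInf_lower) (use that bdd in auto)
  have "\<exists>x\<in>Z. J x < m + 1 / real (Suc n)" for n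
  proof -
    have "\<exists>y\<in>J ` Z. y < m + 1 / real (Suc n)"
      by (rule iffD1[OF cInf_less_iff]) (use Z0 bdd in \<open>auto simp: m_def\<close>)
    thus ?thesis by auto
  qed
  then obtain x where xZ: "\<And>n. x n \<in> Z" and xm: "\<And>n. J (x n) < m + 1 / real (Suc n)" by metis
  \<comment> \<open>Parallelogram law for \<open>J\<close>: the linear parts cancel. Since
    \<open>J\<close> of the midpoint is at least \<open>m\<close>, two near-minimisers must be close
    to each other.\<close>
  have par: "(norm (a - b))\<^sup>2 = 2 * J a + 2 * J b - 4 * J ((1/2) *\<^sub>R (a + b))"
    if "a \<in> Z" "b \<in> Z" for a b
  proof -
    have "(norm (a - b))\<^sup>2 = (norm a)\<^sup>2 + (norm b)\<^sup>2 - 2 * rinner a b"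
      unfolding rinner_self[symmetric] using rinner_commute[of a b] by (simp add: rinner_simps)
    moreover have "(norm ((1/2) *\<^sub>R (a + b)))\<^sup>2 = ((norm a)\<^sup>2 + (norm b)\<^sup>2 + 2 * rinner a b) / 4"
      unfolding rinner_self[symmetric] rinner_simps rinner_commute[of b a]
          by (simp add: field_simps)
    moreover have "L ((1/2) *\<^sub>R (a + b)) = (L a + L b) / 2"
      using that by (simp add: Lsc Zadd Ladd)
    ultimately show ?thesis unfolding J_def by (simp add: field_simps)
  qed
  have close: "(norm (x i - x j))\<^sup>2 \<le> 2 / real (Suc i) + 2 / real (Suc j)" for i j
  proof -
    have "m \<le> J ((1/2) *\<^sub>R (x i + x j))" by (intro mle Zsc Zadd xZ)
    thus ?thesis using par[OF xZ[of i] xZ[of j]] xm[of i] xm[of j] by linarith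
  qed
  have "Cauchy x"
  proof (rule CauchyI)
    fix e :: real assume e: "e > 0"
    obtain N where N: "4 / e\<^sup>2 < real N" using reals_Archimedean2 by blast
    have "norm (x i - x j) < e" if "i \<ge> N" "j \<ge> N" for i j
    proof -
      have N0: "N > 0" using N e by (cases N) (auto simp: field_simps not_less)
      have *: "2 / real (Suc k) < 2 / real N" if "k \<ge> N" for k
        using that N0 by (auto simp: frac_less2)
      have "(norm (x i - x j))\<^sup>2 < 2 / real N + 2 / real N"
        using close[of i j] *[OF that(1)] *[OF that(2)] by linarith
      also have "\<dots> < e\<^sup>2" using N e N0 by (simp add: field_simps)
      finally show ?thesis using e by (simp add: power_less_imp_less_base)
    qed
    thus "\<exists>M. \<forall>i\<ge>M. \<forall>j\<ge>M. norm (x i - x j) < e" by blast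
  qed
  then obtain h where h: "x \<longlonglongrightarrow> h" using Cauchy_convergent_iff convergent_def by blast
  have "L z = rinner z h" if z: "z \<in> Z" for z
  proof -
    \<comment> \<open>First variation in direction \<open>z\<close>, taken along the sequence and
      only then passed to the limit: \<open>L\<close> is controlled on \<open>Z\<close> alone, so
      \<open>J h\<close> itself cannot be used.\<close>
    have q: "0 \<le> r\<^sup>2 * (norm z)\<^sup>2 + 2 * r * (rinner z h - L z)" for r
    proof -
      have "- (1 / real (Suc n)) \<le> r\<^sup>2 * (norm z)\<^sup>2 + 2 * r * (rinner z (x n) - L z)" for n
      proof -
        have "m \<le> J (x n + r *\<^sub>R z)" by (intro mle Zadd Zsc xZ z)
        also have "\<dots> = J (x n) + r\<^sup>2 * (norm z)\<^sup>2 + 2 * r * (rinner z (x n) - L z)"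
          unfolding J_def rinner_self[symmetric] using rinner_commute[of z "x n"]
          by (simp add: rinner_simps Ladd Lsc Zsc xZ z algebra_simps power2_eq_square)
        finally show ?thesis using xm[of n] by linarith
      qed
      moreover have "(\<lambda>n. r\<^sup>2 * (norm z)\<^sup>2 + 2 * r * (rinner z (x n) - L z))
          \<longlonglongrightarrow> r\<^sup>2 * (norm z)\<^sup>2 + 2 * r * (rinner z h - L z)"
        by (intro tendsto_intros tendsto_rinner h)
      moreover have "(\<lambda>n. - (1 / real (Suc n))) \<longlonglongrightarrow> - 0"
        by (intro tendsto_minus LIMSEQ_inverse_real_of_nat[unfolded inverse_eq_divide])
      ultimately have "- 0 \<le> r\<^sup>2 * (norm z)\<^sup>2 + 2 * r * (rinner z h - L z)"
        by (intro LIMSEQ_le[where X="\<lambda>n. - (1 / real (Suc n))"]) auto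
      thus ?thesis by simp
    qed
    show ?thesis
    proof (cases "norm z = 0")
      case True
      thus ?thesis using q[of 1] q[of "-1"] by simp
    next
      case False
      define d where "d = rinner z h - L z"
      \<comment> \<open>This value of \<open>r\<close> minimises the quadratic \<open>q\<close>; the
        minimum is nonnegative only if \<open>d\<close> vanishes.\<close>
      have "0 \<le> (- d / (norm z)\<^sup>2)\<^sup>2 * (norm z)\<^sup>2 + 2 * (- d / (norm z)\<^sup>2) * d"
        using q[of "- d / (norm z)\<^sup>2"] by (simp add: d_def)
      also have "\<dots> = - (d\<^sup>2 / (norm z)\<^sup>2)" using False by (simp add: field_simps power2_eq_square)
      finally have "d\<^sup>2 / (norm z)\<^sup>2 \<le> 0" by linarith
      hence "d = 0" using False by (simp add: divide_le_0_iff)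
      thus ?thesis by (simp add: d_def)
    qed
  qed
  thus ?thesis by blast
qed

text \<open>A complex linear functional is determined by its real part, since evaluating the real
  part at \<open>\<i> *\<^sub>C x\<close> recovers the imaginary part. The real statement on the
  whole space therefore suffices.\<close>

lemma riesz_complex:
  fixes L :: "'a::complex_hilbert_space \<Rightarrow> complex"
  assumes add: "\<And>x y. L (x + y) = L x + L y" and sc: "\<And>c x. L (c *\<^sub>C x) = c * L x"
    and b: "\<And>x. cmod (L x) \<le> K * norm x"
  shows "\<exists>h. \<forall>x. L x = cinner x h"
proof -
  have "\<exists>h. \<forall>z\<in>UNIV. Re (L z) = rinner z h"
  proof (rule riesz_real_subspace)
    show "Re (L (r *\<^sub>R x)) = r * Re (L x)" for r x
      using sc[of "of_real r" x] by (simp add: scaleC_of_real)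
    show "\<bar>Re (L x)\<bar> \<le> K * norm x" for x
      using abs_Re_le_cmod[of "L x"] b[of x] by linarith
  qed (auto simp: add)
  then obtain h where h: "\<And>z. Re (L z) = rinner z h" by blast
  have "L x = cinner x h" for x
    using h[of x] h[of "\<i> *\<^sub>C x"]
    by (auto simp: complex_eq_iff rinner_def sc cinner_scaleC_left)
  thus ?thesis by blast
qed

section \<open>Adjoint orbits of an analytic semigroup\<close>

text \<open>The angle and the bound are fixed as parameters. With \<open>1 \<le> C\<close> the same
  bound also covers the identity at time \<open>0\<close>, which is not a point of the
  sector.\<close>

locale bounded_analytic =
  fixes S :: "complex \<Rightarrow> 'a::complex_hilbert_space \<Rightarrow> 'a" and \<delta> C :: real
  assumes delta_pos: "0 < \<delta>"
    and S_lin: "\<And>z. z \<in> sector \<delta> \<Longrightarrow> clinear_operator UNIV (S z)"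
    and C_ge_1: "1 \<le> C"
    and S_norm_le: "\<And>z x. z \<in> sector \<delta> \<Longrightarrow> norm (S z x) \<le> C * norm x"
    and S_0: "\<And>x. S 0 x = x"
    and S_plus: "\<And>z w x. z \<in> sector \<delta> \<Longrightarrow> w \<in> sector \<delta> \<Longrightarrow> S (z + w) x = S z (S w x)"
    and S_deriv: "\<And>x z. z \<in> sector \<delta> \<Longrightarrow> \<exists>d. ((\<lambda>w. S w x) has_derivative (\<lambda>h. h *\<^sub>C d)) (at z)"
    and S_lim: "\<And>x. ((\<lambda>z. S z x) \<longlongrightarrow> x) (at 0 within sector \<delta>)"
begin

definition T :: "real \<Rightarrow> 'a \<Rightarrow> 'a" where "T t = S (of_real t)"

lemma of_real_in_sector: "t > 0 \<Longrightarrow> complex_of_real t \<in> sector \<delta>"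
  using delta_pos by (simp add: sector_def Arg_of_real)

lemma T_0: "T 0 x = x"
  by (simp add: T_def S_0)

lemma T_lin:
  assumes "t \<ge> 0"
  shows "T t (x + y) = T t x + T t y" "T t (c *\<^sub>C x) = c *\<^sub>C T t x" "T t (r *\<^sub>R x) = r *\<^sub>R T t x"
    "T t (x - y) = T t x - T t y" "T t 0 = 0"
proof -
  have lin: "T t (x + y) = T t x + T t y" "T t (c *\<^sub>C x) = c *\<^sub>C T t x" for x y c
    using S_lin[OF of_real_in_sector, of t] assms
    by (cases "t = 0"; auto simp: T_def clinear_operator_def S_0)+
  have sc: "T t (r *\<^sub>R x) = r *\<^sub>R T t x" for r x
    using lin(2)[of "of_real r" x] by (simp add: scaleC_of_real)
  show "T t (x + y) = T t x + T t y" "T t (c *\<^sub>C x) = c *\<^sub>C T t x" "T t (r *\<^sub>R x) = r *\<^sub>R T t x"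
    by (fact lin sc)+
  show "T t (x - y) = T t x - T t y"
    using lin(1)[of x "- y"] sc[of "-1" y] by simp
  show "T t 0 = 0" using sc[of 0 0] by simp
qed

lemma T_norm_le: "t \<ge> 0 \<Longrightarrow> norm (T t x) \<le> C * norm x"
  using S_norm_le[OF of_real_in_sector, of t x] C_ge_1 mult_right_mono[of 1 C "norm x"]
  by (cases "t = 0") (auto simp: T_def S_0)

lemma bounded_linear_T: "t \<ge> 0 \<Longrightarrow> bounded_linear (T t)"
  by (rule bounded_linear_intro[where K=C]) (use T_norm_le in \<open>auto simp: T_lin mult.commute\<close>)

lemma T_add: "s \<ge> 0 \<Longrightarrow> t \<ge> 0 \<Longrightarrow> T (s + t) x = T s (T t x)"
  using S_plus[OF of_real_in_sector of_real_in_sector, of s t x]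
  by (cases "s = 0"; cases "t = 0") (auto simp: T_def S_0)

lemma T_tendsto_0: "((\<lambda>t. T t x) \<longlongrightarrow> x) (at_right 0)"
proof -
  have "filterlim complex_of_real (at 0 within sector \<delta>) (at_right 0)"
    unfolding filterlim_at
  proof (intro conjI)
    show "\<forall>\<^sub>F t in at_right 0. complex_of_real t \<in> sector \<delta> \<and> complex_of_real t \<noteq> 0"
      using eventually_at_right_less[of 0]
      by eventually_elim (use of_real_in_sector in auto)
    have "(complex_of_real \<longlongrightarrow> of_real 0) (at_right 0)" by (intro tendsto_intros)
    thus "(complex_of_real \<longlongrightarrow> 0) (at_right 0)" by simp
  qed
  from filterlim_compose[OF S_lim this] show ?thesis unfolding T_def by simp
qed

text \<open>At positive times complex differentiability of the orbit gives continuity; at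
  \<open>0\<close>, outside the sector, it is the strong limit of the semigroup.\<close>

lemma continuous_on_T: "continuous_on {0..} (\<lambda>t. T t x)"
  unfolding continuous_on_def
proof
  fix t :: real assume t: "t \<in> {0..}"
  show "((\<lambda>t. T t x) \<longlongrightarrow> T t x) (at t within {0..})"
  proof (cases "t = 0")
    case True
    thus ?thesis using T_tendsto_0[of x] by (simp add: T_0 at_within_Ici_at_right)
  next
    case False
    hence "isCont (\<lambda>w. S w x) (of_real t)"
      using S_deriv[OF of_real_in_sector, of t x] t has_derivative_continuous by auto
    hence "isCont (\<lambda>t. S (of_real t) x) t"
      by (intro isCont_o2[where f=complex_of_real and g="\<lambda>w. S w x"] continuous_of_real) auto
    thus ?thesis unfolding T_def isCont_def by (rule tendsto_within_subset) simp
  qed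
qed

text \<open>Provides the disc for Cauchy's estimates. A positive real stays away from the branch cut
  of \<open>Arg\<close>, so the angle is continuous there.\<close>

lemma cball_subset_sector:
  assumes "t > 0"
  shows "\<exists>r>0. cball (complex_of_real t) r \<subseteq> sector \<delta>"
proof -
  have nr: "complex_of_real t \<notin> \<real>\<^sub>\<le>\<^sub>0" using assms by auto
  have "((\<lambda>z. \<bar>Arg z\<bar>) \<longlongrightarrow> \<bar>Arg (of_real t)\<bar>) (nhds (complex_of_real t))"
    using continuous_at_Arg[OF nr] by (intro tendsto_rabs) (simp only: isCont_def
        tendsto_at_iff_tendsto_nhds)
  moreover have "\<bar>Arg (of_real t)\<bar> < \<delta>" using assms delta_pos by (simp add: Arg_of_real)
  ultimately have "\<forall>\<^sub>F z in nhds (complex_of_real t). \<bar>Arg z\<bar> < \<delta>"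
    by (rule order_tendstoD(2))
  moreover have "\<forall>\<^sub>F z in nhds (complex_of_real t). z \<noteq> 0"
    using assms by (intro t1_space_nhds) auto
  ultimately have "\<forall>\<^sub>F z in nhds (complex_of_real t). z \<in> sector \<delta>"
    by eventually_elim (simp add: sector_def)
  then obtain e where "e > 0" "\<And>z. dist z (complex_of_real t) < e \<Longrightarrow> z \<in> sector \<delta>"
    unfolding eventually_nhds_metric by blast
  thus ?thesis by (intro exI[of _ "e / 2"]) (auto simp: dist_commute)
qed

section \<open>Taylor estimates for scalar orbits, uniform in the vector\<close>

abbreviation orb :: "'a \<Rightarrow> 'a \<Rightarrow> complex \<Rightarrow> complex" where
  "orb y x \<equiv> (\<lambda>z. cinner (S z x) y)"

text \<open>The orbit stands in the slot where the inner product is complex linear, so its complex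
  derivative passes through the pairing. The adjoint orbit as a function of \<open>z\<close> would
  be antiholomorphic instead.\<close>

lemma orb_differentiable: "z \<in> sector \<delta> \<Longrightarrow> orb y x field_differentiable (at z)"
proof -
  assume "z \<in> sector \<delta>"
  then obtain d where "((\<lambda>w. S w x) has_derivative (\<lambda>h. h *\<^sub>C d)) (at z)" using S_deriv by blast
  from bounded_linear.has_derivative[OF bounded_linear_cinner_left this, of y]
  have "(orb y x has_field_derivative cinner d y) (at z)"
    unfolding has_field_derivative_def by (simp add: cinner_scaleC_left mult.commute[of _
        "cinner d y"])
  thus ?thesis unfolding field_differentiable_def by blast
qed

lemma orb_linear:
  assumes "z \<in> sector \<delta>"
  shows "orb y (a + b) z = orb y a z + orb y b z" "orb y (c *\<^sub>C a) z = c * orb y a z"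
    "cmod (orb y a z) \<le> C * norm a * norm y"
proof -
  show "orb y (a + b) z = orb y a z + orb y b z" "orb y (c *\<^sub>C a) z = c * orb y a z"
    using S_lin[OF assms] by (simp_all add: clinear_operator_def cinner_add_left cinner_scaleC_left)
  have "cmod (orb y a z) \<le> norm (S z a) * norm y" by (rule norm_cinner_le)
  also have "\<dots> \<le> C * norm a * norm y" by (intro mult_right_mono S_norm_le assms) auto
  finally show "cmod (orb y a z) \<le> C * norm a * norm y" .
qed

text \<open>Linearity in the vector makes the derivative at \<open>t\<close> a functional to which
  Riesz' theorem applies. The orbits are linear only for \<open>z\<close> in the sector, so the
  functions are compared on a neighbourhood of \<open>t\<close>.\<close>

lemma deriv_orb_linear:
  assumes "t > 0"
  shows "deriv (orb y (a + b)) (of_real t) = deriv (orb y a) (of_real t) +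
      deriv (orb y b) (of_real t)"
    "deriv (orb y (c *\<^sub>C a)) (of_real t) = c * deriv (orb y a) (of_real t)"
proof -
  obtain r where r: "r > 0" "cball (complex_of_real t) r \<subseteq> sector \<delta>"
    using cball_subset_sector[OF assms] by blast
  hence ev: "\<forall>\<^sub>F z in nhds (complex_of_real t). z \<in> sector \<delta>"
    unfolding eventually_nhds_metric by (intro exI[of _ r]) (auto simp: subset_iff dist_commute)
  have "deriv (orb y (a + b)) (of_real t) = deriv (\<lambda>z. orb y a z + orb y b z) (of_real t)"
    by (rule deriv_cong_ev[OF _ refl]) (use ev in \<open>eventually_elim, simp add: orb_linear\<close>)
  thus "deriv (orb y (a + b)) (of_real t) = deriv (orb y a) (of_real t) +
      deriv (orb y b) (of_real t)"
    using orb_differentiable[OF of_real_in_sector[OF assms]] by (simp add: deriv_add)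
  have "deriv (orb y (c *\<^sub>C a)) (of_real t) = deriv (\<lambda>z. c * orb y a z) (of_real t)"
    by (rule deriv_cong_ev[OF _ refl]) (use ev in \<open>eventually_elim, simp add: orb_linear\<close>)
  thus "deriv (orb y (c *\<^sub>C a)) (of_real t) = c * deriv (orb y a) (of_real t)"
    using orb_differentiable[OF of_real_in_sector[OF assms]] by (simp add: deriv_cmult)
qed

text \<open>Cauchy's estimates bound the first two derivatives by a multiple of
  \<open>norm x\<close>. Neither \<open>r\<close> nor \<open>K\<close> depends on \<open>x\<close>;
  this uniformity later allows the passage from weak to norm estimates.\<close>

lemma orb_taylor:
  assumes "t > 0"
  shows "\<exists>r>0. \<exists>K\<ge>0. \<forall>x. \<forall>z\<in>ball (complex_of_real t) r. \<forall>w\<in>ball (complex_of_real t) r.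
     cmod (orb y x z - orb y x w - deriv (orb y x) w * (z - w)) \<le> K * norm x * (cmod (z - w))\<^sup>2 \<and>
     cmod (deriv (orb y x) z - deriv (orb y x) w) \<le> K * norm x * cmod (z - w) \<and>
     cmod (deriv (orb y x) w) \<le> K * norm x"
proof -
  obtain R where R: "R > 0" "cball (complex_of_real t) R \<subseteq> sector \<delta>"
    using cball_subset_sector[OF assms] by blast
  \<comment> \<open>With half the radius, the closed disc of radius \<open>r\<close> around every
    point of the smaller ball still lies in the sector.\<close>
  define r where "r = R / 2"
  have r: "r > 0" using R by (simp add: r_def)
  have sub: "cball w r \<subseteq> sector \<delta>" if "w \<in> ball (complex_of_real t) r" for w
  proof
    fix z assume "z \<in> cball w r"
    hence "dist (complex_of_real t) z \<le> R"
      using that dist_triangle[of "complex_of_real t" z w] by (simp add: r_def)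
    thus "z \<in> sector \<delta>" using R by auto
  qed
  have sub': "ball (complex_of_real t) r \<subseteq> sector \<delta>" using R r by (auto simp: r_def)
  have hol: "orb y x holomorphic_on ball (complex_of_real t) r" for x
    unfolding holomorphic_on_def
    using sub' by (auto intro!: field_differentiable_at_within orb_differentiable)
  define f where "f x n = (deriv ^^ n) (orb y x)" for x n
  have fd: "(f x n has_field_derivative f x (Suc n) w) (at w)"
    if "w \<in> ball (complex_of_real t) r" for x n w
    unfolding f_def using has_field_derivative_higher_deriv[OF hol open_ball that] by simp
  have fb: "cmod (f x n w) \<le> fact n * (C * norm x * norm y) / r ^ n"
    if w: "w \<in> ball (complex_of_real t) r" for x n w
    unfolding f_def
  proof (rule Cauchy_inequality)
    show "orb y x holomorphic_on ball w r"
      unfolding holomorphic_on_def using sub[OF w]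
      by (auto intro!: field_differentiable_at_within orb_differentiable)
    show "continuous_on (cball w r) (orb y x)"
      using sub[OF w] by (intro continuous_at_imp_continuous_on ballI
          field_differentiable_imp_continuous_at
        orb_differentiable) auto
    show "cmod (orb y x v) \<le> C * norm x * norm y" if "cmod (w - v) = r" for v
      using sub[OF w] that by (intro orb_linear) (auto simp: dist_norm)
  qed fact
  \<comment> \<open>The Cauchy bounds for the second and the first derivative, without their common
    factor \<open>norm x\<close>.\<close>
  define K where "K = max (2 * (C * norm y) / r\<^sup>2) ((C * norm y) / r)"
  have C0: "C \<ge> 0" using C_ge_1 by simp
  have K0: "K \<ge> 0" using r C0 by (simp add: K_def le_max_iff_disj)
  have b2: "cmod (f x 2 w) \<le> K * norm x" if "w \<in> ball (complex_of_real t) r" for x w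
  proof -
    have "cmod (f x 2 w) \<le> 2 * (C * norm y) / r\<^sup>2 * norm x"
      using fb[OF that, of x 2] by (simp add: field_simps)
    also have "\<dots> \<le> K * norm x" by (intro mult_right_mono) (auto simp: K_def)
    finally show ?thesis .
  qed
  have b2': "cmod (f x (Suc (Suc 0)) w) \<le> K * norm x" if "w \<in> ball (complex_of_real t) r" for x w
    using b2[OF that] by (simp add: numeral_2_eq_2)
  have b1: "cmod (f x 1 w) \<le> K * norm x" if "w \<in> ball (complex_of_real t) r" for x w
  proof -
    have "cmod (f x 1 w) \<le> (C * norm y) / r * norm x"
      using fb[OF that, of x 1] by (simp add: field_simps)
    also have "\<dots> \<le> K * norm x" by (intro mult_right_mono) (auto simp: K_def)
    finally show ?thesis .
  qed
  have "cmod (orb y x z - orb y x w - deriv (orb y x) w * (z - w)) \<le> K * norm x * (cmod (z - w))\<^sup>2 \<and>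
     cmod (deriv (orb y x) z - deriv (orb y x) w) \<le> K * norm x * cmod (z - w) \<and>
     cmod (deriv (orb y x) w) \<le> K * norm x"
    if zw: "z \<in> ball (complex_of_real t) r" "w \<in> ball (complex_of_real t) r" for x z w
  proof (intro conjI)
    have "cmod (f x 0 z - (\<Sum>i\<le>1. f x i w * (z-w) ^ i / fact i)) \<le>
        K * norm x * cmod (z - w)^(Suc 1) / fact 1"
      by (rule complex_Taylor[where S="ball (complex_of_real t) r"])
        (use zw b2' in \<open>simp_all add: fd has_field_derivative_at_within\<close>)
    thus "cmod (orb y x z - orb y x w - deriv (orb y x) w * (z - w)) \<le>
        K * norm x * (cmod (z - w))\<^sup>2"
      by (simp add: f_def numeral_2_eq_2 algebra_simps)
    \<comment> \<open>The same expansion one derivative higher and one order lower.\<close>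
    have "cmod (f x (Suc 0) z - (\<Sum>i\<le>0. f x (Suc i) w * (z-w) ^ i / fact i)) \<le>
        K * norm x * cmod (z - w)^(Suc 0) / fact 0"
      by (rule complex_Taylor[where S="ball (complex_of_real t) r" and f="\<lambda>i. f x (Suc i)"])
        (use zw b2' in \<open>simp_all add: fd has_field_derivative_at_within\<close>)
    thus "cmod (deriv (orb y x) z - deriv (orb y x) w) \<le> K * norm x * cmod (z - w)"
      by (simp add: f_def)
    show "cmod (deriv (orb y x) w) \<le> K * norm x" using b1[OF zw(2), of x] by (simp add: f_def)
  qed
  thus ?thesis using r K0 by blast
qed

section \<open>Adjoint orbits and their norm derivatives\<close>

definition adj :: "'a \<Rightarrow> real \<Rightarrow> 'a" where
  "adj y t = (SOME h. \<forall>x. cinner (T t x) y = cinner x h)"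

text \<open>The weak derivative of the adjoint orbit, given by Riesz' theorem before any
  differentiability in norm is known; \<open>adj_has_vector_derivative\<close> identifies it as the
  norm derivative.\<close>

definition adj' :: "'a \<Rightarrow> real \<Rightarrow> 'a" where
  "adj' y t = (SOME h. \<forall>x. deriv (orb y x) (of_real t) = cinner x h)"

lemma cinner_adj: "t \<ge> 0 \<Longrightarrow> cinner x (adj y t) = cinner (T t x) y"
proof -
  assume t: "t \<ge> 0"
  have "\<exists>h. \<forall>x. cinner (T t x) y = cinner x h"
  proof (rule riesz_complex[where K="C * norm y"])
    show "cmod (cinner (T t x) y) \<le> C * norm y * norm x" for x
      using norm_cinner_le[of "T t x" y] mult_right_mono[OF T_norm_le[OF t, of x], of "norm y"]
      by (simp add: mult_ac)
  qed (auto simp: T_lin t cinner_add_left cinner_scaleC_left)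
  from someI_ex[OF this] show ?thesis unfolding adj_def by - (rule sym, erule spec)
qed

lemma rinner_adj: "t \<ge> 0 \<Longrightarrow> rinner x (adj y t) = rinner (T t x) y"
  by (simp add: rinner_def cinner_adj)

lemma cinner_adj': "t > 0 \<Longrightarrow> cinner x (adj' y t) = deriv (orb y x) (of_real t)"
proof -
  assume t: "t > 0"
  obtain r K where rK: "r > 0" "\<And>x w. w \<in> ball (complex_of_real t) r \<Longrightarrow>
      cmod (deriv (orb y x) w) \<le> K * norm x"
    using orb_taylor[OF t, of y] by blast
  have "\<exists>h. \<forall>x. deriv (orb y x) (of_real t) = cinner x h"
    by (rule riesz_complex[where K=K]) (use rK deriv_orb_linear[OF t] in auto)
  from someI_ex[OF this] show ?thesis unfolding adj'_def by - (rule sym, erule spec)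
qed

text \<open>Testing with \<open>d\<close> itself turns a bound uniform over all \<open>x\<close>
  into a norm bound.\<close>

lemma norm_le_of_cinner:
  assumes "\<And>x. cmod (cinner x d) \<le> B * norm x" "B \<ge> 0"
  shows "norm d \<le> B"
  using assms(1)[of d] assms(2) by (cases "d =
      0") (simp_all add: cinner_self power2_eq_square norm_mult)

text \<open>The errors in \<open>orb_taylor\<close> are proportional to \<open>norm x\<close>, so
  duality yields a quadratic remainder for the adjoint orbit and a Lipschitz bound for its
  derivative, both in norm.\<close>

lemma adj_local:
  assumes "t > 0"
  shows "\<exists>r>0. \<exists>K. \<forall>s\<in>{t - r<..<t + r}. s > 0 \<longrightarrow>
     norm (adj y s - adj y t - (s - t) *\<^sub>R adj' y t) \<le> K * (s - t)\<^sup>2 \<and>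
     norm (adj' y s - adj' y t) \<le> K * \<bar>s - t\<bar>"
proof -
  obtain r K where r: "r > 0" and K0: "K \<ge> 0" and K: "\<And>x z w. z \<in> ball (complex_of_real t) r \<Longrightarrow>
      w \<in> ball (complex_of_real t) r \<Longrightarrow>
     cmod (orb y x z - orb y x w - deriv (orb y x) w * (z - w)) \<le> K * norm x * (cmod (z - w))\<^sup>2 \<and>
     cmod (deriv (orb y x) z - deriv (orb y x) w) \<le> K * norm x * cmod (z - w)"
    using orb_taylor[OF assms, of y] by metis
  have "norm (adj y s - adj y t - (s - t) *\<^sub>R adj' y t) \<le> K * (s - t)\<^sup>2 \<and>
     norm (adj' y s - adj' y t) \<le> K * \<bar>s - t\<bar>" if s: "s \<in> {t - r<..<t + r}" "s > 0" for s
  proof -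
    have sb: "complex_of_real s \<in> ball (complex_of_real t) r" "complex_of_real t \<in> ball
        (complex_of_real t) r"
      using s r by (auto simp: dist_norm simp flip: of_real_diff)
    have n: "cmod (complex_of_real s - complex_of_real t) = \<bar>s - t\<bar>" by (simp flip: of_real_diff)
    have "norm (adj y s - adj y t - (s - t) *\<^sub>R adj' y t) \<le> K * (s - t)\<^sup>2"
    proof (rule norm_le_of_cinner)
      show "cmod (cinner x (adj y s - adj y t - (s - t) *\<^sub>R adj' y t)) \<le>
          K * (s - t)\<^sup>2 * norm x" for x
        using K[OF sb, of x] s assms
        by (simp add: cinner_diff_right cinner_scaleR_right cinner_adj cinner_adj' T_def n mult_ac)
    qed (use K0 in simp)
    moreover have "norm (adj' y s - adj' y t) \<le> K * \<bar>s - t\<bar>"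
    proof (rule norm_le_of_cinner)
      show "cmod (cinner x (adj' y s - adj' y t)) \<le> K * \<bar>s - t\<bar> * norm x" for x
        using K[OF sb, of x] s assms
        by (simp add: cinner_diff_right cinner_adj' n mult_ac)
    qed (use K0 in simp)
    ultimately show ?thesis by blast
  qed
  thus ?thesis using r by blast
qed

lemma adj_has_vector_derivative:
  assumes "t > 0"
  shows "(adj y has_vector_derivative adj' y t) (at t)"
proof -
  obtain r K where r: "r > 0" and K: "\<And>s. s \<in> {t - r<..<t + r} \<Longrightarrow> s > 0 \<Longrightarrow>
     norm (adj y s - adj y t - (s - t) *\<^sub>R adj' y t) \<le> K * (s - t)\<^sup>2"
    using adj_local[OF assms, of y] by blast
  have "((\<lambda>s. norm (adj y s - adj y t - (s - t) *\<^sub>R adj' y t) / norm (s - t)) \<longlongrightarrow> 0) (at t)"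
  proof (rule Lim_null_comparison)
    have "\<forall>\<^sub>F s in at t. s \<in> {t - r<..<t + r} \<inter> {0<..}"
      using r assms by (intro eventually_at_in_open') auto
    moreover have "\<forall>\<^sub>F s in at t. s \<noteq> t" by (auto simp: eventually_at_filter)
    ultimately show "\<forall>\<^sub>F s in at t. norm (norm (adj y s - adj y t - (s - t) *\<^sub>R adj' y t) / norm
        (s - t)) \<le> K * \<bar>s - t\<bar>"
      by eventually_elim (use K in \<open>auto simp: field_simps power2_eq_square abs_mult_self\<close>)
    have "((\<lambda>s. K * \<bar>s - t\<bar>) \<longlongrightarrow> K * \<bar>t - t\<bar>) (at t)" by (intro tendsto_intros)
    thus "((\<lambda>s. K * \<bar>s - t\<bar>) \<longlongrightarrow> 0) (at t)" by simp
  qed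
  thus ?thesis unfolding has_vector_derivative_def has_derivative_iff_norm
    by (simp add: bounded_linear_scaleR_left)
qed

lemma continuous_on_adj': "continuous_on {0<..} (adj' y)"
proof (rule continuous_at_imp_continuous_on, rule ballI)
  fix t :: real assume "t \<in> {0<..}" hence t: "t > 0" by simp
  obtain r K where r: "r > 0" and K: "\<And>s. s \<in> {t - r<..<t + r} \<Longrightarrow> s > 0 \<Longrightarrow>
     norm (adj' y s - adj' y t) \<le> K * \<bar>s - t\<bar>"
    using adj_local[OF t, of y] by blast
  have "((\<lambda>s. adj' y s - adj' y t) \<longlongrightarrow> 0) (at t)"
  proof (rule Lim_null_comparison)
    have "\<forall>\<^sub>F s in at t. s \<in> {t - r<..<t + r} \<inter> {0<..}"
      using r t by (intro eventually_at_in_open') auto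
    thus "\<forall>\<^sub>F s in at t. norm (adj' y s - adj' y t) \<le> K * \<bar>s - t\<bar>"
      by eventually_elim (use K in auto)
    have "((\<lambda>s. K * \<bar>s - t\<bar>) \<longlongrightarrow> K * \<bar>t - t\<bar>) (at t)" by (intro tendsto_intros)
    thus "((\<lambda>s. K * \<bar>s - t\<bar>) \<longlongrightarrow> 0) (at t)" by simp
  qed
  thus "isCont (adj' y) t" unfolding isCont_def using LIM_zero_iff by blast
qed

lemma continuous_on_adj: "continuous_on {0<..} (adj y)"
  by (intro continuous_at_imp_continuous_on ballI
      has_vector_derivative_continuous[OF adj_has_vector_derivative]) simp

end

section \<open>Strong measurability and Bochner integrals\<close>

text \<open>Replacing all functions by a constant on the exceptional null set makes the convergence
  hold everywhere. Completeness then makes the part of a preimage inside that null set measurable,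
  whatever \<open>f\<close> does there.\<close>

lemma (in complete_measure) borel_measurable_AE_LIMSEQ:
  fixes f :: "'a \<Rightarrow> 'b::metric_space"
  assumes s: "\<And>i. s i \<in> borel_measurable M" and lim: "AE x in M. (\<lambda>i. s i x) \<longlonglongrightarrow> f x"
  shows "f \<in> borel_measurable M"
proof -
  obtain N where N: "N \<in> null_sets M" "\<And>x. x \<in> space M - N \<Longrightarrow> (\<lambda>i. s i x) \<longlonglongrightarrow> f x"
    using AE_E3[OF lim] by blast
  have [measurable]: "N \<in> sets M" using N by auto
  define c :: 'b where "c = undefined"
  define g where "g x = (if x \<in> N then c else f x)" for x
  have g: "g \<in> borel_measurable M"
  proof (rule borel_measurable_LIMSEQ_metric)
    show "(\<lambda>x. if x \<in> N then c else s i x) \<in> borel_measurable M" for i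
      using s by measurable
    show "(\<lambda>i. if x \<in> N then c else s i x) \<longlonglongrightarrow> g x" if "x \<in> space M" for x
      using N(2)[of x] that by (simp add: g_def)
  qed
  show ?thesis
  proof (rule measurableI)
    fix A :: "'b set" assume A: "A \<in> sets borel"
    have eq: "f -` A \<inter> space M = (g -` A \<inter> space M - N) \<union> (f -` A \<inter> space M \<inter> N)"
      by (auto simp: g_def)
    have "g -` A \<inter> space M \<in> sets M" using g A by (rule measurable_sets)
    moreover have "f -` A \<inter> space M \<inter> N \<in> sets M" by (rule complete[OF _ N(1)]) auto
    ultimately have "(g -` A \<inter> space M - N) \<union> (f -` A \<inter> space M \<inter> N) \<in> sets M"
      by (intro sets.Un sets.Diff) auto
    thus "f -` A \<inter> space M \<in> sets M" by (subst eq)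
  qed simp
qed

lemma complete_measure_lebesgue_on: "X \<in> sets lebesgue \<Longrightarrow> complete_measure (lebesgue_on X)"
proof
  fix A B assume X: "X \<in> sets lebesgue" and B: "B \<subseteq> A" and A: "A \<in> null_sets (lebesgue_on X)"
  hence "A \<subseteq> X" "A \<in> null_sets lebesgue" by (auto simp: null_sets_restrict_space)
  moreover have "B \<in> sets lebesgue"
    using completion.complete[OF B] calculation by blast
  ultimately show "B \<in> sets (lebesgue_on X)" using B X by (auto simp: sets_restrict_space_iff)
qed

text \<open>The passage from strong to Borel measurability: simple functions remain simple under
  \<open>g\<close>, and continuity carries the almost everywhere limit along. It is applied to the
  norm and to pairings with fixed vectors.\<close>

lemma strongly_measurable_borel:
  assumes "complete_measure M" "strongly_measurable M f" "continuous_on UNIV g"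
  shows "(\<lambda>x. g (f x) :: 'c::metric_space) \<in> borel_measurable M"
proof -
  obtain s where s: "\<And>i. simple_function M (s i)" "AE x in M. (\<lambda>i. s i x) \<longlonglongrightarrow> f x"
    using assms(2) unfolding strongly_measurable_def by blast
  show ?thesis
  proof (rule complete_measure.borel_measurable_AE_LIMSEQ[OF assms(1)])
    show "(\<lambda>x. g (s i x)) \<in> borel_measurable M" for i
      by (rule borel_measurable_simple_function[OF simple_function_compose1[OF s(1)]])
    show "AE x in M. (\<lambda>i. g (s i x)) \<longlonglongrightarrow> g (f x)"
      using s(2) by eventually_elim (rule continuous_on_tendsto_compose[OF assms(3)], auto)
  qed
qed

lemma borel_measurable_norm_strongly:
  "complete_measure M \<Longrightarrow> strongly_measurable M f \<Longrightarrow> (\<lambda>x. norm (f x)) \<in> borel_measurable M"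
  by (rule strongly_measurable_borel[OF _ _ continuous_on_norm_id])

lemma borel_measurable_rinner_strongly:
  "complete_measure M \<Longrightarrow> strongly_measurable M f \<Longrightarrow> (\<lambda>x. rinner (f x) y) \<in> borel_measurable M"
  by (rule strongly_measurable_borel[OF _ _ linear_continuous_on[OF bounded_linear_rinner_left]])

lemma strongly_measurable_diff:
  assumes "strongly_measurable M f" "strongly_measurable M g"
  shows "strongly_measurable M (\<lambda>x. f x - g x)"
proof -
  obtain s where s: "\<And>i. simple_function M (s i)" "AE x in M. (\<lambda>i. s i x) \<longlonglongrightarrow> f x"
    using assms(1) unfolding strongly_measurable_def by blast
  obtain r where r: "\<And>i. simple_function M (r i)" "AE x in M. (\<lambda>i. r i x) \<longlonglongrightarrow> g x"
    using assms(2) unfolding strongly_measurable_def by blast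
  show ?thesis unfolding strongly_measurable_def
  proof (intro exI conjI allI)
    show "simple_function M (\<lambda>x. s i x - r i x)" for i
      by (rule simple_function_compose2[OF s(1) r(1)])
    show "AE x in M. (\<lambda>i. s i x - r i x) \<longlonglongrightarrow> f x - g x"
      using s(2) r(2) by eventually_elim (rule tendsto_diff)
  qed
qed

lemma strongly_measurable_restrict:
  assumes f: "strongly_measurable (lebesgue_on X) f"
      and "X \<in> sets lebesgue" "Y \<in> sets lebesgue" "Y \<subseteq> X"
  shows "strongly_measurable (lebesgue_on Y) f"
proof -
  obtain s where s: "\<And>i. simple_function (lebesgue_on X) (s i)" "AE x in lebesgue_on X. (\<lambda>i.
      s i x) \<longlonglongrightarrow> f x"
    using f unfolding strongly_measurable_def by blast
  have "simple_function (lebesgue_on Y) (s i)" for i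
  proof -
    have "finite (s i ` X)" and *: "\<And>y. y \<in> X \<Longrightarrow> s i -` {s i y} \<inter> X \<in> sets (lebesgue_on X)"
      using s(1)[of i] unfolding simple_function_def by (auto simp: space_restrict_space)
    have "s i -` {s i y} \<inter> Y \<in> sets (lebesgue_on Y)" if "y \<in> Y" for y
    proof -
      have "s i -` {s i y} \<inter> X \<in> sets lebesgue"
        using *[of y] assms that by (auto simp: sets_restrict_space_iff)
      hence "s i -` {s i y} \<inter> X \<inter> Y \<in> sets lebesgue" using assms by auto
      moreover have "s i -` {s i y} \<inter> X \<inter> Y = s i -` {s i y} \<inter> Y" using assms by auto
      ultimately show ?thesis using assms by (auto simp: sets_restrict_space_iff)
    qed
    moreover have "finite (s i ` Y)" using \<open>finite (s i ` X)\<close> assms(4)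
        by (meson finite_subset image_mono)
    ultimately show ?thesis unfolding simple_function_def by (auto simp: space_restrict_space)
  qed
  moreover have "AE x in lebesgue_on Y. (\<lambda>i. s i x) \<longlonglongrightarrow> f x"
    using s(2) assms by (auto simp: AE_restrict_space_iff elim!: eventually_mono)
  ultimately show ?thesis unfolding strongly_measurable_def by blast
qed

text \<open>Pairing with \<open>y\<close> maps the approximating simple functions and their
  integrals to scalar ones and enlarges the error in mean by at most the factor
  \<open>norm y\<close>. Vector-valued integrals are evaluated through this.\<close>

lemma bochner_has_integral_rinner:
  fixes f :: "'b \<Rightarrow> 'a::complex_hilbert_space"
  assumes "complete_measure M" "bochner_has_integral M f I"
  shows "has_bochner_integral M (\<lambda>x. rinner (f x) y) (rinner I y)"
proof -
  have sm: "strongly_measurable M f" using assms(2) by (simp add: bochner_has_integral_def)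
  obtain s where s: "\<And>i. Bochner_Integration.simple_bochner_integrable M (s i)"
    and n: "(\<lambda>i. \<integral>\<^sup>+ x. ennreal (norm (f x - s i x)) \<partial>M) \<longlonglongrightarrow> 0"
    and l: "(\<lambda>i. Bochner_Integration.simple_bochner_integral M (s i)) \<longlonglongrightarrow> I"
    using assms(2) unfolding bochner_has_integral_def by blast
  have sf: "simple_function M (s i)" for i using s[of i]
      by (auto elim: simple_bochner_integrable.cases)
  have nm: "(\<lambda>x. norm (f x - s i x)) \<in> borel_measurable M" for i
  proof (rule borel_measurable_norm_strongly[OF assms(1)])
    have "strongly_measurable M (s i)" unfolding strongly_measurable_def using sf
        by (intro exI[of _ "\<lambda>_. s i"]) auto
    thus "strongly_measurable M (\<lambda>x. f x - s i x)" by (intro strongly_measurable_diff sm)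
  qed
  show ?thesis
  proof (rule has_bochner_integral.intros)
    show "(\<lambda>x. rinner (f x) y) \<in> borel_measurable M"
      by (rule borel_measurable_rinner_strongly[OF assms(1) sm])
    show "Bochner_Integration.simple_bochner_integrable M (\<lambda>x. rinner (s i x) y)" for i
      by (rule simple_bochner_integrable_compose2[OF _ s s, where p="\<lambda>a b. rinner a y"])
        (simp add: linear_0[OF bounded_linear.linear[OF bounded_linear_rinner_left]])
    have "(\<lambda>i. ennreal (norm y) * (\<integral>\<^sup>+ x. ennreal (norm (f x - s i x)) \<partial>M)) \<longlonglongrightarrow> ennreal (norm y) * 0"
      by (intro ennreal_tendsto_cmult n) simp
    moreover have "(\<integral>\<^sup>+ x. ennreal (norm (rinner (f x) y - rinner (s i x) y)) \<partial>M)
        \<le> ennreal (norm y) * (\<integral>\<^sup>+ x. ennreal (norm (f x - s i x)) \<partial>M)" for i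
    proof -
      have "(\<integral>\<^sup>+ x. ennreal (norm (rinner (f x) y - rinner (s i x) y)) \<partial>M)
        \<le> (\<integral>\<^sup>+ x. ennreal (norm y) * ennreal (norm (f x - s i x)) \<partial>M)"
      proof (intro nn_integral_mono)
        fix x
        have "norm (rinner (f x) y - rinner (s i x) y) \<le> norm y * norm (f x - s i x)"
          using abs_rinner_le[of "f x - s i x" y] by (simp add: rinner_simps mult.commute)
        thus "ennreal (norm (rinner (f x) y - rinner (s i x) y)) \<le>
            ennreal (norm y) * ennreal (norm (f x - s i x))"
          by (simp add: ennreal_mult' [symmetric] ennreal_leI)
      qed
      also have "\<dots> = ennreal (norm y) * (\<integral>\<^sup>+ x. ennreal (norm (f x - s i x)) \<partial>M)"
        by (intro nn_integral_cmult measurable_compose[OF nm measurable_ennreal])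
      finally show ?thesis .
    qed
    ultimately show "(\<lambda>i. \<integral>\<^sup>+ x. ennreal (norm (rinner (f x) y - rinner (s i x) y)) \<partial>M) \<longlonglongrightarrow> 0"
      unfolding mult_zero_right
      by - (rule tendsto_sandwich[OF always_eventually always_eventually tendsto_const], auto)
    have "Bochner_Integration.simple_bochner_integral M (\<lambda>x. rinner (s i x) y)
        = rinner (Bochner_Integration.simple_bochner_integral M (s i)) y" for i
      by (rule simple_bochner_integral_linear[OF bounded_linear.linear[OF
          bounded_linear_rinner_left] s])
    thus "(\<lambda>i. Bochner_Integration.simple_bochner_integral M (\<lambda>x. rinner (s i x) y)) \<longlonglongrightarrow> rinner I y"
      by (simp add: tendsto_rinner l)
  qed
qed

lemma rinner_left_eqI: "(\<And>y. rinner a y = rinner b y) \<Longrightarrow> a = b"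
proof -
  assume "\<And>y. rinner a y = rinner b y"
  hence "rinner (a - b) (a - b) = 0" by (simp add: rinner_simps(3))
  thus "a = b" by (simp add: rinner_self)
qed

text \<open>Uniqueness is inherited from the scalar integrals, because a vector is determined by its
  pairings.\<close>

lemma bochner_integral_eq:
  fixes f :: "'b \<Rightarrow> 'a::complex_hilbert_space"
  assumes "complete_measure M" "bochner_has_integral M f I"
  shows "bochner_integral M f = I"
  unfolding bochner_integral_def
proof (rule the_equality)
  show "bochner_has_integral M f I" by fact
next
  fix J assume J: "bochner_has_integral M f J"
  show "J = I"
    by (rule rinner_left_eqI)
      (meson has_bochner_integral_eq bochner_has_integral_rinner[OF assms(1)] assms(2) J)
qed

lemma norm_simple_bochner_integral_diff_le:
  fixes s t :: "'b \<Rightarrow> 'a::real_normed_vector"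
  assumes s: "Bochner_Integration.simple_bochner_integrable M s"
    and t: "Bochner_Integration.simple_bochner_integrable M t"
  shows "ennreal (norm (Bochner_Integration.simple_bochner_integral M s -
      Bochner_Integration.simple_bochner_integral M t))
    \<le> (\<integral>\<^sup>+ x. ennreal (norm (s x - t x)) \<partial>M)"
proof -
  have d: "Bochner_Integration.simple_bochner_integrable M (\<lambda>x. s x - t x)"
    by (rule simple_bochner_integrable_compose2[OF _ s t]) simp
  have n: "Bochner_Integration.simple_bochner_integrable M (\<lambda>x. norm (s x - t x))"
    by (rule simple_bochner_integrable_compose2[OF _ d d, where p="\<lambda>a b. norm a"]) simp
  have "norm (Bochner_Integration.simple_bochner_integral M s -
      Bochner_Integration.simple_bochner_integral M t)
     = norm (Bochner_Integration.simple_bochner_integral M (\<lambda>x. s x - t x))"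
    by (simp add: simple_bochner_integral_diff[OF s t])
  also have "\<dots> \<le> Bochner_Integration.simple_bochner_integral M (\<lambda>x. norm (s x - t x))"
    by (rule simple_bochner_integral_norm_bound[OF d])
  finally show ?thesis
    using simple_bochner_integral_eq_nn_integral[OF n]
        by (simp flip: ennreal_le_iff2) (metis ennreal_leI)
qed

text \<open>Bochner's criterion. Truncated simple functions converge to \<open>f\<close> in mean by
  dominated convergence, so their integrals form a Cauchy sequence.\<close>

lemma bochner_integrableI:
  fixes f :: "'b \<Rightarrow> 'a::{real_normed_vector,complete_space}"
  assumes cM: "complete_measure M" and fM: "finite_measure M" and sm: "strongly_measurable M f"
    and int: "integrable M (\<lambda>x. norm (f x))"
  shows "bochner_integrable M f"
proof -
  obtain s0 where s0: "\<And>i. simple_function M (s0 i)" "AE x in M. (\<lambda>i. s0 i x) \<longlonglongrightarrow> f x"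
    using sm unfolding strongly_measurable_def by blast
  have nf[measurable]: "(\<lambda>x. norm (f x)) \<in> borel_measurable M"
      by (rule borel_measurable_norm_strongly[OF cM sm])
  \<comment> \<open>With the factor 2 the truncation is eventually inactive wherever
    \<open>f x\<close> is nonzero, while it forces the value 0 where \<open>f x\<close> vanishes.
    The error is at most \<open>3 * norm (f x)\<close>.\<close>
  define s where "s i x = (if norm (s0 i x) \<le> 2 * norm (f x) then s0 i x else 0)" for i x
  have sf: "simple_function M (s i)" for i
  proof -
    have [measurable]: "(\<lambda>x. norm (s0 i x)) \<in> borel_measurable M"
      by (rule borel_measurable_simple_function[OF simple_function_compose1[OF s0(1)]])
    show ?thesis unfolding s_def
      by (intro simple_function_If s0 simple_function_const) measurable
  qed
  have lim: "AE x in M. (\<lambda>i. s i x) \<longlonglongrightarrow> f x"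
    using s0(2)
  proof eventually_elim
    case (elim x)
    show ?case
    proof (cases "f x = 0")
      case True
      hence "s i x = 0" for i by (simp add: s_def)
      thus ?thesis using True by simp
    next
      case False
      have "\<forall>\<^sub>F i in sequentially. norm (s0 i x) < 2 * norm (f x)"
        by (rule order_tendstoD(2)[OF tendsto_norm[OF elim]]) (use False in simp)
      hence "\<forall>\<^sub>F i in sequentially. s0 i x = s i x"
        by eventually_elim (simp add: s_def)
      thus ?thesis using elim tendsto_cong by fastforce
    qed
  qed
  \<comment> \<open>On a finite measure space the support of every simple function has finite
    measure.\<close>
  have sb: "Bochner_Integration.simple_bochner_integrable M (s i)" for i
    using sf finite_measure.emeasure_finite[OF fM] by (intro simple_bochner_integrable.intros) auto
  have smi: "strongly_measurable M (s i)" for i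
    unfolding strongly_measurable_def using sf by (intro exI[of _ "\<lambda>_. s i"]) auto
  have nm: "(\<lambda>x. norm (f x - s i x)) \<in> borel_measurable M" for i
    by (intro borel_measurable_norm_strongly[OF cM] strongly_measurable_diff sm smi)
  have n0: "(\<lambda>i. \<integral>\<^sup>+ x. ennreal (norm (f x - s i x)) \<partial>M) \<longlonglongrightarrow> (\<integral>\<^sup>+ x. 0 \<partial>M)"
  proof (rule nn_integral_dominated_convergence[where w="\<lambda>x. ennreal (3 * norm (f x))"])
    show "(\<lambda>x. ennreal (norm (f x - s i x))) \<in> borel_measurable M" for i
        by (rule measurable_compose[OF nm measurable_ennreal])
    show "AE x in M. ennreal (norm (f x - s i x)) \<le> ennreal (3 * norm (f x))" for i
    proof (rule AE_I2, rule ennreal_leI)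
      fix x
      have "norm (s i x) \<le> 2 * norm (f x)" by (simp add: s_def)
      thus "norm (f x - s i x) \<le> 3 * norm (f x)"
          using norm_triangle_ineq4[of "f x" "s i x"] by linarith
    qed
    have "integrable M (\<lambda>x. 3 * norm (f x))" using int by simp
    thus "(\<integral>\<^sup>+ x. ennreal (3 * norm (f x)) \<partial>M) < \<infinity>"
      using integrableD(2)[of M "\<lambda>x. 3 * norm (f x)"] by (simp add: less_top)
    show "AE x in M. (\<lambda>i. ennreal (norm (f x - s i x))) \<longlonglongrightarrow> 0"
      using lim
    proof eventually_elim
      case (elim x)
      have "(\<lambda>i. ennreal (norm (f x - s i x))) \<longlonglongrightarrow> ennreal (norm (f x - f x))"
        by (intro tendsto_ennrealI tendsto_intros elim)
      thus ?case by simp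
    qed
  qed simp_all
  hence n: "(\<lambda>i. \<integral>\<^sup>+ x. ennreal (norm (f x - s i x)) \<partial>M) \<longlonglongrightarrow> 0" by simp
  define J where "J i = Bochner_Integration.simple_bochner_integral M (s i)" for i
  have J: "ennreal (norm (J i - J j)) \<le> (\<integral>\<^sup>+ x. ennreal (norm (f x - s i x)) \<partial>M) +
      (\<integral>\<^sup>+ x. ennreal (norm (f x - s j x)) \<partial>M)" for i j
  proof -
    have "ennreal (norm (J i - J j)) \<le> (\<integral>\<^sup>+ x. ennreal (norm (s i x - s j x)) \<partial>M)"
      unfolding J_def by (rule norm_simple_bochner_integral_diff_le[OF sb sb])
    also have "\<dots> \<le> (\<integral>\<^sup>+ x. ennreal (norm (f x - s i x)) + ennreal (norm (f x - s j x)) \<partial>M)"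
    proof (intro nn_integral_mono)
      fix x
      have "norm (s i x - s j x) \<le> norm (f x - s i x) + norm (f x - s j x)"
        using norm_triangle_ineq4[of "f x - s j x" "f x - s i x"] by (simp add: algebra_simps)
      thus "ennreal (norm (s i x - s j x)) \<le> ennreal (norm (f x - s i x)) +
          ennreal (norm (f x - s j x))"
        by (simp add: ennreal_leI flip: ennreal_plus)
    qed
    also have "\<dots> = (\<integral>\<^sup>+ x. ennreal (norm (f x - s i x)) \<partial>M) +
        (\<integral>\<^sup>+ x. ennreal (norm (f x - s j x)) \<partial>M)"
      by (intro nn_integral_add measurable_compose[OF nm measurable_ennreal])
    finally show ?thesis .
  qed
  have "Cauchy J"
  proof (rule CauchyI)
    fix e :: real assume e: "e > 0"
    have "\<forall>\<^sub>F i in sequentially. (\<integral>\<^sup>+ x. ennreal (norm (f x - s i x)) \<partial>M) < ennreal (e / 2)"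
      by (rule order_tendstoD(2)[OF n]) (use e in simp)
    then obtain N where N: "\<And>i. i \<ge> N \<Longrightarrow> (\<integral>\<^sup>+ x. ennreal (norm (f x - s i x)) \<partial>M) < ennreal (e / 2)"
      unfolding eventually_sequentially by blast
    have "norm (J i - J j) < e" if "i \<ge> N" "j \<ge> N" for i j
    proof -
      have "ennreal (norm (J i - J j)) < ennreal (e / 2) + ennreal (e / 2)"
        using J[of i j] add_strict_mono[OF N[OF that(1)] N[OF that(2)]] by (rule le_less_trans)
      also have "\<dots> = ennreal e" using e by (simp flip: ennreal_plus)
      finally show ?thesis using e by (simp add: ennreal_less_iff)
    qed
    thus "\<exists>M. \<forall>i\<ge>M. \<forall>j\<ge>M. norm (J i - J j) < e" by blast
  qed
  then obtain I where "J \<longlonglongrightarrow> I" using Cauchy_convergent_iff convergent_def by blast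
  thus ?thesis unfolding bochner_integrable_def bochner_has_integral_def J_def
      using sm sb n by blast
qed

text \<open>Discretising time instead of the range: a continuous function composed with
  \<open>U i\<close> is simple, however large its range. The approximation is from below so that
  \<open>t - U i s\<close> stays nonnegative for \<open>s < t\<close>.\<close>

lemma simple_approx_id:
  obtains U :: "nat \<Rightarrow> real \<Rightarrow> real" where
    "\<And>i. simple_function (lebesgue_on {0<..}) (U i)" "\<And>i s. 0 \<le> U i s"
    "\<And>i s. 0 \<le> s \<Longrightarrow> U i s \<le> s" "\<And>s. 0 \<le> s \<Longrightarrow> (\<lambda>i. U i s) \<longlonglongrightarrow> s"
proof -
  have "(\<lambda>s::real. max 0 s) \<in> borel_measurable (lebesgue_on {0<..})"
    by (intro continuous_imp_measurable_on_sets_lebesgue continuous_intros) auto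
  then obtain U where U: "incseq U" "\<And>i. simple_function (lebesgue_on {0<..}) (U i)"
    "\<And>x. bdd_above (range (\<lambda>i. U i x))" "\<And>i x. 0 \<le> U i x" "(\<lambda>s::real. max 0 s) = (SUP i. U i)"
    using borel_measurable_implies_simple_function_sequence_real[of "\<lambda>s::real. max 0 s"]
        by (metis max.cobounded1)
  have l: "(\<lambda>i. U i s) \<longlonglongrightarrow> s" if "0 \<le> s" for s
  proof -
    have "incseq (\<lambda>i. U i s)" using U(1) by (auto simp: incseq_def le_funD)
    hence "(\<lambda>i. U i s) \<longlonglongrightarrow> (SUP i. U i s)" by (intro LIMSEQ_incseq_SUP U)
    moreover have "max 0 s = (SUP i. U i s)" using fun_cong[OF U(5), of s] unfolding SUP_apply .
    hence "(SUP i. U i s) = s" using that by (metis max.absorb2)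
    ultimately show ?thesis by simp
  qed
  moreover have "U i s \<le> s" if "0 \<le> s" for i s
  proof -
    have "incseq (\<lambda>i. U i s)" using U(1) by (auto simp: incseq_def le_funD)
    thus ?thesis using l[OF that] by (rule incseq_le)
  qed
  ultimately show ?thesis using that U by blast
qed

text \<open>Composition with the discretised identity. Continuity is required on the closed half
  line because \<open>U i s\<close> may be \<open>0\<close>.\<close>

lemma continuous_imp_strongly_measurable:
  assumes "continuous_on {0..} W"
  shows "strongly_measurable (lebesgue_on {0<..}) (W :: real \<Rightarrow> 'a::real_normed_vector)"
proof -
  obtain U where U: "\<And>i. simple_function (lebesgue_on {0<..}) (U i)" "\<And>i s. 0 \<le> U i s"
    "\<And>s::real. 0 \<le> s \<Longrightarrow> (\<lambda>i. U i s) \<longlonglongrightarrow> s" by (rule simple_approx_id) blast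
  show ?thesis unfolding strongly_measurable_def
  proof (intro exI conjI allI)
    show "simple_function (lebesgue_on {0<..}) (\<lambda>s. W (U i s))" for i
      by (rule simple_function_compose1[OF U(1)])
    show "AE s in lebesgue_on {0<..}. (\<lambda>i. W (U i s)) \<longlonglongrightarrow> W s"
    proof (rule AE_I2)
      fix s :: real assume "s \<in> space (lebesgue_on {0<..})"
      hence "0 \<le> s" by (simp add: space_restrict_space)
      thus "(\<lambda>i. W (U i s)) \<longlonglongrightarrow> W s"
        by (intro continuous_on_tendsto_compose[OF assms U(3)]) (use U(2) in auto)
    qed
  qed
qed

section \<open>Strong measurability of the Duhamel integrand\<close>

context bounded_analytic begin

text \<open>Extension by zero puts the integrands for all \<open>t\<close> on the same measure
  space, where they can be subtracted and dominated. The same formula is used with \<open>u\<close>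
  in place of \<open>f\<close>.\<close>

definition duhamel_integrand :: "(real \<Rightarrow> 'a) \<Rightarrow> real \<Rightarrow> real \<Rightarrow> 'a" where
  "duhamel_integrand f t s = (if s < t then T (t - s) (f s) else 0)"

lemma norm_duhamel_integrand_le: "norm (duhamel_integrand f t s) \<le> C * norm (f s)"
  using T_norm_le[of "t - s" "f s"] C_ge_1 by (auto simp: duhamel_integrand_def)

lemma strongly_measurable_duhamel_integrand:
  assumes "strongly_measurable (lebesgue_on {0<..}) f"
  shows "strongly_measurable (lebesgue_on {0<..}) (duhamel_integrand f t)"
proof -
  obtain s0 where s0: "\<And>i. simple_function (lebesgue_on {0<..}) (s0 i)" "AE x in (lebesgue_on
      {0<..}). (\<lambda>i. s0 i x) \<longlonglongrightarrow> f x"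
    using assms unfolding strongly_measurable_def by blast
  obtain U where U: "\<And>i. simple_function (lebesgue_on {0<..}) (U i)" "\<And>i s. 0 \<le> U i s"
    "\<And>i s. 0 \<le> s \<Longrightarrow> U i s \<le> s" "\<And>s::real. 0 \<le> s \<Longrightarrow> (\<lambda>i. U i s) \<longlonglongrightarrow> s"
    by (rule simple_approx_id) blast
  \<comment> \<open>Both the time argument and the vector are discretised; a function of two simple
    functions is simple.\<close>
  define g where "g i s = (if s < t then T (t - U i s) (s0 i s) else 0)" for i s
  show ?thesis unfolding strongly_measurable_def
  proof (intro exI conjI allI)
    have "{x \<in> space (lebesgue_on {0<..}). x < t} = {0<..<t}" by (auto simp: space_restrict_space)
    hence "{x \<in> space (lebesgue_on {0<..}). x < t} \<in> sets (lebesgue_on {0<..})"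
      by (auto simp: sets_restrict_space_iff)
    thus "simple_function (lebesgue_on {0<..}) (g i)" for i unfolding g_def
      by (intro simple_function_If simple_function_const
          simple_function_compose2[OF U(1) s0(1), where h="\<lambda>a b. T (t - a) b"])
    have "AE x in lebesgue_on {0<..}. x > 0" by (rule AE_I2) (simp add: space_restrict_space)
    with s0(2) show "AE s in lebesgue_on {0<..}. (\<lambda>i. g i s) \<longlonglongrightarrow> duhamel_integrand f t s"
    proof eventually_elim
      case (elim s)
      show ?case
      proof (cases "s < t")
        case True
        have "(\<lambda>i. t - U i s) \<longlonglongrightarrow> t - s" by (intro tendsto_intros U) (use elim in simp)
        moreover have Ut: "t - U i s \<ge> 0" for i using U(3)[of s i] elim True by simp
        ultimately have 1: "(\<lambda>i. T (t - U i s) (f s)) \<longlonglongrightarrow> T (t - s) (f s)"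
          by (intro continuous_on_tendsto_compose[OF continuous_on_T]) (use True in auto)
        \<comment> \<open>The operator varies with \<open>i\<close>, but the uniform bound
          \<open>C\<close> reduces the claim to the convergence of \<open>s0 i s\<close>.\<close>
        have 2: "(\<lambda>i. T (t - U i s) (s0 i s - f s)) \<longlonglongrightarrow> 0"
        proof (rule Lim_null_comparison[OF always_eventually])
          show "\<forall>i. norm (T (t - U i s) (s0 i s - f s)) \<le> C * norm (s0 i s - f s)"
            using T_norm_le Ut by blast
          have "(\<lambda>i. C * norm (s0 i s - f s)) \<longlonglongrightarrow> C * norm (f s - f s)"
            by (intro tendsto_intros elim)
          thus "(\<lambda>i. C * norm (s0 i s - f s)) \<longlonglongrightarrow> 0" by simp
        qed
        have "(\<lambda>i. T (t - U i s) (s0 i s - f s) + T (t - U i s) (f s)) \<longlonglongrightarrow> 0 + T (t - s) (f s)"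
          by (intro tendsto_add 1 2)
        moreover have "T (t - U i s) (s0 i s - f s) + T (t - U i s) (f s) =
            T (t - U i s) (s0 i s)" for i
          using T_lin(4)[OF Ut] by simp
        ultimately show ?thesis using True by (simp add: g_def duhamel_integrand_def)
      qed (simp add: g_def duhamel_integrand_def)
    qed
  qed
qed

end

section \<open>The Duhamel integral\<close>

lemma lebesgue_on_if:
  fixes g :: "real \<Rightarrow> real"
  assumes "X \<in> sets lebesgue" "Y \<in> sets lebesgue" "Y \<subseteq> X"
  shows "integrable (lebesgue_on X) (\<lambda>s. if s \<in> Y then g s else 0) \<longleftrightarrow> integrable (lebesgue_on Y) g"
    and "(\<integral>s. (if s \<in> Y then g s else 0) \<partial>lebesgue_on X) = (\<integral>s. g s \<partial>lebesgue_on Y)"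
proof -
  have eq: "(\<lambda>s. indicator X s * (if s \<in> Y then g s else 0)) = (\<lambda>s. indicator Y s * g s)"
    using assms(3) by (auto simp: indicator_def fun_eq_iff)
  show "integrable (lebesgue_on X) (\<lambda>s. if s \<in> Y then g s else 0) \<longleftrightarrow> integrable (lebesgue_on Y) g"
    using assms by (simp add: integrable_restrict_space eq)
  show "(\<integral>s. (if s \<in> Y then g s else 0) \<partial>lebesgue_on X) = (\<integral>s. g s \<partial>lebesgue_on Y)"
    using assms by (simp add: integral_restrict_space eq)
qed

lemma integrable_lebesgue_on_subset:
  fixes g :: "real \<Rightarrow> real"
  assumes "integrable (lebesgue_on X) g" "X \<in> sets lebesgue" "Y \<in> sets lebesgue" "Y \<subseteq> X"
  shows "integrable (lebesgue_on Y) g"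
  using assms set_integrable_subset[of lebesgue X g Y]
  by (simp add: integrable_restrict_space set_integrable_def)

lemma AE_lebesgue_on_neq: "X \<in> sets lebesgue \<Longrightarrow> AE s in lebesgue_on X. s \<noteq> (t::real)"
  using AE_completion[OF AE_lborel_singleton[of t]]
      by (auto simp: AE_restrict_space_iff elim: eventually_mono)

text \<open>The pointwise form of Cauchy-Schwarz, \<open>a * b \<le> a\<^sup>2 + b\<^sup>2\<close>,
  splits the norm into the weighted square and \<open>s powr (- \<beta>)\<close>; the latter is
  integrable at \<open>0\<close> because \<open>\<beta> < 1\<close>. In this form the weight enters
  the rest of the proof.\<close>

lemma L2_weighted_norm_integrable:
  assumes f: "f \<in> L2_weighted \<beta>" and b: "\<beta> < 1"
  shows "integrable (lebesgue_on {0<..<t}) (\<lambda>s. norm (f s))"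
proof -
  have sm: "strongly_measurable (lebesgue_on {0<..<t}) f"
    using f by (auto simp: L2_weighted_def intro!: strongly_measurable_restrict[of "{0<..}"])
  have "integrable (lebesgue_on {0<..}) (\<lambda>s. (norm (f s))\<^sup>2 * s powr \<beta>)"
    using f by (simp add: L2_weighted_def)
  hence i1: "integrable (lebesgue_on {0<..<t}) (\<lambda>s. (norm (f s))\<^sup>2 * s powr \<beta>)"
    by (rule integrable_lebesgue_on_subset) auto
  \<comment> \<open>The endpoint \<open>max 0 t\<close> gives a valid interval for negative
    \<open>t\<close> as well.\<close>
  have "(\<lambda>s. s powr (- \<beta>)) absolutely_integrable_on {0..max 0 t}"
    by (rule nonnegative_absolutely_integrable_1)
      (use b in \<open>auto intro!: integrable_on_powr_from_0\<close>)
  hence "integrable (lebesgue_on {0..max 0 t}) (\<lambda>s. s powr (- \<beta>))"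
    by (simp add: set_integrable_def integrable_restrict_space)
  hence i2: "integrable (lebesgue_on {0<..<t}) (\<lambda>s. s powr (- \<beta>))"
    by (rule integrable_lebesgue_on_subset) auto
  show ?thesis
  proof (rule Bochner_Integration.integrable_bound[OF Bochner_Integration.integrable_add[OF i1 i2]])
    show "(\<lambda>s. norm (f s)) \<in> borel_measurable (lebesgue_on {0<..<t})"
      by (intro borel_measurable_norm_strongly complete_measure_lebesgue_on sm) auto
    show "AE s in lebesgue_on {0<..<t}. norm (norm (f s)) \<le>
        norm ((norm (f s))\<^sup>2 * s powr \<beta> + s powr (- \<beta>))"
    proof (rule AE_I2)
      fix s assume "s \<in> space (lebesgue_on {0<..<t})"
      hence s: "s > 0" by (simp add: space_restrict_space)
      define a where "a = norm (f s) * s powr (\<beta> / 2)"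
      define b where "b = s powr (- \<beta> / 2)"
      have "a * b = norm (f s) * (s powr (\<beta> / 2) * s powr (- \<beta> / 2))" by (simp add: a_def b_def)
      also have "\<dots> = norm (f s)" using s by (simp flip: powr_add)
      finally have ab: "a * b = norm (f s)" .
      have "a\<^sup>2 = (norm (f s))\<^sup>2 * s powr \<beta>" "b\<^sup>2 = s powr (- \<beta>)"
        using s by (simp_all add: a_def b_def power_mult_distrib power2_eq_square flip: powr_add)
      moreover have "a * b \<le> a\<^sup>2 + b\<^sup>2"
        using sum_squares_bound[of a b] zero_le_power2[of a] zero_le_power2[of b] by linarith
      ultimately show "norm (norm (f s)) \<le> norm ((norm (f s))\<^sup>2 * s powr \<beta> + s powr (- \<beta>))"
        using ab by simp
    qed
  qed
qed

section \<open>The Duhamel integral: existence, pairings and continuity\<close>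

context bounded_analytic begin

context
  fixes f :: "real \<Rightarrow> 'a"
  assumes f_sm: "strongly_measurable (lebesgue_on {0<..}) f"
    and f_int: "\<And>t. integrable (lebesgue_on {0<..<t}) (\<lambda>s. norm (f s))"
begin

lemma duhamel_integrand_restrict_sm:
  "strongly_measurable (lebesgue_on {0<..<t}) (\<lambda>s. T (t - s) (f s))"
proof -
  have "strongly_measurable (lebesgue_on {0<..<t}) (duhamel_integrand f t)"
    by (rule strongly_measurable_restrict[OF strongly_measurable_duhamel_integrand[OF f_sm]]) auto
  then obtain s where s: "\<And>i. simple_function (lebesgue_on {0<..<t}) (s i)"
     "AE x in lebesgue_on {0<..<t}. (\<lambda>i. s i x) \<longlonglongrightarrow> duhamel_integrand f t x"
    unfolding strongly_measurable_def by blast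
  have "AE x in lebesgue_on {0<..<t}. x < t" by (rule AE_I2) (simp add: space_restrict_space)
  with s(2) have "AE x in lebesgue_on {0<..<t}. (\<lambda>i. s i x) \<longlonglongrightarrow> T (t - x) (f x)"
    by eventually_elim (simp add: duhamel_integrand_def)
  thus ?thesis unfolding strongly_measurable_def using s(1) by blast
qed

lemma duhamel_bochner_integrable:
  "bochner_integrable (lebesgue_on {0<..<t}) (\<lambda>s. T (t - s) (f s))"
proof (rule bochner_integrableI)
  have cM: "complete_measure (lebesgue_on {0<..<t})" by (rule complete_measure_lebesgue_on) auto
  show "complete_measure (lebesgue_on {0<..<t})" by fact
  have "{0<..<t} \<in> lmeasurable" by (cases "0 \<le> t") (auto intro: bounded_set_imp_lmeasurable)
  thus "finite_measure (lebesgue_on {0<..<t})" by (rule finite_measure_lebesgue_on)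
  show "integrable (lebesgue_on {0<..<t}) (\<lambda>s. norm (T (t - s) (f s)))"
  proof (rule Bochner_Integration.integrable_bound)
    show "integrable (lebesgue_on {0<..<t}) (\<lambda>s. C * norm (f s))" using f_int by simp
    show "(\<lambda>s. norm (T (t - s) (f s))) \<in> borel_measurable (lebesgue_on {0<..<t})"
      by (rule borel_measurable_norm_strongly[OF cM duhamel_integrand_restrict_sm])
    show "AE s in lebesgue_on {0<..<t}. norm (norm (T (t - s) (f s))) \<le> norm (C * norm (f s))"
      by (rule AE_I2) (use T_norm_le C_ge_1 in \<open>auto simp: space_restrict_space\<close>)
  qed
qed (rule duhamel_integrand_restrict_sm)

definition duhamel :: "real \<Rightarrow> 'a" where
  "duhamel t = bochner_integral (lebesgue_on {0<..<t}) (\<lambda>s. T (t - s) (f s))"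

lemma rinner_duhamel_restrict:
  "integrable (lebesgue_on {0<..<t}) (\<lambda>s. rinner (T (t - s) (f s)) y)"
  "rinner (duhamel t) y = (\<integral>s. rinner (T (t - s) (f s)) y \<partial>lebesgue_on {0<..<t})"
proof -
  have cM: "complete_measure (lebesgue_on {0<..<t})" by (rule complete_measure_lebesgue_on) auto
  obtain I where I: "bochner_has_integral (lebesgue_on {0<..<t}) (\<lambda>s. T (t - s) (f s)) I"
    using duhamel_bochner_integrable unfolding bochner_integrable_def by blast
  have "has_bochner_integral (lebesgue_on {0<..<t}) (\<lambda>s. rinner (T (t - s) (f s)) y) (rinner
      (duhamel t) y)"
    using bochner_has_integral_rinner[OF cM I] bochner_integral_eq[OF cM I]
        by (simp add: duhamel_def)
  thus "integrable (lebesgue_on {0<..<t}) (\<lambda>s. rinner (T (t - s) (f s)) y)"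
    "rinner (duhamel t) y = (\<integral>s. rinner (T (t - s) (f s)) y \<partial>lebesgue_on {0<..<t})"
    by (auto simp: has_bochner_integral_iff)
qed

lemma duhamel_integrand_if: "s \<in> {0<..} \<Longrightarrow> rinner (duhamel_integrand f t s) y =
    (if s \<in> {0<..<t} then rinner (T (t - s) (f s)) y else 0)"
  by (auto simp: duhamel_integrand_def rinner_zero)

lemma rinner_duhamel:
  "integrable (lebesgue_on {0<..}) (\<lambda>s. rinner (duhamel_integrand f t s) y)"
  "rinner (duhamel t) y = (\<integral>s. rinner (duhamel_integrand f t s) y \<partial>lebesgue_on {0<..})"
proof -
  have "integrable (lebesgue_on {0<..}) (\<lambda>s. if s \<in> {0<..<t} then rinner (T (t - s) (f
      s)) y else 0)"
    and "(\<integral>s. (if s \<in> {0<..<t} then rinner (T (t - s) (f s)) y else 0) \<partial>lebesgue_on {0<..}) =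
        rinner (duhamel t) y"
    using rinner_duhamel_restrict by (subst lebesgue_on_if; auto)+
  moreover have "integrable (lebesgue_on {0<..}) (\<lambda>s. rinner (duhamel_integrand f t s) y) \<longleftrightarrow>
      integrable (lebesgue_on {0<..}) (\<lambda>s. if s \<in> {0<..<t} then rinner (T (t - s) (f s)) y else 0)"
    by (intro Bochner_Integration.integrable_cong refl duhamel_integrand_if) (simp add:
        space_restrict_space)
  moreover have "(\<integral>s. rinner (duhamel_integrand f t s) y \<partial>lebesgue_on {0<..}) =
      (\<integral>s. (if s \<in> {0<..<t} then rinner (T (t - s) (f s)) y else 0) \<partial>lebesgue_on {0<..})"
    by (intro Bochner_Integration.integral_cong refl duhamel_integrand_if) (simp add:
        space_restrict_space)
  ultimately show "integrable (lebesgue_on {0<..}) (\<lambda>s. rinner (duhamel_integrand f t s) y)"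
    "rinner (duhamel t) y = (\<integral>s. rinner (duhamel_integrand f t s) y \<partial>lebesgue_on
        {0<..})" by simp_all
qed

lemma f_dom_int: "integrable (lebesgue_on {0<..}) (\<lambda>s. if s \<in> {0<..<B} then norm (f s) else 0)"
  using f_int by (subst lebesgue_on_if) auto

lemma norm_duhamel_integrand_dom: "s \<in> {0<..} \<Longrightarrow> t \<le> B \<Longrightarrow>
    norm (duhamel_integrand f t s) \<le> C * (if s \<in> {0<..<B} then norm (f s) else 0)"
  using norm_duhamel_integrand_le[of f t s] C_ge_1 by (auto simp: duhamel_integrand_def)

lemma norm_duhamel_integrand_diff_dom:
  assumes "s \<in> {0<..}" "t \<le> B" "t' \<le> B"
  shows "norm (duhamel_integrand f t s - duhamel_integrand f t' s) \<le>
      2 * C * (if s \<in> {0<..<B} then norm (f s) else 0)"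
proof -
  have "norm (duhamel_integrand f t s - duhamel_integrand f t' s) \<le>
      norm (duhamel_integrand f t s) + norm (duhamel_integrand f t' s)"
      by (rule norm_triangle_ineq4)
  also have "\<dots> \<le> C * (if s \<in> {0<..<B} then norm (f s) else 0) +
      C * (if s \<in> {0<..<B} then norm (f s) else 0)"
    by (intro add_mono norm_duhamel_integrand_dom assms)
  finally show ?thesis by simp
qed

lemma duhamel_integrand_diff_meas: "(\<lambda>s. norm (duhamel_integrand f t s - duhamel_integrand f t'
    s)) \<in> borel_measurable (lebesgue_on {0<..})"
  by (intro borel_measurable_norm_strongly complete_measure_lebesgue_on strongly_measurable_diff
      strongly_measurable_duhamel_integrand f_sm) auto

lemma duhamel_integrand_diff_int: "integrable (lebesgue_on {0<..}) (\<lambda>s. norm (duhamel_integrand f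
    t s - duhamel_integrand f t' s))"
proof (rule Bochner_Integration.integrable_bound)
  show "integrable (lebesgue_on {0<..}) (\<lambda>s. 2 * C * (if s \<in> {0<..<max t t'} then norm (f
      s) else 0))"
    by (intro integrable_mult_right f_dom_int)
  show "AE s in lebesgue_on {0<..}. norm (norm (duhamel_integrand f t s - duhamel_integrand f t'
      s)) \<le> norm (2 * C * (if s \<in> {0<..<max t t'} then norm (f s) else 0))"
  proof (rule AE_I2)
    fix s assume "s \<in> space (lebesgue_on {0::real<..})"
    thus "norm (norm (duhamel_integrand f t s - duhamel_integrand f t' s)) \<le>
        norm (2 * C * (if s \<in> {0<..<max t t'} then norm (f s) else 0))"
      using norm_duhamel_integrand_diff_dom[of s t "max t t'" t']
          by (simp add: space_restrict_space)
  qed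
qed (rule duhamel_integrand_diff_meas)

text \<open>Pairing the difference with itself expresses its squared norm as a scalar integral; one
  factor \<open>norm d\<close> is then cancelled.\<close>

lemma norm_duhamel_diff_le: "norm (duhamel t - duhamel t') \<le>
    (\<integral>s. norm (duhamel_integrand f t s - duhamel_integrand f t' s) \<partial>lebesgue_on {0<..})"
proof (cases "duhamel t = duhamel t'")
  case False
  define d where "d = duhamel t - duhamel t'"
  have "norm d * norm d = rinner d d" by (simp add: rinner_self power2_eq_square)
  also have "\<dots> = (\<integral>s. rinner (duhamel_integrand f t s - duhamel_integrand f t' s) d
      \<partial>lebesgue_on {0<..})"
    by (simp add: d_def rinner_simps rinner_duhamel)
  also have "\<dots> \<le> (\<integral>s. norm (duhamel_integrand f t s - duhamel_integrand f t' s) * norm d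
      \<partial>lebesgue_on {0<..})"
  proof (rule integral_mono)
    show "integrable (lebesgue_on {0<..}) (\<lambda>s. rinner (duhamel_integrand f t s -
        duhamel_integrand f t' s) d)"
      by (simp add: rinner_simps rinner_duhamel)
    show "integrable (lebesgue_on {0<..}) (\<lambda>s. norm (duhamel_integrand f t s - duhamel_integrand f
        t' s) * norm d)"
      by (intro integrable_mult_left duhamel_integrand_diff_int)
    show "rinner (duhamel_integrand f t s - duhamel_integrand f t' s) d \<le>
        norm (duhamel_integrand f t s - duhamel_integrand f t' s) * norm d" for s
      using abs_rinner_le[of "duhamel_integrand f t s - duhamel_integrand f t' s" d] by linarith
  qed
  finally show ?thesis using False by (simp add: d_def)
qed (simp add: integral_nonneg)

text \<open>Away from the diagonal the cutoff \<open>s < x n\<close> is eventually constant, so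
  strong continuity of the semigroup decides. At \<open>s = t\<close> the cutoff may jump.\<close>

lemma duhamel_integrand_tendsto:
  assumes x: "x \<longlonglongrightarrow> t" and "s \<noteq> t"
  shows "(\<lambda>n. duhamel_integrand f (x n) s) \<longlonglongrightarrow> duhamel_integrand f t s"
proof (cases "s < t")
  case True
  have ev: "\<forall>\<^sub>F n in sequentially. s < x n" by (rule order_tendstoD(1)[OF x True])
  have "(\<lambda>n. T (x n - s) (f s)) \<longlonglongrightarrow> T (t - s) (f s)"
  proof (rule continuous_on_tendsto_compose[OF continuous_on_T])
    show "(\<lambda>n. x n - s) \<longlonglongrightarrow> t - s" by (intro tendsto_intros x)
    show "\<forall>\<^sub>F n in sequentially. x n - s \<in> {0..}" using ev by eventually_elim simp
  qed (use True in simp)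
  moreover have "\<forall>\<^sub>F n in sequentially. duhamel_integrand f (x n) s = T (x n - s) (f s)"
    using ev by eventually_elim (simp add: duhamel_integrand_def)
  ultimately show ?thesis using True by (simp add: duhamel_integrand_def tendsto_cong)
next
  case False
  hence "\<forall>\<^sub>F n in sequentially. x n < s" using assms by (intro order_tendstoD(2)[OF x]) auto
  hence "\<forall>\<^sub>F n in sequentially. duhamel_integrand f (x n) s =
      0" by eventually_elim (simp add: duhamel_integrand_def)
  thus ?thesis using False by (simp add: duhamel_integrand_def tendsto_cong)
qed

text \<open>Dominated convergence for the norms of differences of integrands; the diagonal is a null
  set.\<close>

lemma continuous_on_duhamel: "continuous_on {0..} duhamel"
  unfolding continuous_on_sequentially
proof (intro ballI allI impI)
  fix t :: real and x assume t: "t \<in> {0..}" and "(\<forall>n. x n \<in> {0..}) \<and> x \<longlonglongrightarrow> t"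
  hence x: "x \<longlonglongrightarrow> t" by simp
  \<comment> \<open>A common upper bound for all the times involved, so that one majorant serves the
    whole sequence.\<close>
  obtain B where B: "\<And>n. x n \<le> B" "t \<le> B"
  proof -
    have "Bseq x" using x convergent_imp_Bseq convergent_def by blast
    then obtain K where K: "\<And>n. norm (x n) \<le> K" unfolding Bseq_def by blast
    show ?thesis
    proof (rule that)
      show "x n \<le> max K t" for n using K[of n] by auto
    qed simp
  qed
  have "(\<lambda>n. \<integral>s. norm (duhamel_integrand f (x n) s - duhamel_integrand f t s) \<partial>lebesgue_on {0<..})
      \<longlonglongrightarrow> (\<integral>s. 0 \<partial>lebesgue_on {0::real<..})"
  proof (rule integral_dominated_convergence[where w="\<lambda>s. 2 * C * (if s \<in> {0<..<B} then norm (f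
      s) else 0)"])
    show "integrable (lebesgue_on {0<..}) (\<lambda>s. 2 * C * (if s \<in> {0<..<B} then norm (f s) else 0))"
      by (intro integrable_mult_right f_dom_int)
    show "AE s in lebesgue_on {0<..}. norm (norm (duhamel_integrand f (x n) s - duhamel_integrand
        f t s)) \<le> 2 * C * (if s \<in> {0<..<B} then norm (f s) else 0)" for n
    proof (rule AE_I2)
      fix s assume "s \<in> space (lebesgue_on {0::real<..})"
      hence "s \<in> {0<..}" by (simp add: space_restrict_space)
      from norm_duhamel_integrand_diff_dom[OF this B(1) B(2)]
      show "norm (norm (duhamel_integrand f (x n) s - duhamel_integrand f t s)) \<le>
          2 * C * (if s \<in> {0<..<B} then norm (f s) else 0)" by simp
    qed
    have "AE s in lebesgue_on {0<..}. s \<noteq> t" by (rule AE_lebesgue_on_neq) auto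
    thus "AE s in lebesgue_on {0<..}. (\<lambda>n. norm (duhamel_integrand f (x n) s - duhamel_integrand
        f t s)) \<longlonglongrightarrow> 0"
    proof eventually_elim
      case (elim s)
      have "(\<lambda>n. norm (duhamel_integrand f (x n) s - duhamel_integrand f t s)) \<longlonglongrightarrow> norm
          (duhamel_integrand f t s - duhamel_integrand f t s)"
        by (intro tendsto_intros duhamel_integrand_tendsto x elim)
      thus ?case by simp
    qed
  qed (use duhamel_integrand_diff_meas in simp_all)
  hence l: "(\<lambda>n. \<integral>s. norm (duhamel_integrand f (x n) s - duhamel_integrand f t s) \<partial>lebesgue_on
      {0<..}) \<longlonglongrightarrow> 0" by simp
  have "(\<lambda>n. duhamel (x n) - duhamel t) \<longlonglongrightarrow> 0"
    by (rule Lim_null_comparison[OF always_eventually l]) (use norm_duhamel_diff_le in blast)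
  thus "(duhamel \<circ> x) \<longlonglongrightarrow> duhamel t" unfolding comp_def using LIM_zero_iff by blast
qed

lemma duhamel_0: "duhamel 0 = 0"
proof (rule rinner_left_eqI)
  fix y
  have "rinner (duhamel 0) y = (\<integral>s. rinner (T (0 - s) (f s)) y \<partial>lebesgue_on {0<..<0})"
    by (rule rinner_duhamel_restrict)
  also have "\<dots> = 0" by (simp add: integral_restrict_space)
  finally show "rinner (duhamel 0) y = rinner 0 y" by (simp add: rinner_zero)
qed

end
end

section \<open>Weak derivatives of locally integrable functions\<close>

text \<open>Fubini for \<open>k r * F s\<close> on the half plane \<open>r \<le> s\<close>.
  Integrating over \<open>r\<close> first produces \<open>\<eta> s\<close>; integrating over
  \<open>s\<close> first produces the total integral of \<open>F\<close> minus its primitive, and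
  the total drops out because \<open>k\<close> has integral zero.\<close>

lemma integral_by_parts_C1_L1:
  fixes F \<eta> k :: "real \<Rightarrow> real"
  assumes F: "integrable lebesgue F"
    and \<eta>: "\<And>s. (\<eta> has_real_derivative k s) (at s)" and k: "continuous_on UNIV k"
    and supp: "\<And>s. s \<notin> {a..b} \<Longrightarrow> \<eta> s = 0" "\<And>s. s \<notin> {a..b} \<Longrightarrow> k s = 0"
  shows "(\<integral>s. \<eta> s * F s \<partial>lebesgue) = - (\<integral>r. k r * (\<integral>s. (if s < r then F s else 0)
      \<partial>lebesgue) \<partial>lebesgue)"
proof -
  \<comment> \<open>A Borel representative of \<open>F\<close>, so that the integrand is measurable
    on the product of the Borel measures.\<close>
  obtain G where G[measurable]: "G \<in> borel_measurable lborel" and FG: "AE s in lborel. F s = G s"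
    using completion_ex_borel_measurable_real[of F lborel] F by auto
  have FG': "AE s in lebesgue. F s = G s" using FG by (rule AE_completion)
  have Gl: "G \<in> borel_measurable lebesgue" by (rule measurable_completion[OF G])
  have intG': "integrable lebesgue G" by (rule integrable_cong_AE_imp[OF F Gl FG'])
  have intG: "integrable lborel G" using intG' G integrable_completion by blast
  have km[measurable]: "k \<in> borel_measurable borel" by (rule borel_measurable_continuous_onI[OF k])
  have \<eta>c: "continuous_on UNIV \<eta>" using \<eta> DERIV_isCont continuous_at_imp_continuous_on by blast
  have \<eta>m[measurable]: "\<eta> \<in> borel_measurable borel" by (rule borel_measurable_continuous_onI[OF \<eta>c])
  have kc: "isCont k s" for s using k by (simp add: continuous_on_eq_continuous_at)
  have ftc: "has_bochner_integral lborel (\<lambda>r. k r * indicator {x..y} r) (\<eta> y - \<eta> x)"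
      if "x \<le> y" for x y
    by (rule has_bochner_integral_FTC_Icc_real[OF that \<eta> kc])
  \<comment> \<open>The lower limit lies to the left of the support and of \<open>s\<close>: the
    interval is never empty and \<open>\<eta>\<close> vanishes at its left end.\<close>
  have kind: "k r * indicator {min a s - 1..s} r = (if r \<le> s then k r else 0)" for r s
    using supp(2)[of r] by (auto simp: indicator_def min_def split: if_splits)
  have kint: "has_bochner_integral lborel (\<lambda>r. if r \<le> s then k r else 0) (\<eta> s)" for s
  proof -
    have "\<eta> (min a s - 1) = 0" by (rule supp) auto
    thus ?thesis using ftc[of "min a s - 1" s] unfolding kind by simp
  qed
  have kall: "has_bochner_integral lborel k 0"
  proof -
    have "(\<lambda>r. if r \<le> b + 1 then k r else 0) = k" using supp(2) by (auto simp: fun_eq_iff)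
    moreover have "\<eta> (b + 1) = 0" by (rule supp) auto
    ultimately show ?thesis using kint[of "b + 1"] by simp
  qed
  have i1: "integrable (lborel \<Otimes>\<^sub>M lborel) (\<lambda>(r, s). k r * G s)"
  proof (rule lborel_pair.Fubini_integrable)
    show "(\<lambda>(r, s). k r * G s) \<in> borel_measurable (lborel \<Otimes>\<^sub>M lborel)" by measurable
    have "(\<lambda>r. \<integral>s. norm (case (r, s) of (r, s) \<Rightarrow> k r * G s) \<partial>lborel) =
        (\<lambda>r. \<bar>k r\<bar> * (\<integral>s. \<bar>G s\<bar> \<partial>lborel))"
      by (simp add: abs_mult)
    moreover have "integrable lborel k" using kall by (simp add: has_bochner_integral_iff)
    ultimately show "integrable lborel (\<lambda>r. \<integral>s. norm (case (r, s) of (r, s) \<Rightarrow> k r * G s) \<partial>lborel)"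
      by (simp add: integrable_abs)
    show "AE r in lborel. integrable lborel (\<lambda>s. case (r, s) of (r, s) \<Rightarrow> k r * G s)"
      using intG by (intro AE_I2) simp
  qed
  define h where "h r s = (if r \<le> s then k r * G s else 0)" for r s
  have i2: "integrable (lborel \<Otimes>\<^sub>M lborel) (\<lambda>(r, s). h r s)"
  proof (rule Bochner_Integration.integrable_bound[OF i1])
    show "(\<lambda>(r, s). h r s) \<in> borel_measurable (lborel \<Otimes>\<^sub>M lborel)" unfolding h_def by measurable
    show "AE x in lborel \<Otimes>\<^sub>M lborel. norm (case x of (r, s) \<Rightarrow> h r s) \<le>
        norm (case x of (r, s) \<Rightarrow> k r * G s)"
      by (rule AE_I2) (auto simp: h_def)
  qed
  have Gi: "integrable lborel (\<lambda>s. if P s then G s else 0)"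
      if [measurable]: "Measurable.pred borel P" for P
    by (rule Bochner_Integration.integrable_bound[OF intG]) auto
  define \<Phi> where "\<Phi> r = (\<integral>s. (if s < r then F s else 0) \<partial>lebesgue)" for r
  have hint: "(\<integral>s. h r s \<partial>lborel) = k r * (\<integral>s. G s \<partial>lborel) - k r * \<Phi> r" for r
  proof -
    have "(\<integral>s. (if s < r then F s else 0) \<partial>lebesgue) = (\<integral>s. (if s < r then G s else 0) \<partial>lebesgue)"
    proof (rule integral_cong_AE)
      show "(\<lambda>s. if s < r then F s else 0) \<in> borel_measurable lebesgue"
        "(\<lambda>s. if s < r then G s else 0) \<in> borel_measurable lebesgue"
        using borel_measurable_integrable[OF F] borel_measurable_integrable[OF intG']
        by (auto intro!: measurable_If)
      show "AE s in lebesgue. (if s < r then F s else 0) = (if s < r then G s else 0)"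
        using FG' by eventually_elim simp
    qed
    also have "\<dots> = (\<integral>s. (if s < r then G s else 0) \<partial>lborel)"
        by (rule integral_completion) measurable
    finally have 1: "(\<integral>s. (if s < r then F s else 0) \<partial>lebesgue) =
        (\<integral>s. (if s < r then G s else 0) \<partial>lborel)" .
    have "h r s = k r * (G s - (if s < r then G s else 0))" for s by (simp add: h_def)
    hence "(\<integral>s. h r s \<partial>lborel) = k r * (\<integral>s. G s - (if s < r then G s else 0) \<partial>lborel)" by simp
    also have "\<dots> = k r * ((\<integral>s. G s \<partial>lborel) - (\<integral>s. (if s < r then G s else 0) \<partial>lborel))"
      by (subst Bochner_Integration.integral_diff[OF intG Gi]) auto
    finally show ?thesis
      unfolding 1 \<Phi>_def by (simp add: algebra_simps)
  qed
  have "integrable lborel (\<lambda>r. k r * (\<integral>s. G s \<partial>lborel) - (\<integral>s. h r s \<partial>lborel))"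
    using kall lborel_pair.integrable_fst'[OF i2]
    by (intro Bochner_Integration.integrable_diff integrable_mult_left) (auto simp:
        has_bochner_integral_iff)
  hence k\<Phi>: "integrable lborel (\<lambda>r. k r * \<Phi> r)" unfolding hint by simp
  have "(\<integral>s. \<eta> s * F s \<partial>lebesgue) = (\<integral>s. \<eta> s * G s \<partial>lebesgue)"
  proof (rule integral_cong_AE)
    show "(\<lambda>s. \<eta> s * F s) \<in> borel_measurable lebesgue" "(\<lambda>s. \<eta> s * G s) \<in> borel_measurable lebesgue"
      using borel_measurable_integrable[OF F] borel_measurable_integrable[OF intG']
        measurable_completion[of \<eta> lborel borel] \<eta>m by auto
    show "AE s in lebesgue. \<eta> s * F s = \<eta> s * G s" using FG' by eventually_elim simp
  qed
  also have "\<dots> = (\<integral>s. \<eta> s * G s \<partial>lborel)" by (rule integral_completion) measurable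
  also have "\<dots> = (\<integral>s. (\<integral>r. h r s \<partial>lborel) \<partial>lborel)"
  proof (rule Bochner_Integration.integral_cong[OF refl])
    fix s
    have "h r s = (if r \<le> s then k r else 0) * G s" for r by (simp add: h_def)
    thus "\<eta> s * G s = (\<integral>r. h r s \<partial>lborel)"
      using kint[of s] by (simp add: has_bochner_integral_iff)
  qed
  also have "\<dots> = (\<integral>r. (\<integral>s. h r s \<partial>lborel) \<partial>lborel)" by (rule lborel_pair.Fubini_integral[OF i2])
  also have "\<dots> = - (\<integral>r. k r * \<Phi> r \<partial>lborel)"
    unfolding hint using kall k\<Phi> by (subst Bochner_Integration.integral_diff) (auto simp:
        has_bochner_integral_iff)
  also have "(\<integral>r. k r * \<Phi> r \<partial>lborel) = (\<integral>r. k r * \<Phi> r \<partial>lebesgue)"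
    using borel_measurable_integrable[OF k\<Phi>] by (rule integral_completion[symmetric])
  finally show ?thesis unfolding \<Phi>_def .
qed

text \<open>The indicator of \<open>K\<close> is a pointwise limit of continuous cutoffs with values
  in the unit interval and supports in one fixed interval, so dominated convergence extends the
  hypothesis \<open>test\<close> to it.\<close>

lemma integral_compact_eq_0:
  fixes G :: "real \<Rightarrow> real"
  assumes int: "\<And>a b. 0 < a \<Longrightarrow> a \<le> b \<Longrightarrow> b < T \<Longrightarrow> integrable (lebesgue_on {a..b}) G"
    and test: "\<And>a b k. 0 < a \<Longrightarrow> a < b \<Longrightarrow> b < T \<Longrightarrow> continuous_on UNIV k \<Longrightarrow> (\<And>s. s \<notin> {a..b} \<Longrightarrow> k s = 0) \<Longrightarrow>
       (\<integral>s. k s * G s \<partial>lebesgue) = 0"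
    and K: "compact K" "K \<subseteq> {0<..<T}"
  shows "(\<integral>s. G s \<partial>lebesgue_on K) = 0"
proof (cases "K = {}")
  case False
  \<comment> \<open>The ends \<open>a\<close> and \<open>b\<close> lie halfway between
    \<open>K\<close> and the boundary points \<open>0\<close> and \<open>T\<close>; every point
    outside \<open>{a..b}\<close> has distance at least \<open>e\<close> from
    \<open>K\<close>.\<close>
  define a where "a = Inf K / 2"
  define b where "b = (Sup K + T) / 2"
  define e where "e = min a ((T - Sup K) / 2)"
  have bdd: "bdd_below K" "bdd_above K" 
    using compact_imp_bounded[OF K(1)] by (auto intro: bounded_imp_bdd_below bounded_imp_bdd_above)
  have "Inf K \<in> K" "Sup K \<in> K"
    using closed_contains_Inf[OF False bdd(1) compact_imp_closed[OF K(1)]]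
      closed_contains_Sup[OF False bdd(2) compact_imp_closed[OF K(1)]] by auto
  hence Ks: "0 < Inf K" "Sup K < T" "Inf K \<le> Sup K" using K(2) bdd by (auto intro: cInf_lower)
  hence ab: "0 < a" "a < b" "b < T" and e: "e > 0" by (auto simp: a_def b_def e_def)
  have far: "e \<le> infdist s K" if "s \<notin> {a..b}" for s
    unfolding infdist_notempty[OF False]
  proof (rule cINF_greatest[OF False])
    fix x assume x: "x \<in> K"
    hence "Inf K \<le> x" "x \<le> Sup K" using bdd by (auto intro: cInf_lower cSup_upper)
    moreover have "e \<le> Inf K / 2" "e \<le> (T - Sup K) / 2" unfolding e_def a_def
        by (rule min.cobounded1, rule min.cobounded2)
    ultimately show "e \<le> dist s x" using that Ks by (auto simp: a_def b_def dist_real_def)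
  qed
  \<comment> \<open>The summand \<open>1 / e\<close> makes the slope large enough for the cutoff to
    vanish at distance \<open>e\<close>; the growing summand \<open>n\<close> shrinks the support to
    \<open>K\<close>.\<close>
  define k where "k n s = max 0 (1 - (real n + 1 / e) * infdist s K)" for n s
  have k01: "0 \<le> k n s" "k n s \<le> 1" for n s using e by (auto simp: k_def infdist_nonneg)
  have k0: "k n s = 0" if "s \<notin> {a..b}" for n s
  proof -
    have "1 = 1 / e * e" using e by simp
    also have "\<dots> \<le> (real n + 1 / e) * infdist s K" using far[OF that] e by (intro mult_mono) auto
    finally show ?thesis by (simp add: k_def)
  qed
  have kc: "continuous_on UNIV (k n)" for n unfolding k_def by (intro continuous_intros)
  have klim: "(\<lambda>n. k n s) \<longlonglongrightarrow> indicator K s" for s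
  proof (cases "s \<in> K")
    case True
    thus ?thesis by (simp add: k_def)
  next
    case False
    hence d: "infdist s K > 0"
      using in_closed_iff_infdist_zero[OF compact_imp_closed[OF K(1)] \<open>K \<noteq> {}\<close>, of s]
          infdist_nonneg[of s K] by linarith
    have "\<forall>\<^sub>F n in sequentially. k n s = 0"
    proof -
      obtain N where N: "1 / infdist s K < real N" using reals_Archimedean2 by blast
      have "k n s = 0" if "n \<ge> N" for n
      proof -
        have "1 = 1 / infdist s K * infdist s K" using d by simp
        also have "\<dots> \<le> (real n + 1 / e) * infdist s K"
          using N that d e by (intro mult_right_mono) (auto intro: add_increasing2 order.trans[OF
              less_imp_le[OF N]])
        finally show ?thesis by (simp add: k_def)
      qed
      thus ?thesis unfolding eventually_sequentially by blast
    qed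
    thus ?thesis using False by (simp add: tendsto_eventually)
  qed
  have Gi: "integrable lebesgue (\<lambda>s. indicator {a..b} s * G s)"
    using int[of a b] ab by (simp add: integrable_restrict_space)
  have Ksub: "K \<subseteq> {a..b}"
  proof
    fix x assume x: "x \<in> K"
    hence "Inf K \<le> x" "x \<le> Sup K" using bdd by (auto intro: cInf_lower cSup_upper)
    thus "x \<in> {a..b}" using Ks by (auto simp: a_def b_def)
  qed
  have Gm: "(\<lambda>s. indicator {a..b} s * G s) \<in> borel_measurable lebesgue"
      by (rule borel_measurable_integrable[OF Gi])
  have "(\<lambda>n. \<integral>s. k n s * G s \<partial>lebesgue) \<longlonglongrightarrow> (\<integral>s. indicator K s * G s \<partial>lebesgue)"
  proof (rule integral_dominated_convergence[where w="\<lambda>s. \<bar>indicator {a..b} s * G s\<bar>"])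
    have "(\<lambda>s. indicator K s * G s) = (\<lambda>s. indicator K s * (indicator {a..b} s * G s))"
      using Ksub by (auto simp: fun_eq_iff indicator_def)
    moreover have "K \<in> sets lebesgue" by (simp add: borel_closed compact_imp_closed K(1))
    ultimately show "(\<lambda>s. indicator K s * G s) \<in> borel_measurable lebesgue" using Gm by simp
    have "(\<lambda>s. k n s * G s) = (\<lambda>s. k n s * (indicator {a..b} s * G s))" for n
      using k0 by (auto simp: fun_eq_iff indicator_def)
    moreover have "k n \<in> borel_measurable lebesgue" for n
      using measurable_completion[of "k n" lborel borel]
          borel_measurable_continuous_onI[OF kc] by simp
    ultimately show "(\<lambda>s. k n s * G s) \<in> borel_measurable lebesgue" for n using Gm by simp
    show "integrable lebesgue (\<lambda>s. \<bar>indicator {a..b} s * G s\<bar>)" using Gi by (rule integrable_abs)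
    show "AE s in lebesgue. (\<lambda>n. k n s * G s) \<longlonglongrightarrow> indicator K s * G s"
      by (intro AE_I2 tendsto_intros klim)
    show "AE s in lebesgue. norm (k n s * G s) \<le> \<bar>indicator {a..b} s * G s\<bar>" for n
    proof (rule AE_I2)
      fix s
      have "\<bar>k n s\<bar> * \<bar>G s\<bar> \<le> 1 * \<bar>G s\<bar>" using k01 by (intro mult_right_mono) auto
      thus "norm (k n s * G s) \<le> \<bar>indicator {a..b} s * G s\<bar>"
        using k0[of s n] by (auto simp: indicator_def abs_mult)
    qed
  qed
  moreover have "(\<integral>s. k n s * G s \<partial>lebesgue) = 0" for n by (rule test[OF ab kc k0])
  ultimately have "(\<integral>s. indicator K s * G s \<partial>lebesgue) = 0" by (simp add: LIMSEQ_const_iff)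
  thus ?thesis by (simp add: integral_restrict_space borel_closed compact_imp_closed K(1))
qed simp

text \<open>On a compact set where \<open>G\<close> is positive its integral is zero, so the set is
  null. By inner regularity the set of all points of \<open>{a..b}\<close> with positive
  \<open>G\<close> is null too. Applied to a function and its negative, this gives vanishing almost
  everywhere.\<close>

lemma AE_nonpos_of_test:
  fixes G :: "real \<Rightarrow> real"
  assumes int: "\<And>a b. 0 < a \<Longrightarrow> a \<le> b \<Longrightarrow> b < T \<Longrightarrow> integrable (lebesgue_on {a..b}) G"
    and test: "\<And>a b k. 0 < a \<Longrightarrow> a < b \<Longrightarrow> b < T \<Longrightarrow> continuous_on UNIV k \<Longrightarrow> (\<And>s. s \<notin> {a..b} \<Longrightarrow> k s = 0) \<Longrightarrow>
       (\<integral>s. k s * G s \<partial>lebesgue) = 0"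
  shows "AE s in lebesgue_on {0<..<T}. G s \<le> 0"
proof -
  have loc: "AE s in lebesgue. s \<in> {a..b} \<longrightarrow> G s \<le> 0" if ab: "0 < a" "a \<le> b" "b < T" for a b
  proof -
    define P where "P = {s\<in>{a..b}. G s > 0}"
    have Gm: "G \<in> borel_measurable (lebesgue_on {a..b})"
        by (rule borel_measurable_integrable[OF int[OF ab]])
    have "{s \<in> space (lebesgue_on {a..b}). G s > 0} \<in> sets (lebesgue_on {a..b})"
        using Gm by measurable
    hence P: "P \<in> sets lebesgue" unfolding P_def
        by (auto simp: space_restrict_space sets_restrict_space_iff)
    have C0: "emeasure lebesgue C = 0" if C: "closed C" "C \<subseteq> P" for C
    proof -
      have Cs: "C \<in> sets lebesgue" using C(1) by (simp add: borel_closed)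
      have "bounded C" using C(2) by (intro bounded_subset[OF bounded_closed_interval, of C a b])
          (auto simp: P_def)
      hence cC: "compact C" using C(1) by (simp add: compact_eq_bounded_closed)
      have CT: "C \<subseteq> {0<..<T}" using C(2) ab by (auto simp: P_def)
      have 0: "(\<integral>s. G s \<partial>lebesgue_on C) = 0"
      proof (rule integral_compact_eq_0[of T G C, OF _ _ cC CT])
        fix a b assume "0 < a" "a \<le> b" "b < T"
        thus "integrable (lebesgue_on {a..b}) G" by (rule int)
      next
        fix a b and k :: "real \<Rightarrow> real"
        assume "0 < a" "a < b" "b < T" "continuous_on UNIV k" "\<And>s. s \<notin> {a..b} \<Longrightarrow> k s = 0"
        thus "(\<integral>s. k s * G s \<partial>lebesgue) = 0" by (rule test)
      qed
      have iC: "integrable (lebesgue_on C) G"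
        by (rule integrable_lebesgue_on_subset[OF int[OF ab]]) (use C Cs in \<open>auto simp: P_def\<close>)
      have "AE s in lebesgue_on C. 0 \<le> G s"
        by (rule AE_I2) (use C in \<open>auto simp: P_def space_restrict_space\<close>)
      hence "AE s in lebesgue_on C. G s = 0" using integral_nonneg_eq_0_iff_AE[OF iC] 0 by blast
      hence "AE s in lebesgue. s \<in> C \<longrightarrow> G s = 0" using Cs by (simp add: AE_restrict_space_iff)
      hence "AE s in lebesgue. s \<notin> C" by eventually_elim (use C in \<open>auto simp: P_def\<close>)
      thus ?thesis using Cs by (simp add: AE_iff_null_sets[symmetric] null_setsD1)
    qed
    have "emeasure lebesgue P \<le> ennreal e" if e0: "e > 0" for e
    proof -
      obtain C where C: "closed C" "C \<subseteq> P" "emeasure lebesgue (P - C) < ennreal e"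
        using sets_lebesgue_inner_closed[OF P e0] by metis
      have Cs: "C \<in> sets lebesgue" using C(1) by (simp add: borel_closed)
      have "P = C \<union> (P - C)" using C(2) by auto
      hence "emeasure lebesgue P \<le> emeasure lebesgue C + emeasure lebesgue (P - C)"
        using emeasure_subadditive[of C lebesgue "P - C"] Cs P by auto
      thus ?thesis using C0[OF C(1,2)] C(3) by simp
    qed
    hence "emeasure lebesgue P \<le> 0" by - (rule ennreal_le_epsilon, simp)
    hence "P \<in> null_sets lebesgue" using P by (intro null_setsI) auto
    from AE_not_in[OF this] show ?thesis by eventually_elim (auto simp: P_def not_less)
  qed
  \<comment> \<open>Countably many compact intervals exhaust the open interval; those that are empty
    contribute nothing.\<close>
  have "AE s in lebesgue. \<forall>n::nat. s \<in> {1 / real (Suc n)..T - 1 / real (Suc n)} \<longrightarrow> G s \<le> 0"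
  proof (rule AE_all_countable[THEN iffD2], rule allI)
    fix n :: nat
    show "AE s in lebesgue. s \<in> {1 / real (Suc n)..T - 1 / real (Suc n)} \<longrightarrow> G s \<le> 0"
    proof (cases "1 / real (Suc n) \<le> T - 1 / real (Suc n)")
      case True
      show ?thesis by (rule loc[OF _ True]) auto
    qed auto
  qed
  hence "AE s in lebesgue. s \<in> {0<..<T} \<longrightarrow> G s \<le> 0"
  proof eventually_elim
    case (elim s)
    show ?case
    proof
      assume s: "s \<in> {0<..<T}"
      obtain n where n: "inverse (real (Suc n)) < min s (T - s)"
        using reals_Archimedean[of "min s (T - s)"] s by auto
      hence "s \<in> {1 / real (Suc n)..T - 1 / real (Suc n)}" by (auto simp: inverse_eq_divide)
      thus "G s \<le> 0" using elim by blast
    qed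
  qed
  thus ?thesis by (simp add: AE_restrict_space_iff)
qed

lemma integrable_mult_continuous_support:
  fixes k G :: "real \<Rightarrow> real"
  assumes G: "integrable (lebesgue_on {a..b}) G" and k: "continuous_on UNIV k"
      and supp: "\<And>s. s \<notin> {a..b} \<Longrightarrow> k s = 0"
  shows "integrable lebesgue (\<lambda>s. k s * G s)"
proof -
  have Gi: "integrable lebesgue (\<lambda>s. indicator {a..b} s * G s)"
    using G by (simp add: integrable_restrict_space)
  have "compact (k ` {a..b})" by (intro compact_continuous_image continuous_on_subset[OF k]) auto
  hence "bounded (k ` {a..b})" by (rule compact_imp_bounded)
  then obtain B where B: "\<And>s. s \<in> {a..b} \<Longrightarrow> \<bar>k s\<bar> \<le> B"
    unfolding bounded_iff by (metis imageI real_norm_def)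
  have eq: "(\<lambda>s. k s * G s) = (\<lambda>s. k s * (indicator {a..b} s * G s))"
    using supp by (auto simp: fun_eq_iff indicator_def)
  have km: "k \<in> borel_measurable lebesgue"
    by (rule measurable_completion) (simp add: borel_measurable_continuous_onI[OF k])
  show ?thesis unfolding eq
  proof (rule Bochner_Integration.integrable_bound)
    show "integrable lebesgue (\<lambda>s. B * (indicator {a..b} s * G s))" using Gi by simp
    show "(\<lambda>s. k s * (indicator {a..b} s * G s)) \<in> borel_measurable lebesgue"
      using km borel_measurable_integrable[OF Gi] by simp
    show "AE s in lebesgue. norm (k s * (indicator {a..b} s * G s)) \<le>
        norm (B * (indicator {a..b} s * G s))"
    proof (rule AE_I2)
      fix s
      show "norm (k s * (indicator {a..b} s * G s)) \<le> norm (B * (indicator {a..b} s * G s))"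
      proof (cases "s \<in> {a..b}")
        case True
        have "\<bar>k s\<bar> \<le> \<bar>B\<bar>" using B[OF True] by linarith
        thus ?thesis using True by (simp add: abs_mult mult_right_mono)
      qed simp
    qed
  qed
qed

lemma continuous_on_indefinite_lebesgue:
  fixes F :: "real \<Rightarrow> real"
  assumes F: "integrable lebesgue F"
  shows "continuous_on UNIV (\<lambda>s. \<integral>r. (if r < s then F r else 0) \<partial>lebesgue)"
  unfolding continuous_on_sequentially
proof (intro ballI allI impI)
  fix t :: real and x assume "(\<forall>n. x n \<in> UNIV) \<and> x \<longlonglongrightarrow> t"
  hence x: "x \<longlonglongrightarrow> t" by simp
  have m: "(\<lambda>r. if r < s then F r else 0) \<in> borel_measurable lebesgue" for s
    using borel_measurable_integrable[OF F] by (auto intro!: measurable_If)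
  have "(\<lambda>n. \<integral>r. (if r < x n then F r else 0) \<partial>lebesgue) \<longlonglongrightarrow> (\<integral>r. (if r < t then F r else
      0) \<partial>lebesgue)"
  proof (rule integral_dominated_convergence[where w="\<lambda>r. \<bar>F r\<bar>"])
    show "integrable lebesgue (\<lambda>r. \<bar>F r\<bar>)" using F by (rule integrable_abs)
    have "AE r in lebesgue. r \<noteq> t" by (rule AE_completion[OF AE_lborel_singleton])
    thus "AE r in lebesgue. (\<lambda>n. if r < x n then F r else 0) \<longlonglongrightarrow> (if r < t then F r else 0)"
    proof eventually_elim
      case (elim r)
      show ?case
      proof (cases "r < t")
        case True
        have "\<forall>\<^sub>F n in sequentially. r < x n" by (rule order_tendstoD(1)[OF x True])
        hence "\<forall>\<^sub>F n in sequentially. (if r < x n then F r else 0) = F r" by eventually_elim simp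
        thus ?thesis using True by (simp add: tendsto_eventually)
      next
        case False
        have "\<forall>\<^sub>F n in sequentially. x n < r" by (rule order_tendstoD(2)[OF x]) (use False
            elim in simp)
        hence "\<forall>\<^sub>F n in sequentially. (if r < x n then F r else 0) = 0" by eventually_elim simp
        thus ?thesis using False by (simp add: tendsto_eventually)
      qed
    qed
  qed (use m in auto)
  thus "((\<lambda>s. \<integral>r. (if r < s then F r else 0) \<partial>lebesgue) \<circ> x) \<longlonglongrightarrow> (\<integral>r. (if r < t then F r else
      0) \<partial>lebesgue)"
    by (simp add: comp_def)
qed

text \<open>A parabola cut off to the middle third of the interval, with integral
  \<open>(b - a)^3 / 6\<close>. It serves to correct the mean of a test function.\<close>

lemma exists_bump:
  assumes "0 < (T::real)"
  obtains a b :: real and k where "0 < a" "a < b" "b < T" "continuous_on UNIV k"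
    "\<And>s. s \<notin> {a..b} \<Longrightarrow> k s = 0" "(\<integral>s. k s \<partial>lborel) \<noteq> (0::real)"
proof -
  define a b where "a = T / 3" and "b = 2 * T / 3"
  define k where "k s = max 0 ((s - a) * (b - s))" for s
  have ab: "0 < a" "a < b" "b < T" using assms by (auto simp: a_def b_def)
  have k0: "k s = 0" if "s \<notin> {a..b}" for s
  proof -
    have "(s - a) * (b - s) \<le> 0" using that ab by (auto simp: mult_le_0_iff)
    thus ?thesis by (simp add: k_def)
  qed
  have "k s = (s - a) * (b - s) * indicator {a..b} s" for s
    using k0[of s] by (auto simp: k_def indicator_def max_def zero_le_mult_iff)
  hence "(\<integral>s. k s \<partial>lborel) = (\<integral>s. (s - a) * (b - s) * indicator {a..b} s \<partial>lborel)" by simp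
  also have "\<dots> = (- (b^3 / 3) + (a + b) * b\<^sup>2 / 2 - a * b * b) - (- (a^3 / 3) + (a +
      b) * a\<^sup>2 / 2 - a * b * a)"
  proof (rule integral_FTC_Icc_real)
    show "((\<lambda>s. - (s^3 / 3) + (a + b) * s\<^sup>2 / 2 - a * b * s) has_real_derivative (s - a) * (b -
        s)) (at s)" for s
      by (auto intro!: derivative_eq_intros simp: field_simps power2_eq_square)
    show "isCont (\<lambda>s. (s - a) * (b - s)) s" for s by (intro continuous_intros)
  qed (use ab in simp)
  also have "\<dots> = (b - a)^3 / 6" by (simp add: field_simps power2_eq_square power3_eq_cube)
  finally have "(\<integral>s. k s \<partial>lborel) = (b - a)^3 / 6" .
  moreover have "(b - a)^3 / 6 > 0" using ab by simp
  ultimately have "(\<integral>s. k s \<partial>lborel) \<noteq> 0" by linarith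
  moreover have "continuous_on UNIV k" unfolding k_def by (intro continuous_intros)
  ultimately show ?thesis using that ab k0 by blast
qed

text \<open>A continuous \<open>k\<close> with compact support and mean zero is the derivative of a
  compactly supported function, so \<open>g\<close> minus the primitive of \<open>F\<close>
  annihilates it. Subtracting a multiple of the bump gives every \<open>k\<close> mean zero, at the
  price of the constant \<open>c\<close>.\<close>

lemma du_bois_reymond:
  fixes F g :: "real \<Rightarrow> real"
  assumes T: "0 < T" and F: "integrable lebesgue F"
    and g: "\<And>a b. 0 < a \<Longrightarrow> a \<le> b \<Longrightarrow> b < T \<Longrightarrow> integrable (lebesgue_on {a..b}) g"
    and weak: "\<And>a b \<eta> k. 0 < a \<Longrightarrow> a < b \<Longrightarrow> b < T \<Longrightarrow> (\<And>s. (\<eta> has_real_derivative k s) (at s)) \<Longrightarrow>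
      continuous_on UNIV k \<Longrightarrow> (\<And>s. s \<notin> {a..b} \<Longrightarrow> \<eta> s = 0) \<Longrightarrow> (\<And>s. s \<notin> {a..b} \<Longrightarrow> k s = 0) \<Longrightarrow>
      (\<integral>s. k s * g s \<partial>lebesgue) = - (\<integral>s. \<eta> s * F s \<partial>lebesgue)"
  shows "\<exists>c. AE s in lebesgue_on {0<..<T}. g s = c + (\<integral>r. (if r < s then F r else 0) \<partial>lebesgue)"
proof -
  define \<Phi> where "\<Phi> s = (\<integral>r. (if r < s then F r else 0) \<partial>lebesgue)" for s
  have \<Phi>c: "continuous_on UNIV \<Phi>" unfolding \<Phi>_def by (rule continuous_on_indefinite_lebesgue[OF F])
  have \<Phi>i: "integrable (lebesgue_on {a..b}) \<Phi>" for a b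
    by (rule continuous_imp_integrable_real[OF continuous_on_subset[OF \<Phi>c]]) simp
  have Gi: "integrable (lebesgue_on {a..b}) (\<lambda>s. g s - \<Phi> s)" if "0 < a" "a \<le> b" "b < T" for a b
    by (intro Bochner_Integration.integrable_diff g that \<Phi>i)
  have klb: "(\<integral>s. k s \<partial>lebesgue) = (\<integral>s. k s \<partial>lborel)"
      if "continuous_on UNIV k" for k :: "real \<Rightarrow> real"
    by (rule integral_completion) (simp add: borel_measurable_continuous_onI[OF that])
  have kint: "integrable lebesgue k" if "continuous_on UNIV k" "\<And>s. s \<notin> {a..b} \<Longrightarrow>
      k s = 0" for k :: "real \<Rightarrow> real" and a b
    using integrable_mult_continuous_support[of a b "\<lambda>_. 1" k] that
    by (simp add: continuous_imp_integrable_real)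
  have mean0: "(\<integral>s. k s * (g s - \<Phi> s) \<partial>lebesgue) = 0"
    if ab: "0 < a" "a < b" "b < T" and k: "continuous_on UNIV k" "\<And>s. s \<notin> {a..b} \<Longrightarrow>
        k s = 0" "(\<integral>s. k s \<partial>lborel) = 0" for a b k
  proof -
    have kc: "isCont k s" for s using k(1) by (simp add: continuous_on_eq_continuous_at)
    \<comment> \<open>An antiderivative on the whole line. It is constant on each side of
      \<open>{a..b}\<close>, and the vanishing mean makes the two constants equal.\<close>
    obtain E where E': "\<forall>x::real. -\<infinity> < ereal x \<longrightarrow> ereal x < \<infinity> \<longrightarrow> (E has_vector_derivative k x) (at x)"
      using einterval_antiderivative[of "-\<infinity>" "\<infinity>" k] kc by auto
    hence E: "(E has_real_derivative k x) (at x)" for x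
      by (simp add: has_real_derivative_iff_has_vector_derivative)
    define \<eta> where "\<eta> s = E s - E a" for s
    have \<eta>: "(\<eta> has_real_derivative k s) (at s)" for s
      unfolding \<eta>_def by (auto intro!: derivative_eq_intros E)
    have "(\<integral>s. k s * indicator {a..b} s \<partial>lborel) = E b - E a"
      by (rule integral_FTC_Icc_real) (use ab E kc in auto)
    moreover have "k s * indicator {a..b} s = k s" for s using k(2)[of s]
        by (auto simp: indicator_def)
    ultimately have Eb: "E b = E a" using k(3) by simp
    have \<eta>0: "\<eta> s = 0" if s: "s \<notin> {a..b}" for s
    proof -
      have Ec: "continuous_on X E" for X using DERIV_isCont[OF E]
          by (simp add: continuous_at_imp_continuous_on)
      have "E a = E s" if "s < a"
      proof (rule DERIV_isconst_end[OF that Ec])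
        fix x assume "s < x" "x < a"
        thus "(E has_real_derivative 0) (at x)" using E[of x] k(2)[of x] by simp
      qed
      moreover have "E s = E b" if "b < s"
      proof (rule DERIV_isconst_end[OF that Ec])
        fix x assume "b < x" "x < s"
        thus "(E has_real_derivative 0) (at x)" using E[of x] k(2)[of x] by simp
      qed
      ultimately show ?thesis using s Eb by (auto simp: \<eta>_def)
    qed
    have "(\<integral>s. k s * g s \<partial>lebesgue) = - (\<integral>s. \<eta> s * F s \<partial>lebesgue)"
      by (rule weak[OF ab \<eta> k(1) \<eta>0 k(2)])
    also have "\<dots> = (\<integral>s. k s * \<Phi> s \<partial>lebesgue)"
      using integral_by_parts_C1_L1[OF F \<eta> k(1) \<eta>0 k(2)] by (simp add: \<Phi>_def)
    finally have "(\<integral>s. k s * g s \<partial>lebesgue) = (\<integral>s. k s * \<Phi> s \<partial>lebesgue)" .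
    moreover have "(\<integral>s. k s * (g s - \<Phi> s) \<partial>lebesgue) =
        (\<integral>s. k s * g s \<partial>lebesgue) - (\<integral>s. k s * \<Phi> s \<partial>lebesgue)"
      unfolding right_diff_distrib using ab
      by (intro Bochner_Integration.integral_diff integrable_mult_continuous_support[OF _
          k(1,2)] g \<Phi>i) auto
    ultimately show ?thesis by simp
  qed
  obtain a0 b0 k0 where k0: "0 < a0" "a0 < b0" "b0 < T" "continuous_on UNIV k0"
    "\<And>s. s \<notin> {a0..b0} \<Longrightarrow> k0 s = 0" "(\<integral>s. k0 s \<partial>lborel) \<noteq> (0::real)"
    using exists_bump[OF T] by metis
  \<comment> \<open>The value forced by testing \<open>g s - \<Phi> s - c\<close> with the bump
    alone.\<close>
  define c where "c = (\<integral>s. k0 s * (g s - \<Phi> s) \<partial>lebesgue) / (\<integral>s. k0 s \<partial>lborel)"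
  have test: "(\<integral>s. k s * (g s - \<Phi> s - c) \<partial>lebesgue) = 0"
    if ab: "0 < a" "a < b" "b < T" and k: "continuous_on UNIV k" "\<And>s. s \<notin> {a..b} \<Longrightarrow>
        k s = 0" for a b k
  proof -
    \<comment> \<open>Chosen so that \<open>k - m * k0\<close> has mean zero.\<close>
    define m where "m = (\<integral>s. k s \<partial>lborel) / (\<integral>s. k0 s \<partial>lborel)"
    have ki: "integrable lebesgue k" "integrable lebesgue k0" using kint k k0 by blast+
    have kG: "integrable lebesgue (\<lambda>s. k s * (g s - \<Phi> s))"
      by (rule integrable_mult_continuous_support[OF Gi k]) (use ab in auto)
    have kG0: "integrable lebesgue (\<lambda>s. k0 s * (g s - \<Phi> s))"
      by (rule integrable_mult_continuous_support[OF Gi k0(4,5)]) (use k0(1-3) in auto)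
    have "(\<integral>s. (k s - m * k0 s) * (g s - \<Phi> s) \<partial>lebesgue) = 0"
    proof (rule mean0)
      show "0 < min a a0" "min a a0 < max b b0" "max b b0 < T" using ab k0 by auto
      show cont: "continuous_on UNIV (\<lambda>s. k s - m * k0 s)" by (intro continuous_intros k k0)
      show "k s - m * k0 s = 0" if "s \<notin> {min a a0..max b b0}" for s
        using that k(2)[of s] k0(5)[of s] by (auto simp: min_def max_def split: if_splits)
      have "(\<integral>s. k s - m * k0 s \<partial>lborel) = (\<integral>s. k s - m * k0 s \<partial>lebesgue)"
          by (rule klb[OF cont, symmetric])
      also have "\<dots> = (\<integral>s. k s \<partial>lborel) - m * (\<integral>s. k0 s \<partial>lborel)"
        using ki by (simp add: klb k k0)
      finally show "(\<integral>s. k s - m * k0 s \<partial>lborel) = 0" using k0(6) by (simp add: m_def)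
    qed
    moreover have "(\<integral>s. (k s - m * k0 s) * (g s - \<Phi> s) \<partial>lebesgue)
      = (\<integral>s. k s * (g s - \<Phi> s) \<partial>lebesgue) - m * (\<integral>s. k0 s * (g s - \<Phi> s) \<partial>lebesgue)"
      using kG kG0 by (simp add: left_diff_distrib mult.assoc)
    ultimately have "(\<integral>s. k s * (g s - \<Phi> s) \<partial>lebesgue) = (\<integral>s. k s \<partial>lebesgue) * c"
      by (simp add: m_def c_def klb k)
    moreover have "(\<integral>s. k s * (g s - \<Phi> s - c) \<partial>lebesgue) =
        (\<integral>s. k s * (g s - \<Phi> s) \<partial>lebesgue) - (\<integral>s. k s \<partial>lebesgue) * c"
      using kG ki by (simp add: right_diff_distrib[of _ "_ - _" c])
    ultimately show ?thesis by simp
  qed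
  have Gci: "integrable (lebesgue_on {a..b}) (\<lambda>s. g s - \<Phi> s - c)" if "0 < a" "a \<le> b" "b < T" for a b
    by (intro Bochner_Integration.integrable_diff[OF Gi[OF that]]
        continuous_imp_integrable_real) simp
  have "AE s in lebesgue_on {0<..<T}. g s - \<Phi> s - c \<le> 0"
    by (rule AE_nonpos_of_test[OF Gci test])
  moreover have "AE s in lebesgue_on {0<..<T}. - (g s - \<Phi> s - c) \<le> 0"
  proof (rule AE_nonpos_of_test)
    show "integrable (lebesgue_on {a..b}) (\<lambda>s. - (g s - \<Phi> s - c))"
        if "0 < a" "a \<le> b" "b < T" for a b
      by (intro Bochner_Integration.integrable_minus Gci that)
    show "(\<integral>s. k s * - (g s - \<Phi> s - c) \<partial>lebesgue) = 0"
      if "0 < a" "a < b" "b < T" "continuous_on UNIV k" "\<And>s. s \<notin> {a..b} \<Longrightarrow> k s = 0" for a b k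
    proof -
      have "(\<integral>s. k s * (g s - \<Phi> s - c) \<partial>lebesgue) = 0" by (rule test[OF that])
      thus ?thesis unfolding mult_minus_right Bochner_Integration.integral_minus by simp
    qed
  qed
  ultimately have "AE s in lebesgue_on {0<..<T}. g s = c + \<Phi> s" by eventually_elim simp
  thus ?thesis unfolding \<Phi>_def by blast
qed

section \<open>Test functions built from adjoint orbits\<close>

lemma L2_loc_norm_integrable:
  assumes "u \<in> L2_loc" "0 < a"
  shows "integrable (lebesgue_on {a..b}) (\<lambda>s. norm (u s))"
proof (rule Bochner_Integration.integrable_bound)
  have sm: "strongly_measurable (lebesgue_on {a..b}) u"
    using assms by - (rule strongly_measurable_restrict[of "{0<..}" u], auto simp: L2_loc_def)
  have "compact {a..b} \<and> {a..b} \<subseteq> {0<..}" using assms(2) by auto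
  hence "integrable (lebesgue_on {a..b}) (\<lambda>s. (norm (u s))\<^sup>2)"
    using assms(1) unfolding L2_loc_def by blast
  thus "integrable (lebesgue_on {a..b}) (\<lambda>s. 1 + (norm (u s))\<^sup>2)"
    by - (rule Bochner_Integration.integrable_add[OF continuous_imp_integrable_real],
        simp, assumption)
  show "(\<lambda>s. norm (u s)) \<in> borel_measurable (lebesgue_on {a..b})"
    by (intro borel_measurable_norm_strongly complete_measure_lebesgue_on sm) auto
  show "AE s in lebesgue_on {a..b}. norm (norm (u s)) \<le> norm (1 + (norm (u s))\<^sup>2)"
  proof (rule AE_I2)
    fix s
    have "2 * norm (u s) \<le> 1 + (norm (u s))\<^sup>2" using sum_squares_bound[of 1 "norm (u s)"] by simp
    hence "norm (u s) \<le> 1 + (norm (u s))\<^sup>2" using norm_ge_zero[of "u s"] by linarith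
    thus "norm (norm (u s)) \<le> norm (1 + (norm (u s))\<^sup>2)" by simp
  qed
qed

lemma continuous_support_bounded:
  fixes k :: "real \<Rightarrow> real"
  assumes k: "continuous_on UNIV k" and supp: "\<And>s. s \<notin> {a..b} \<Longrightarrow> k s = 0"
  shows "\<exists>B\<ge>0. \<forall>s. \<bar>k s\<bar> \<le> B"
proof -
  have "compact (k ` {a..b})" by (intro compact_continuous_image continuous_on_subset[OF k]) auto
  hence "bounded (k ` {a..b})" by (rule compact_imp_bounded)
  then obtain B where B: "\<And>s. s \<in> {a..b} \<Longrightarrow> \<bar>k s\<bar> \<le> B"
    unfolding bounded_iff by (metis imageI real_norm_def)
  have "\<bar>k s\<bar> \<le> max B 0" for s using B[of s] supp[of s] by (cases "s \<in> {a..b}") auto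
  thus ?thesis by (intro exI[of _ "max B 0"]) auto
qed

locale analytic_generator = bounded_analytic S \<delta> C for S :: "complex \<Rightarrow> 'a::complex_hilbert_space \<Rightarrow>
    'a" and \<delta> C +
  fixes D :: "'a set" and A :: "'a \<Rightarrow> 'a"
  assumes A_lin: "clinear_operator D A" and D_dense: "closure D = UNIV"
    and generator: "\<And>x. x \<in> D \<Longrightarrow> ((\<lambda>t. (1 / t) *\<^sub>R (S (complex_of_real t) x - x)) \<longlongrightarrow> - A x)
        (at_right 0)"
begin

text \<open>Density of \<open>D\<close> gives uniqueness: the vectors that pair equally with two
  candidates form a closed set containing \<open>D\<close>.\<close>

lemma adjoint_eqI:
  assumes "\<And>x. x \<in> D \<Longrightarrow> cinner (A x) y = cinner x z"
  shows "y \<in> adjoint_dom D A" "adjoint_op D A y = z"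
proof -
  show "y \<in> adjoint_dom D A" using assms unfolding adjoint_dom_def by blast
  show "adjoint_op D A y = z" unfolding adjoint_op_def
  proof (rule the_equality)
    fix z' assume z': "\<forall>x\<in>D. cinner (A x) y = cinner x z'"
    have cl: "closed {x. cinner x (z' - z) = 0}"
      by (intro closed_Collect_eq continuous_intros linear_continuous_on[OF
          bounded_linear_cinner_left])
    have "D \<subseteq> {x. cinner x (z' - z) = 0}"
      using z' assms by (auto simp: cinner_diff_right)
    hence "closure D \<subseteq> {x. cinner x (z' - z) = 0}" by (rule closure_minimal[OF _ cl])
    hence "cinner x z' = cinner x z" for x using D_dense by (auto simp: cinner_diff_right)
    thus "z' = z" by (rule cinner_left_eqI)
  qed (use assms in blast)
qed

text \<open>Both sides express the right derivative at \<open>t\<close> of the pairing of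
  \<open>T t x\<close> with \<open>y\<close>. The semigroup law moves the difference quotient onto
  \<open>x\<close>, where the generator appears, and differentiability of the adjoint orbit gives
  the other side.\<close>

lemma rinner_A_adj:
  assumes t: "t > 0" and x: "x \<in> D"
  shows "rinner (A x) (adj y t) = - rinner x (adj' y t)"
proof -
  have "((\<lambda>h. rinner (T t ((1 / h) *\<^sub>R (T h x - x))) y) \<longlongrightarrow> rinner (T t (- A x)) y) (at_right 0)"
    using generator[OF x] t unfolding T_def[symmetric]
    by (intro tendsto_rinner bounded_linear.tendsto[OF bounded_linear_T]) auto
  moreover have "\<forall>\<^sub>F h in at_right 0. rinner (T t ((1 / h) *\<^sub>R (T h x - x))) y
     = (rinner x (adj y (t + h)) - rinner x (adj y t)) / h"
    using eventually_at_right_less[of "0::real"]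
  proof eventually_elim
    case (elim h)
    thus ?case using t by (simp add: T_lin rinner_simps rinner_adj T_add)
  qed
  ultimately have 1: "((\<lambda>h. (rinner x (adj y (t +
      h)) - rinner x (adj y t)) / h) \<longlongrightarrow> rinner (T t (- A x)) y) (at_right 0)"
    by (rule Lim_transform_eventually)
  have "((\<lambda>s. rinner x (adj y s)) has_real_derivative rinner x (adj' y t)) (at t)"
    using bounded_linear.has_vector_derivative[OF bounded_linear_rinner_right
        adj_has_vector_derivative[OF t]]
    by (simp add: has_real_derivative_iff_has_vector_derivative)
  hence "((\<lambda>h. (rinner x (adj y (t + h)) - rinner x (adj y t)) / h) \<longlongrightarrow> rinner x (adj' y t)) (at 0)"
    by (simp add: DERIV_def)
  hence "((\<lambda>h. (rinner x (adj y (t + h)) - rinner x (adj y t)) / h) \<longlongrightarrow> rinner x (adj' y t))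
      (at_right 0)"
    by (rule tendsto_within_subset) simp
  hence "rinner (T t (- A x)) y = rinner x (adj' y t)"
    by (rule tendsto_unique[OF trivial_limit_at_right_real 1])
  moreover have "rinner (T t (- A x)) y = - rinner (A x) (adj y t)"
    using t T_lin(4)[of t 0 "A x"] T_lin(5)[of t] by (simp add: rinner_adj rinner_simps)
  ultimately show ?thesis by simp
qed

text \<open>The domain is a complex subspace, so the real identity may be used at \<open>x\<close>
  and at \<open>\<i> *\<^sub>C x\<close>, which together give the complex one. The factor
  \<open>r\<close> later takes the values of \<open>\<eta>\<close>.\<close>

lemma adjoint_adj:
  assumes t: "t > 0"
  shows "r *\<^sub>R adj y t \<in> adjoint_dom D A" "adjoint_op D A (r *\<^sub>R adj y t) = - (r *\<^sub>R adj' y t)"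
proof -
  have "cinner (A x) (r *\<^sub>R adj y t) = cinner x (- (r *\<^sub>R adj' y t))" if x: "x \<in> D" for x
  proof -
    have ix: "\<i> *\<^sub>C x \<in> D" "A (\<i> *\<^sub>C x) = \<i> *\<^sub>C A x" using A_lin x
        by (auto simp: clinear_operator_def)
    have "cinner (A x) (adj y t) = - cinner x (adj' y t)"
      using rinner_A_adj[OF t x, of y] rinner_A_adj[OF t ix(1), of y]
      by (auto simp: rinner_def ix cinner_scaleC_left complex_eq_iff)
    thus ?thesis by (simp add: cinner_scaleR_right cinner_minus_right)
  qed
  from adjoint_eqI[OF this] show "r *\<^sub>R adj y t \<in> adjoint_dom D A"
    "adjoint_op D A (r *\<^sub>R adj y t) = - (r *\<^sub>R adj' y t)" by blast+
qed

lemma adjoint_0: "0 \<in> adjoint_dom D A" "adjoint_op D A 0 = 0"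
  using adjoint_adj[of 1 0] by auto

section \<open>The weak equation tested with one adjoint orbit and one scalar profile\<close>

context
  fixes t a b :: real and y :: 'a and \<eta> k :: "real \<Rightarrow> real"
  assumes ab: "0 < a" "a < b" "b < t"
    and \<eta>: "\<And>s. (\<eta> has_real_derivative k s) (at s)" and kc: "continuous_on UNIV k"
    and supp: "\<And>s. s \<notin> {a..b} \<Longrightarrow> \<eta> s = 0" "\<And>s. s \<notin> {a..b} \<Longrightarrow> k s = 0"
begin

definition test_fun :: "real \<Rightarrow> 'a" where "test_fun s = \<eta> s *\<^sub>R adj y (t - s)"
definition test_fun' :: "real \<Rightarrow> 'a" where "test_fun' s =
    k s *\<^sub>R adj y (t - s) - \<eta> s *\<^sub>R adj' y (t - s)"

text \<open>For \<open>s \<ge> t\<close> the vector \<open>adj y (t - s)\<close> carries no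
  differentiability information, but there \<open>s > b\<close> and the factor \<open>\<eta>\<close>
  vanishes in a neighbourhood.\<close>

lemma test_fun_deriv: "(test_fun has_vector_derivative test_fun' s) (at s)"
proof (cases "s < t")
  case True
  have "((\<lambda>s. t - s) has_vector_derivative - 1) (at s)"
    unfolding has_real_derivative_iff_has_vector_derivative[symmetric]
        by (auto intro!: derivative_eq_intros)
  hence "((\<lambda>s. adj y (t - s)) has_vector_derivative (- 1) *\<^sub>R adj' y (t - s)) (at s)"
    using vector_diff_chain_at[of "\<lambda>s. t - s" "-1" s "adj y" "adj' y (t - s)"]
        adj_has_vector_derivative[of "t - s" y] True
    by (simp add: comp_def)
  from has_vector_derivative_scaleR[OF \<eta> this] show ?thesis
    unfolding test_fun_def[abs_def] test_fun'_def by (simp add: algebra_simps)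
next
  case False
  hence s: "s > b" using ab by simp
  have "((\<lambda>_. 0) has_vector_derivative 0) (at s)" by (rule has_vector_derivative_const)
  hence "(test_fun has_vector_derivative 0) (at s)"
    by (rule has_vector_derivative_transform_within_open[of _ _ _ "{b<..}"]) (use s supp in \<open>auto
        simp: test_fun_def\<close>)
  thus ?thesis using s supp[of s] by (simp add: test_fun'_def)
qed

text \<open>As \<open>b < t\<close>, the two open half lines overlap and cover the real
  line.\<close>

lemma continuous_pieces:
  assumes "continuous_on {..<t} f" "\<And>s. s > b \<Longrightarrow> f s = 0"
  shows "continuous_on UNIV (f :: real \<Rightarrow> 'a)"
proof -
  have "continuous_on {b<..} f"
    by (rule continuous_on_eq[OF continuous_on_const[of _ 0]]) (use assms(2) in simp)
  hence "continuous_on ({..<t} \<union> {b<..}) f" by (intro continuous_on_open_Un assms) auto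
  moreover have "{..<t} \<union> {b<..} = UNIV" using ab by auto
  ultimately show ?thesis by simp
qed

lemma adj_shift_continuous: "continuous_on {..<t} (\<lambda>s. adj y (t - s))" "continuous_on {..<t} (\<lambda>s.
    adj' y (t - s))"
  by (intro continuous_on_compose2[OF continuous_on_adj] continuous_on_compose2[OF
      continuous_on_adj'] continuous_intros; auto)+

lemma \<eta>_cont: "continuous_on X \<eta>"
  using DERIV_isCont[OF \<eta>] by (simp add: continuous_at_imp_continuous_on)

lemma k_cont: "continuous_on X k" by (rule continuous_on_subset[OF kc]) simp

lemma test_fun'_cont: "continuous_on UNIV test_fun'"
  by (rule continuous_pieces; unfold test_fun'_def)
    (intro continuous_intros adj_shift_continuous \<eta>_cont k_cont, use supp in auto)

lemma adjoint_test_fun: "test_fun s \<in> adjoint_dom D A" "adjoint_op D A (test_fun s) =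
    - (\<eta> s *\<^sub>R adj' y (t - s))"
proof -
  have "test_fun s \<in> adjoint_dom D A \<and> adjoint_op D A (test_fun s) = - (\<eta> s *\<^sub>R adj' y (t - s))"
  proof (cases "s < t")
    case True
    thus ?thesis using adjoint_adj[of "t - s" "\<eta> s" y] by (simp add: test_fun_def)
  next
    case False
    hence "\<eta> s = 0" using ab supp(1)[of s] by auto
    thus ?thesis using adjoint_0 by (simp add: test_fun_def)
  qed
  thus "test_fun s \<in> adjoint_dom D A" "adjoint_op D A (test_fun s) =
      - (\<eta> s *\<^sub>R adj' y (t - s))" by blast+
qed

lemma test_fun_test: "test_fun \<in> test_functions D A"
  unfolding test_functions_def
proof (intro CollectI conjI)
  show "test_fun C1_differentiable_on {0<..}" unfolding C1_differentiable_on_def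
    using test_fun_deriv continuous_on_subset[OF test_fun'_cont] by blast
  show "\<forall>s>0. test_fun s \<in> adjoint_dom D A" using adjoint_test_fun by blast
  show "continuous_on {0<..} test_fun"
    by (intro continuous_at_imp_continuous_on ballI has_vector_derivative_continuous[OF
        test_fun_deriv])
  have "continuous_on UNIV (\<lambda>s. - (\<eta> s *\<^sub>R adj' y (t - s)))"
    by (rule continuous_pieces) (intro continuous_intros adj_shift_continuous \<eta>_cont, use
        supp in auto)
  thus "continuous_on {0<..} (\<lambda>s. adjoint_op D A (test_fun s))"
    unfolding adjoint_test_fun by (rule continuous_on_subset) simp
  show "\<exists>K. compact K \<and> K \<subseteq> {0<..} \<and> (\<forall>s\<in>{0<..} - K. test_fun s = 0)"
    using ab supp by (intro exI[of _ "{a..b}"]) (auto simp: test_fun_def)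
qed

lemma test_fun_equation: "- vector_derivative test_fun (at s) + adjoint_op D A (test_fun s) =
    - (k s *\<^sub>R adj y (t - s))"
  by (simp add: vector_derivative_at[OF test_fun_deriv] adjoint_test_fun test_fun'_def)

text \<open>Moves the semigroup from \<open>y\<close> back to \<open>w\<close>; it is used with
  \<open>k\<close> and \<open>u\<close> on one side of the weak equation, and with
  \<open>\<eta>\<close> and \<open>f\<close> on the other.\<close>

lemma cinner_adj_duhamel_integrand:
  assumes "\<And>s. s \<notin> {a..b} \<Longrightarrow> m s = 0"
  shows "cinner (w s) (m s *\<^sub>R adj y (t - s)) = of_real (m s) * cinner (duhamel_integrand w t s) y"
proof (cases "s < t")
  case True
  thus ?thesis by (simp add: cinner_scaleR_right cinner_adj duhamel_integrand_def)
next
  case False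
  hence "m s = 0" using assms[of s] ab by auto
  thus ?thesis using cinner_scaleR_right[of "w s" 0 0] by simp
qed

lemma weighted_duhamel_integrand_integrable:
  assumes sm: "strongly_measurable (lebesgue_on {0<..}) w"
      and int: "integrable (lebesgue_on {a..b}) (\<lambda>s. norm (w s))"
    and m: "continuous_on UNIV m" "\<And>s. s \<notin> {a..b} \<Longrightarrow> m s = 0"
  shows "integrable (lebesgue_on {0<..}) (\<lambda>s. of_real (m s) * cinner (duhamel_integrand w t s) y)"
proof -
  obtain B where B: "B \<ge> 0" "\<And>s. \<bar>m s\<bar> \<le> B" using continuous_support_bounded[OF m] by blast
  show ?thesis
  proof (rule Bochner_Integration.integrable_bound)
    have "integrable (lebesgue_on {0<..}) (\<lambda>s. if s \<in> {a..b} then norm (w s) else 0)"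
      using int ab by (subst lebesgue_on_if) auto
    thus "integrable (lebesgue_on {0<..}) (\<lambda>s. B * C * norm y * (if s \<in> {a..b} then norm (w
        s) else 0))"
      by (rule integrable_mult_right)
    have "(\<lambda>s. cinner (duhamel_integrand w t s) y) \<in> borel_measurable (lebesgue_on {0<..})"
      by (rule strongly_measurable_borel[OF complete_measure_lebesgue_on
          strongly_measurable_duhamel_integrand[OF sm]])
        (auto intro: linear_continuous_on bounded_linear_cinner_left)
    moreover have "(\<lambda>s. complex_of_real (m s)) \<in> borel_measurable (lebesgue_on {0<..})"
      by (intro continuous_imp_measurable_on_sets_lebesgue continuous_on_of_real
          continuous_on_subset[OF m(1)]) auto
    ultimately show "(\<lambda>s. of_real (m s) * cinner (duhamel_integrand w t s) y) \<in> borel_measurable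
        (lebesgue_on {0<..})" by simp
    show "AE s in lebesgue_on {0<..}. norm (of_real (m s) * cinner (duhamel_integrand w t s) y)
       \<le> norm (B * C * norm y * (if s \<in> {a..b} then norm (w s) else 0))"
    proof (rule AE_I2)
      fix s
      have "norm (of_real (m s) * cinner (duhamel_integrand w t s) y) \<le>
          B * (C * norm (w s) * norm y)"
        unfolding norm_mult norm_of_real
        using B C_ge_1 norm_cinner_le[of "duhamel_integrand w t s" y] mult_right_mono[OF
            norm_duhamel_integrand_le[of w t s], of "norm y"]
        by (intro mult_mono) auto
      thus "norm (of_real (m s) * cinner (duhamel_integrand w t s) y)
         \<le> norm (B * C * norm y * (if s \<in> {a..b} then norm (w s) else 0))"
        using B C_ge_1 m(2)[of s] by (auto simp: mult_ac abs_mult)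
    qed
  qed
qed

text \<open>The support of \<open>m\<close> lies in the open half line, so the integral extends to
  the whole line, where the real-valued du Bois-Reymond lemma is stated.\<close>

lemma weighted_duhamel_integrand_Re:
  assumes "strongly_measurable (lebesgue_on {0<..}) w" "integrable (lebesgue_on {a..b}) (\<lambda>s.
      norm (w s))"
    and m: "continuous_on UNIV m" "\<And>s. s \<notin> {a..b} \<Longrightarrow> m s = 0"
  shows "Re (\<integral>s. of_real (m s) * cinner (duhamel_integrand w t s) y \<partial>lebesgue_on {0<..}) =
      (\<integral>s. m s * rinner (duhamel_integrand w t s) y \<partial>lebesgue)"
proof -
  have "Re (\<integral>s. of_real (m s) * cinner (duhamel_integrand w t s) y \<partial>lebesgue_on {0<..})
     = (\<integral>s. Re (of_real (m s) * cinner (duhamel_integrand w t s) y) \<partial>lebesgue_on {0<..})"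
    by (rule integral_Re[symmetric, OF weighted_duhamel_integrand_integrable[OF assms]])
  also have "\<dots> = (\<integral>s. indicator {0<..} s *\<^sub>R (m s * rinner (duhamel_integrand w t s) y) \<partial>lebesgue)"
    by (simp add: integral_restrict_space rinner_def)
  also have "\<dots> = (\<integral>s. m s * rinner (duhamel_integrand w t s) y \<partial>lebesgue)"
    using m(2) ab by (intro Bochner_Integration.integral_cong) (auto simp: indicator_def)
  finally show ?thesis .
qed

lemma weak_solution_scalar:
  assumes u: "weak_solution D A f u" and f_sm: "strongly_measurable (lebesgue_on {0<..}) f"
    and f_int: "integrable (lebesgue_on {a..b}) (\<lambda>s. norm (f s))"
  shows "(\<integral>s. k s * rinner (duhamel_integrand u t s) y \<partial>lebesgue) =
      - (\<integral>s. \<eta> s * rinner (duhamel_integrand f t s) y \<partial>lebesgue)"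
proof -
  have u2: "u \<in> L2_loc" using u by (simp add: weak_solution_def)
  hence u_sm: "strongly_measurable (lebesgue_on {0<..}) u" by (simp add: L2_loc_def)
  have u_int: "integrable (lebesgue_on {a..b}) (\<lambda>s. norm (u s))"
      by (rule L2_loc_norm_integrable[OF u2 ab(1)])
  have "(\<integral>s. cinner (u s) (- vector_derivative test_fun (at s) +
      adjoint_op D A (test_fun s)) \<partial>lebesgue_on {0<..})
     = (\<integral>s. cinner (f s) (test_fun s) \<partial>lebesgue_on {0<..})"
    using u test_fun_test by (simp add: weak_solution_def)
  moreover have "cinner (u s) (- vector_derivative test_fun (at s) + adjoint_op D A (test_fun s))
     = - (of_real (k s) * cinner (duhamel_integrand u t s) y)" for s
    using cinner_adj_duhamel_integrand[of k u s, OF supp(2)] unfolding test_fun_equation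
        by (simp add: cinner_minus_right)
  moreover have "cinner (f s) (test_fun s) = of_real (\<eta> s) * cinner (duhamel_integrand f
      t s) y" for s
    unfolding test_fun_def by (rule cinner_adj_duhamel_integrand[OF supp(1)])
  ultimately have "- (\<integral>s. of_real (k s) * cinner (duhamel_integrand u t s) y \<partial>lebesgue_on {0<..})
     = (\<integral>s. of_real (\<eta> s) * cinner (duhamel_integrand f t s) y \<partial>lebesgue_on {0<..})" by simp
  hence "- Re (\<integral>s. of_real (k s) * cinner (duhamel_integrand u t s) y \<partial>lebesgue_on {0<..})
     = Re (\<integral>s. of_real (\<eta> s) * cinner (duhamel_integrand f t s) y \<partial>lebesgue_on {0<..})"
    by (metis uminus_complex.sel(1))
  thus ?thesis using weighted_duhamel_integrand_Re[OF u_sm u_int kc supp(2)]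
      weighted_duhamel_integrand_Re[OF f_sm f_int \<eta>_cont supp(1)] by simp
qed

end

end

section \<open>The trace at time zero\<close>

text \<open>The exceptional null set depends on \<open>t\<close> and \<open>y\<close>. It becomes
  uniform by taking rational times and, as test vectors, the values of simple functions that
  approximate \<open>w\<close>.\<close>

lemma (in bounded_analytic) AE_zero_of_orbits:
  assumes sm: "strongly_measurable (lebesgue_on {0<..}) w"
    and orb: "\<And>t y. 0 < t \<Longrightarrow> AE s in lebesgue_on {0<..<t}. rinner (T (t - s) (w s)) y = 0"
  shows "AE s in lebesgue_on {0<..}. w s = 0"
proof -
  obtain p where p: "\<And>i. simple_function (lebesgue_on {0<..}) (p i)"
    and lim: "AE s in lebesgue_on {0<..}. (\<lambda>i. p i s) \<longlonglongrightarrow> w s"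
    using sm unfolding strongly_measurable_def by blast
  \<comment> \<open>Each \<open>w s\<close> is almost everywhere a limit of elements of
    \<open>E\<close>, so orthogonality to \<open>E\<close> forces
    \<open>rinner (w s) (w s) = 0\<close>.\<close>
  define E where "E = (\<Union>i. p i ` {0<..})"
  have "finite (p i ` {0<..})" for i
    using p[of i] by (simp add: simple_function_def space_restrict_space)
  hence E: "countable E" unfolding E_def by (intro countable_UN) (auto intro: countable_finite)
  define Q where "Q = \<rat> \<inter> {0::real<..}"
  have Q: "countable Q" unfolding Q_def using countable_rat by blast
  have "AE s in lebesgue. s \<in> {0<..<q} \<longrightarrow> rinner (T (q - s) (w s)) e = 0" if "q \<in> Q" for q e
    using orb[of q e] that by (simp add: AE_restrict_space_iff Q_def)
  hence "AE s in lebesgue. \<forall>q\<in>Q. \<forall>e\<in>E. s \<in> {0<..<q} \<longrightarrow> rinner (T (q - s) (w s)) e = 0"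
    unfolding AE_ball_countable[OF Q] AE_ball_countable[OF E] by blast
  moreover have "AE s in lebesgue. s \<in> {0<..} \<longrightarrow> (\<lambda>i. p i s) \<longlonglongrightarrow> w s"
    using lim by (simp add: AE_restrict_space_iff)
  ultimately have "AE s in lebesgue. s \<in> {0<..} \<longrightarrow> w s = 0"
  proof eventually_elim
    case (elim s)
    show ?case
    proof
      assume s: "s \<in> {0<..}"
      have e: "rinner (w s) e = 0" if "e \<in> E" for e
      proof -
        \<comment> \<open>Rational times above \<open>s\<close> that converge to \<open>s\<close>;
          strong continuity at \<open>0\<close> removes the semigroup from the pairing.\<close>
        have "\<exists>q\<in>\<rat>. s < q \<and> q < s + 1 / real (Suc n)" for n by (rule Rats_dense_in_real) simp
        then obtain q where q: "\<And>n. q n \<in> \<rat>" "\<And>n. s < q n" "\<And>n. q n < s + 1 / real (Suc n)" by metis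
        have "(\<lambda>n. s + 1 / real (Suc n)) \<longlonglongrightarrow> s + 0"
          by (intro tendsto_intros LIMSEQ_inverse_real_of_nat[unfolded inverse_eq_divide])
        moreover have le: "s \<le> q n" "q n \<le> s + 1 / real (Suc n)" for n
          using q(2,3)[of n] by linarith+
        ultimately have "q \<longlonglongrightarrow> s"
          by (intro tendsto_sandwich[OF _ _ tendsto_const, of s q]) (auto intro!:
              always_eventually simp del: of_nat_Suc)
        hence "(\<lambda>n. q n - s) \<longlonglongrightarrow> s - s" by (intro tendsto_intros)
        hence "(\<lambda>n. T (q n - s) (w s)) \<longlonglongrightarrow> T 0 (w s)"
          by (intro continuous_on_tendsto_compose[OF continuous_on_T]) (use le in auto)
        hence "(\<lambda>n. rinner (T (q n - s) (w s)) e) \<longlonglongrightarrow> rinner (w s) e"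
          by (intro tendsto_rinner) (simp_all add: T_0)
        moreover have "rinner (T (q n - s) (w s)) e = 0" for n
        proof -
          have "q n \<in> Q" using q(1,2)[of n] s by (simp add: Q_def)
          thus ?thesis using elim(1) that s q(2)[of n] by auto
        qed
        ultimately show ?thesis by (simp add: LIMSEQ_const_iff)
      qed
      have "(\<lambda>i. p i s) \<longlonglongrightarrow> w s" using elim(2) s by blast
      hence "(\<lambda>i. rinner (w s) (p i s)) \<longlonglongrightarrow> rinner (w s) (w s)"
          by (intro tendsto_rinner tendsto_const)
      moreover have "rinner (w s) (p i s) = 0" for i using s by (intro e) (auto simp: E_def)
      ultimately have "rinner (w s) (w s) = 0" by (simp add: LIMSEQ_const_iff)
      thus "w s = 0" by (simp add: rinner_self)
    qed
  qed
  thus ?thesis by (simp add: AE_restrict_space_iff)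
qed

section \<open>The weak solution minus the Duhamel integral, and its trace\<close>

context analytic_generator begin

context
  fixes f u :: "real \<Rightarrow> 'a"
  assumes f_sm: "strongly_measurable (lebesgue_on {0<..}) f"
    and f_int: "\<And>t. integrable (lebesgue_on {0<..<t}) (\<lambda>s. norm (f s))"
    and u: "weak_solution D A f u"
begin

definition homogeneous_part :: "real \<Rightarrow> 'a" where "homogeneous_part s = u s - duhamel f s"

lemma u_L2_loc: "u \<in> L2_loc" using u by (simp add: weak_solution_def)

lemma u_sm: "strongly_measurable (lebesgue_on {0<..}) u"
  using u_L2_loc by (simp add: L2_loc_def)

lemma duhamel_continuous: "continuous_on {0..} (duhamel f)"
  by (rule continuous_on_duhamel[OF f_sm f_int])

lemma homogeneous_part_sm: "strongly_measurable (lebesgue_on {0<..}) homogeneous_part"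
  unfolding homogeneous_part_def[abs_def]
  by (intro strongly_measurable_diff u_sm continuous_imp_strongly_measurable duhamel_continuous)

text \<open>The du Bois-Reymond lemma yields a constant plus the primitive of the paired forcing
  \<open>F\<close>. That primitive is the pairing of \<open>T (t - s) (duhamel f s)\<close> with
  \<open>y\<close>, so subtracting it leaves the constant.\<close>

lemma homogeneous_part_constant:
  assumes t: "t > 0"
  shows "\<exists>c. AE s in lebesgue_on {0<..<t}. rinner (T (t - s) (homogeneous_part s)) y = c"
proof -
  define F where "F s = (if s \<in> {0<..<t} then rinner (T (t - s) (f s)) y else 0)" for s
  have F: "integrable lebesgue F"
    using lebesgue_on_if(1)[of UNIV "{0<..<t}" "\<lambda>s. rinner (T (t - s) (f s)) y"]
      rinner_duhamel_restrict(1)[OF f_sm f_int] by (simp add: F_def[abs_def] lebesgue_on_UNIV_eq)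
  define g where "g s = rinner (duhamel_integrand u t s) y" for s
  have "\<exists>c. AE s in lebesgue_on {0<..<t}. g s = c + (\<integral>r. (if r < s then F r else 0) \<partial>lebesgue)"
  proof (rule du_bois_reymond[OF t F])
    fix a b :: real assume ab: "0 < a" "a \<le> b" "b < t"
    have cM: "complete_measure (lebesgue_on {a..b})" by (rule complete_measure_lebesgue_on) simp
    show "integrable (lebesgue_on {a..b}) g"
    proof (rule Bochner_Integration.integrable_bound)
      show "integrable (lebesgue_on {a..b}) (\<lambda>s. C * norm y * norm (u s))"
        by (intro integrable_mult_right L2_loc_norm_integrable[OF u_L2_loc ab(1)])
      have "strongly_measurable (lebesgue_on {a..b}) (duhamel_integrand u t)"
        by (rule strongly_measurable_restrict[OF strongly_measurable_duhamel_integrand[OF u_sm]])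
            (use ab in auto)
      thus "g \<in> borel_measurable (lebesgue_on {a..b})" unfolding g_def[abs_def]
        by (rule borel_measurable_rinner_strongly[OF cM])
      show "AE s in lebesgue_on {a..b}. norm (g s) \<le> norm (C * norm y * norm (u s))"
      proof (rule AE_I2)
        fix s
        have "\<bar>g s\<bar> \<le> norm (duhamel_integrand u t s) * norm y" unfolding g_def
            by (rule abs_rinner_le)
        also have "\<dots> \<le> C * norm (u s) * norm y"
            by (intro mult_right_mono norm_duhamel_integrand_le) simp
        finally show "norm (g s) \<le> norm (C * norm y * norm (u s))"
          using C_ge_1 by (simp add: abs_mult mult_ac)
      qed
    qed
  next
    fix a b :: real and \<eta> k :: "real \<Rightarrow> real"
    assume h: "0 < a" "a < b" "b < t" "\<And>s. (\<eta> has_real_derivative k s) (at s)"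
        "continuous_on UNIV k"
      "\<And>s. s \<notin> {a..b} \<Longrightarrow> \<eta> s = 0" "\<And>s. s \<notin> {a..b} \<Longrightarrow> k s = 0"
    have fi: "integrable (lebesgue_on {a..b}) (\<lambda>s. norm (f s))"
      by (rule integrable_lebesgue_on_subset[OF f_int[of t]]) (use h(1-3) in auto)
    have "(\<integral>s. k s * g s \<partial>lebesgue) = - (\<integral>s. \<eta> s * rinner (duhamel_integrand f t s) y \<partial>lebesgue)"
      unfolding g_def by (rule weak_solution_scalar[OF h u f_sm fi])
    also have "(\<lambda>s. \<eta> s * rinner (duhamel_integrand f t s) y) = (\<lambda>s. \<eta> s * F s)"
    proof
      fix s
      show "\<eta> s * rinner (duhamel_integrand f t s) y = \<eta> s * F s"
        using h(6)[of s] h(1-3) by (cases "s \<in> {a..b}") (auto simp: F_def duhamel_integrand_def)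
    qed
    finally show "(\<integral>s. k s * g s \<partial>lebesgue) = - (\<integral>s. \<eta> s * F s \<partial>lebesgue)" .
  qed
  then obtain c where c: "AE s in lebesgue_on {0<..<t}. g s =
      c + (\<integral>r. (if r < s then F r else 0) \<partial>lebesgue)" by blast
  have "rinner (T (t - s) (homogeneous_part s)) y = c"
    if s: "s \<in> {0<..<t}" and eq: "g s = c + (\<integral>r. (if r < s then F r else 0) \<partial>lebesgue)" for s
  proof -
    have "(\<integral>r. (if r < s then F r else 0) \<partial>lebesgue)
      = (\<integral>r. (if r \<in> {0<..<s} then rinner (T (s - r) (f r)) (adj y (t - s)) else 0) \<partial>lebesgue)"
    proof (rule Bochner_Integration.integral_cong[OF refl])
      fix r
      \<comment> \<open>The semigroup law splits the evolution at time \<open>s\<close>, and the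
        second factor is moved onto \<open>y\<close>.\<close>
      have "T (t - r) (f r) = T (t - s) (T (s - r) (f r))" if "r < s"
        using T_add[of "t - s" "s - r" "f r"] s that by simp
      thus "(if r < s then F r else 0) = (if r \<in> {0<..<s} then rinner (T (s - r) (f r)) (adj y (t
          - s)) else 0)"
        using s by (simp add: F_def rinner_adj)
    qed
    also have "\<dots> = (\<integral>r. rinner (T (s - r) (f r)) (adj y (t - s)) \<partial>lebesgue_on {0<..<s})"
      using lebesgue_on_if(2)[of UNIV "{0<..<s}" "\<lambda>r. rinner (T (s - r) (f r)) (adj y (t - s))"]
      by (simp add: lebesgue_on_UNIV_eq)
    also have "\<dots> = rinner (duhamel f s) (adj y (t - s))"
      by (rule rinner_duhamel_restrict(2)[OF f_sm f_int, symmetric])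
    also have "\<dots> = rinner (T (t - s) (duhamel f s)) y" using s by (simp add: rinner_adj)
    finally show ?thesis using eq s by (simp add: g_def duhamel_integrand_def homogeneous_part_def
        T_lin rinner_simps)
  qed
  moreover have "AE s in lebesgue_on {0<..<t}. s \<in> {0<..<t}"
      by (rule AE_I2) (simp add: space_restrict_space)
  ultimately have "AE s in lebesgue_on {0<..<t}. rinner (T (t - s) (homogeneous_part s)) y = c"
    using c by (auto elim: eventually_elim2)
  thus ?thesis by blast
qed

lemma homogeneous_part_norm_integrable: "\<tau> > 0 \<Longrightarrow>
    integrable (lebesgue_on {\<tau>..b}) (\<lambda>s. norm (homogeneous_part s))"
proof -
  assume \<tau>: "\<tau> > 0"
  have cd: "continuous_on {\<tau>..b} (\<lambda>s. norm (duhamel f s))"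
    by (intro continuous_on_norm continuous_on_subset[OF duhamel_continuous]) (use \<tau> in auto)
  show ?thesis
  proof (rule Bochner_Integration.integrable_bound)
    show "integrable (lebesgue_on {\<tau>..b}) (\<lambda>s. norm (u s) + norm (duhamel f s))"
      by (rule Bochner_Integration.integrable_add[OF L2_loc_norm_integrable[OF u_L2_loc \<tau>]
          continuous_imp_integrable_real[OF cd]])
    show "(\<lambda>s. norm (homogeneous_part s)) \<in> borel_measurable (lebesgue_on {\<tau>..b})"
      by (rule borel_measurable_norm_strongly[OF complete_measure_lebesgue_on
          strongly_measurable_restrict[OF homogeneous_part_sm]])
        (use \<tau> in auto)
    show "AE s in lebesgue_on {\<tau>..b}. norm (norm (homogeneous_part s)) \<le>
        norm (norm (u s) + norm (duhamel f s))"
      by (rule AE_I2) (simp add: homogeneous_part_def norm_triangle_ineq4)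
  qed
qed

text \<open>The Duhamel integral is bounded on \<open>{0..2}\<close>, which contains every
  \<open>{\<tau>..2 * \<tau>}\<close> with \<open>\<tau> < 1\<close>. The interval has length
  \<open>\<tau>\<close>, so this adds just the bound \<open>B\<close> to the mean of
  \<open>norm (u s)\<close>.\<close>

lemma homogeneous_part_dyadic_mean_bound: "\<exists>K. \<forall>\<tau>\<in>{0<..<1}. (1 / \<tau>) * (\<integral>s. norm (homogeneous_part
    s) \<partial>lebesgue_on {\<tau>..2 * \<tau>}) \<le> K"
proof -
  have "bdd_above ((\<lambda>\<tau>. (1 / \<tau>) * (\<integral>s. norm (u s) \<partial>lebesgue_on {\<tau>..2 * \<tau>})) ` {0<..<1})"
    using u by (simp add: weak_solution_def)
  then obtain K where "\<forall>x\<in>(\<lambda>\<tau>. (1 / \<tau>) * (\<integral>s. norm (u s) \<partial>lebesgue_on {\<tau>..2 * \<tau>})) `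
      {0<..<1}. x \<le> K"
    unfolding bdd_above_def by blast
  hence K: "\<And>\<tau>. \<tau> \<in> {0<..<1} \<Longrightarrow> (1 / \<tau>) * (\<integral>s. norm (u s) \<partial>lebesgue_on {\<tau>..2 * \<tau>}) \<le> K"
    by blast
  have "compact (duhamel f ` {0..2})"
    by (intro compact_continuous_image continuous_on_subset[OF duhamel_continuous]) auto
  hence "bounded (duhamel f ` {0..2})" by (rule compact_imp_bounded)
  then obtain B where B: "\<And>s. s \<in> {0..2} \<Longrightarrow> norm (duhamel f s) \<le> B" unfolding bounded_iff
      by (metis imageI)
  have "(1 / \<tau>) * (\<integral>s. norm (homogeneous_part s) \<partial>lebesgue_on {\<tau>..2 * \<tau>}) \<le> K + B"
      if \<tau>: "\<tau> \<in> {0<..<1}" for \<tau>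
  proof -
    have \<tau>0: "\<tau> > 0" using \<tau> by simp
    have ui: "integrable (lebesgue_on {\<tau>..2 * \<tau>}) (\<lambda>s. norm (u s))"
        by (rule L2_loc_norm_integrable[OF u_L2_loc \<tau>0])
    have Bi: "integrable (lebesgue_on {\<tau>..2 * \<tau>}) (\<lambda>s. B)"
        by (rule continuous_imp_integrable_real) simp
    have "(\<integral>s. norm (homogeneous_part s) \<partial>lebesgue_on {\<tau>..2 * \<tau>}) \<le>
        (\<integral>s. norm (u s) + B \<partial>lebesgue_on {\<tau>..2 * \<tau>})"
    proof (rule integral_mono[OF homogeneous_part_norm_integrable[OF \<tau>0]
        Bochner_Integration.integrable_add[OF ui Bi]])
      fix s assume "s \<in> space (lebesgue_on {\<tau>..2 * \<tau>})"
      hence "s \<in> {0..2}" using \<tau> by (simp add: space_restrict_space)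
      thus "norm (homogeneous_part s) \<le> norm (u s) + B"
        using B[of s] norm_triangle_ineq4[of "u s" "duhamel f s"]
            by (simp add: homogeneous_part_def)
    qed
    also have "\<dots> = (\<integral>s. norm (u s) \<partial>lebesgue_on {\<tau>..2 * \<tau>}) + \<tau> * B"
      using \<tau>0 by (simp add: Bochner_Integration.integral_add[OF ui Bi] measure_restrict_space)
    finally have "(1 / \<tau>) * (\<integral>s. norm (homogeneous_part s) \<partial>lebesgue_on {\<tau>..2 * \<tau>})
      \<le> (1 / \<tau>) * ((\<integral>s. norm (u s) \<partial>lebesgue_on {\<tau>..2 * \<tau>}) + \<tau> * B)"
      using \<tau>0 by (intro mult_left_mono) auto
    also have "\<dots> = (1 / \<tau>) * (\<integral>s. norm (u s) \<partial>lebesgue_on {\<tau>..2 * \<tau>}) + B" using \<tau>0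
        by (simp add: field_simps)
    finally show ?thesis using K[OF \<tau>] by linarith
  qed
  thus ?thesis by blast
qed

text \<open>The mean is formed after pairing with \<open>z\<close>, so that a scalar integral
  suffices; the vector \<open>h\<close> appears as a limit in this weak sense.\<close>

definition dyadic_dyadic_mean :: "real \<Rightarrow> 'a \<Rightarrow> real" where
  "dyadic_dyadic_mean \<tau> z = (1 / \<tau>) * (\<integral>s. rinner (homogeneous_part s) z \<partial>lebesgue_on {\<tau>..2 * \<tau>})"

lemma dyadic_dyadic_mean_integrable: "\<tau> > 0 \<Longrightarrow>
    integrable (lebesgue_on {\<tau>..b}) (\<lambda>s. rinner (homogeneous_part s) z)"
proof -
  assume \<tau>: "\<tau> > 0"
  show ?thesis
  proof (rule Bochner_Integration.integrable_bound)
    show "integrable (lebesgue_on {\<tau>..b}) (\<lambda>s. norm (homogeneous_part s) * norm z)"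
      by (intro integrable_mult_left homogeneous_part_norm_integrable \<tau>)
    show "(\<lambda>s. rinner (homogeneous_part s) z) \<in> borel_measurable (lebesgue_on {\<tau>..b})"
      by (rule borel_measurable_rinner_strongly[OF complete_measure_lebesgue_on
          strongly_measurable_restrict[OF homogeneous_part_sm]])
        (use \<tau> in auto)
    show "AE s in lebesgue_on {\<tau>..b}. norm (rinner (homogeneous_part s) z) \<le>
        norm (norm (homogeneous_part s) * norm z)"
      by (rule AE_I2) (simp add: abs_rinner_le)
  qed
qed

lemma dyadic_dyadic_mean_lin:
  assumes "\<tau> > 0"
  shows "dyadic_dyadic_mean \<tau> (x + y) = dyadic_dyadic_mean \<tau> x +
      dyadic_dyadic_mean \<tau> y" "dyadic_dyadic_mean \<tau> (r *\<^sub>R x) = r * dyadic_dyadic_mean \<tau> x"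
  using assms by (simp_all add: dyadic_dyadic_mean_def rinner_simps dyadic_dyadic_mean_integrable
      distrib_left)

text \<open>The vector may depend on \<open>s\<close>: a constant one gives boundedness of the limit
  functional, and the difference of two adjoint orbits gives the convergence of the means.\<close>

lemma dyadic_dyadic_mean_bound:
  assumes \<tau>: "\<tau> > 0" and K: "(1 / \<tau>) * (\<integral>s. norm (homogeneous_part s) \<partial>lebesgue_on {\<tau>..2 * \<tau>}) \<le> K"
    and int: "integrable (lebesgue_on {\<tau>..2 * \<tau>}) (\<lambda>s. rinner (homogeneous_part s) (z s))"
    and B: "\<And>s. s \<in> {\<tau>..2 * \<tau>} \<Longrightarrow> norm (z s) \<le> B" "B \<ge> 0"
  shows "\<bar>(1 / \<tau>) * (\<integral>s. rinner (homogeneous_part s) (z s) \<partial>lebesgue_on {\<tau>..2 * \<tau>})\<bar> \<le> K * B"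
proof -
  have "\<bar>\<integral>s. rinner (homogeneous_part s) (z s) \<partial>lebesgue_on {\<tau>..2 * \<tau>}\<bar> \<le>
      (\<integral>s. norm (homogeneous_part s) * B \<partial>lebesgue_on {\<tau>..2 * \<tau>})"
  proof (rule integral_abs_bound_integral[OF int])
    show "integrable (lebesgue_on {\<tau>..2 * \<tau>}) (\<lambda>s. norm (homogeneous_part s) * B)"
      by (intro integrable_mult_left homogeneous_part_norm_integrable \<tau>)
    fix s assume "s \<in> space (lebesgue_on {\<tau>..2 * \<tau>})"
    hence "norm (z s) \<le> B" by (intro B) (simp add: space_restrict_space)
    hence "norm (homogeneous_part s) * norm (z s) \<le> norm (homogeneous_part s) * B"
        by (intro mult_left_mono) auto
    thus "\<bar>rinner (homogeneous_part s) (z s)\<bar> \<le> norm (homogeneous_part s) * B"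
        using abs_rinner_le[of "homogeneous_part s" "z s"] by linarith
  qed
  hence "(1 / \<tau>) * \<bar>\<integral>s. rinner (homogeneous_part s) (z s) \<partial>lebesgue_on {\<tau>..2 * \<tau>}\<bar>
      \<le> (1 / \<tau>) * ((\<integral>s. norm (homogeneous_part s) \<partial>lebesgue_on {\<tau>..2 * \<tau>}) * B)"
    using \<tau> by (intro mult_left_mono) auto
  also have "\<dots> = ((1 / \<tau>) * (\<integral>s. norm (homogeneous_part s) \<partial>lebesgue_on {\<tau>..2 * \<tau>})) * B" by simp
  also have "\<dots> \<le> K * B" by (intro mult_right_mono K B)
  finally show ?thesis using \<tau> by (simp add: abs_mult)
qed

lemma dyadic_dyadic_mean_adj_tendsto:
  assumes t: "t > 0" and c: "AE s in lebesgue_on {0<..<t}. rinner (T (t - s)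
      (homogeneous_part s)) y = c"
  shows "((\<lambda>\<tau>. dyadic_dyadic_mean \<tau> (adj y t)) \<longlongrightarrow> c) (at_right 0)"
proof (rule tendstoI)
  fix e :: real assume e: "e > 0"
  obtain K0 where K0: "\<And>\<tau>. \<tau> \<in> {0<..<1} \<Longrightarrow> (1 / \<tau>) * (\<integral>s. norm (homogeneous_part s) \<partial>lebesgue_on
      {\<tau>..2 * \<tau>}) \<le> K0"
    using homogeneous_part_dyadic_mean_bound by blast
  \<comment> \<open>The maximum with \<open>1\<close> makes \<open>K\<close> positive, so that the
    tolerance can be divided by it.\<close>
  define K where "K = max K0 1"
  have K: "K > 0" "\<And>\<tau>. \<tau> \<in> {0<..<1} \<Longrightarrow> (1 / \<tau>) * (\<integral>s. norm (homogeneous_part s) \<partial>lebesgue_on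
      {\<tau>..2 * \<tau>}) \<le> K"
    using K0 unfolding K_def by (auto intro: le_max_iff_disj[THEN iffD2])
  define e' where "e' = e / (2 * K)"
  have e': "e' > 0" using e K by (simp add: e'_def)
  have "isCont (adj y) t" by (rule has_vector_derivative_continuous[OF
      adj_has_vector_derivative[OF t]])
  then obtain d where d: "d > 0" "\<And>s. dist s t < d \<Longrightarrow> dist (adj y s) (adj y t) < e'"
    using e' unfolding continuous_at_eps_delta by metis
  \<comment> \<open>For \<open>\<tau> < \<tau>0\<close> and \<open>s\<close> in
    \<open>{\<tau>..2 * \<tau>}\<close> the time \<open>t - s\<close> is positive and within
    \<open>d\<close> of \<open>t\<close>.\<close>
  define \<tau>0 where "\<tau>0 = min 1 (min d t / 2)"
  have \<tau>0: "\<tau>0 > 0" using d t by (simp add: \<tau>0_def)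
  have "dist (dyadic_dyadic_mean \<tau> (adj y t)) c < e" if \<tau>: "0 < \<tau>" "\<tau> < \<tau>0" for \<tau>
  proof -
    have \<tau>': "\<tau> < 1" "2 * \<tau> < d" "2 * \<tau> < t" using \<tau> by (auto simp: \<tau>0_def)
    let ?M = "lebesgue_on {\<tau>..2 * \<tau>}"
    have i1: "integrable ?M (\<lambda>s. rinner (homogeneous_part s) (adj y t))"
        by (rule dyadic_dyadic_mean_integrable[OF \<tau>(1)])
    have ic: "integrable ?M (\<lambda>s. c)" by (rule continuous_imp_integrable_real) simp
    have "AE s in lebesgue. s \<in> {0<..<t} \<longrightarrow> rinner (T (t - s) (homogeneous_part s)) y = c"
      using c by (simp add: AE_restrict_space_iff)
    hence "AE s in lebesgue. s \<in> {\<tau>..2 * \<tau>} \<longrightarrow> rinner (T (t - s) (homogeneous_part s)) y = c"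
      by eventually_elim (use \<tau> \<tau>' in auto)
    hence "AE s in ?M. rinner (T (t - s) (homogeneous_part s)) y = c"
        by (simp add: AE_restrict_space_iff)
    moreover have "AE s in ?M. s \<in> {\<tau>..2 * \<tau>}" by (rule AE_I2) (simp add: space_restrict_space)
    \<comment> \<open>Almost everywhere \<open>c\<close> is the pairing with
      \<open>adj y (t - s)\<close>, so the deviation from \<open>c\<close> is a pairing with a small
      difference.\<close>
    ultimately have ae: "AE s in ?M. rinner (homogeneous_part s) (adj y t) - c =
        rinner (homogeneous_part s) (adj y t - adj y (t - s))"
      by eventually_elim (use \<tau>' in \<open>simp add: rinner_simps rinner_adj\<close>)
    have id: "integrable ?M (\<lambda>s. rinner (homogeneous_part s) (adj y t) - c)"
        by (rule Bochner_Integration.integrable_diff[OF i1 ic])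
    have "continuous_on {\<tau>..2 * \<tau>} (\<lambda>s. adj y (t - s))"
      by (rule continuous_on_compose2[OF continuous_on_adj]) (use \<tau>' in \<open>auto intro!:
          continuous_intros\<close>)
    \<comment> \<open>The vector in the pairing varies with \<open>s\<close>, so measurability is
      read off from the almost everywhere equality \<open>ae\<close>, with a constant sequence as
      approximation.\<close>
    have dm: "(\<lambda>s. rinner (homogeneous_part s) (adj y t - adj y (t - s))) \<in> borel_measurable ?M"
    proof (rule complete_measure.borel_measurable_AE_LIMSEQ)
      show "complete_measure ?M" by (rule complete_measure_lebesgue_on) simp
      show "(\<lambda>s. rinner (homogeneous_part s) (adj y t) - c) \<in> borel_measurable ?M" for i :: nat
        by (rule borel_measurable_integrable[OF id])
      show "AE s in ?M. (\<lambda>i. rinner (homogeneous_part s) (adj y t) - c) \<longlonglongrightarrow> rinner (homogeneous_part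
          s) (adj y t - adj y (t - s))"
        using ae by eventually_elim simp
    qed
    have ii: "integrable ?M (\<lambda>s. rinner (homogeneous_part s) (adj y t - adj y (t - s)))"
      by (rule integrable_cong_AE_imp[OF id dm ae])
    have "measure ?M {\<tau>..2 * \<tau>} = \<tau>" using \<tau>(1) by (subst measure_restrict_space) auto
    hence mc: "(\<integral>s. c \<partial>?M) = \<tau> * c" by simp
    have "dyadic_dyadic_mean \<tau> (adj y t) - c =
        (1 / \<tau>) * ((\<integral>s. rinner (homogeneous_part s) (adj y t) \<partial>?M) - (\<integral>s. c \<partial>?M))"
      unfolding mc dyadic_dyadic_mean_def using \<tau> by (simp add: field_simps)
    also have "\<dots> = (1 / \<tau>) * (\<integral>s. rinner (homogeneous_part s) (adj y t) - c \<partial>?M)"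
      by (simp add: Bochner_Integration.integral_diff[OF i1 ic])
    also have "\<dots> = (1 / \<tau>) * (\<integral>s. rinner (homogeneous_part s) (adj y t - adj y (t - s)) \<partial>?M)"
      using integral_cong_AE[OF borel_measurable_integrable[OF id] dm ae] by simp
    finally have eq: "dyadic_dyadic_mean \<tau> (adj y t) - c =
        (1 / \<tau>) * (\<integral>s. rinner (homogeneous_part s) (adj y t - adj y (t - s)) \<partial>?M)" .
    have "\<bar>(1 / \<tau>) * (\<integral>s. rinner (homogeneous_part s) (adj y t - adj y (t - s)) \<partial>?M)\<bar> \<le> K * e'"
    proof (rule dyadic_dyadic_mean_bound[OF \<tau>(1) K(2) ii])
      fix s assume "s \<in> {\<tau>..2 * \<tau>}"
      hence "dist (t - s) t < d" using \<tau> \<tau>' by (simp add: dist_real_def)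
      from d(2)[OF this] show "norm (adj y t - adj y (t - s)) \<le> e'"
          by (simp add: dist_norm norm_minus_commute)
    qed (use \<tau> \<tau>' e' in auto)
    also have "K * e' < e" using K e by (simp add: e'_def)
    finally show ?thesis using eq by (simp add: dist_real_def)
  qed
  thus "\<forall>\<^sub>F \<tau> in at_right 0. dist (dyadic_dyadic_mean \<tau> (adj y t)) c < e"
    unfolding eventually_at_right_field using \<tau>0 by (intro exI[of _ \<tau>0]) auto
qed

text \<open>One \<open>h\<close> serves all \<open>t\<close> and \<open>y\<close>, because the
  limits of the means define a single functional before any \<open>t\<close> or \<open>y\<close> is
  chosen, and every constant is its value at some \<open>adj y t\<close>.\<close>

lemma exists_trace:
  "\<exists>h. \<forall>t>0. \<forall>y. AE s in lebesgue_on {0<..<t}. rinner (T (t - s) (homogeneous_part s)) y =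
      rinner (T t h) y"
proof -
  \<comment> \<open>The vectors along which the means converge. All \<open>adj y t\<close> with
    \<open>t > 0\<close> belong to it.\<close>
  define Z where "Z = {z. \<exists>l. ((\<lambda>\<tau>. dyadic_dyadic_mean \<tau> z) \<longlongrightarrow> l) (at_right 0)}"
  define L where "L z = Lim (at_right 0) (\<lambda>\<tau>. dyadic_dyadic_mean \<tau> z)" for z
  have L_eq: "L z = l" if "((\<lambda>\<tau>. dyadic_dyadic_mean \<tau> z) \<longlongrightarrow> l) (at_right 0)" for z l
    unfolding L_def by (rule tendsto_Lim[OF trivial_limit_at_right_real that])
  have L: "((\<lambda>\<tau>. dyadic_dyadic_mean \<tau> z) \<longlongrightarrow> L z) (at_right 0)" if z: "z \<in> Z" for z
    using z L_eq unfolding Z_def by fastforce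
  obtain K where K: "\<And>\<tau>. \<tau> \<in> {0<..<1} \<Longrightarrow> (1 / \<tau>) * (\<integral>s. norm (homogeneous_part s) \<partial>lebesgue_on
      {\<tau>..2 * \<tau>}) \<le> K"
    using homogeneous_part_dyadic_mean_bound by blast
  have pos: "\<forall>\<^sub>F \<tau>::real in at_right 0. \<tau> \<in> {0<..<1}"
    unfolding eventually_at_right_field by (intro exI[of _ 1]) auto
  have add: "((\<lambda>\<tau>. dyadic_dyadic_mean \<tau> (x + y)) \<longlongrightarrow> L x + L y) (at_right 0)"
      if "x \<in> Z" "y \<in> Z" for x y
  proof (rule Lim_transform_eventually[OF tendsto_add[OF L[OF that(1)] L[OF that(2)]]])
    show "\<forall>\<^sub>F \<tau> in at_right 0. dyadic_dyadic_mean \<tau> x + dyadic_dyadic_mean \<tau> y =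
        dyadic_dyadic_mean \<tau> (x + y)"
      using pos by eventually_elim (simp add: dyadic_dyadic_mean_lin)
  qed
  have sc: "((\<lambda>\<tau>. dyadic_dyadic_mean \<tau> (r *\<^sub>R x)) \<longlongrightarrow> r * L x) (at_right 0)" if "x \<in> Z" for x r
  proof (rule Lim_transform_eventually[OF tendsto_mult_left[OF L[OF that]]])
    show "\<forall>\<^sub>F \<tau> in at_right 0. r * dyadic_dyadic_mean \<tau> x = dyadic_dyadic_mean \<tau> (r *\<^sub>R x)"
      using pos by eventually_elim (simp add: dyadic_dyadic_mean_lin)
  qed
  have "\<exists>h. \<forall>z\<in>Z. L z = rinner z h"
  proof (rule riesz_real_subspace)
    have "dyadic_dyadic_mean \<tau> 0 = 0" for \<tau> by (simp add: dyadic_dyadic_mean_def rinner_zero)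
    thus "0 \<in> Z" unfolding Z_def by auto
    show "x + y \<in> Z" "L (x + y) = L x + L y" if "x \<in> Z" "y \<in> Z" for x y
      using add[OF that] L_eq by (auto simp: Z_def)
    show "r *\<^sub>R x \<in> Z" "L (r *\<^sub>R x) = r * L x" if "x \<in> Z" for x r
      using sc[OF that] L_eq by (auto simp: Z_def)
    show "\<bar>L x\<bar> \<le> K * norm x" if "x \<in> Z" for x
    proof (rule tendsto_upperbound[OF tendsto_rabs[OF L[OF that]]])
      show "\<forall>\<^sub>F \<tau> in at_right 0. \<bar>dyadic_dyadic_mean \<tau> x\<bar> \<le> K * norm x"
        using pos
      proof eventually_elim
        case (elim \<tau>)
        thus ?case unfolding dyadic_dyadic_mean_def
          by (intro dyadic_dyadic_mean_bound[where z="\<lambda>_. x"] K dyadic_dyadic_mean_integrable) auto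
      qed
    qed simp
  qed
  then obtain h where h: "\<And>z. z \<in> Z \<Longrightarrow> L z = rinner z h" by blast
  have "AE s in lebesgue_on {0<..<t}. rinner (T (t - s) (homogeneous_part s)) y =
      rinner (T t h) y" if t: "t > 0" for t y
  proof -
    obtain c where c: "AE s in lebesgue_on {0<..<t}. rinner (T (t - s) (homogeneous_part s)) y = c"
      using homogeneous_part_constant[OF t] by blast
    note lim = dyadic_dyadic_mean_adj_tendsto[OF t c]
    hence "adj y t \<in> Z" unfolding Z_def by blast
    hence "c = rinner (adj y t) h" using h L_eq[OF lim] by simp
    also have "\<dots> = rinner (T t h) y" using t rinner_adj[of t h y] by (subst rinner_commute) simp
    finally show ?thesis using c by simp
  qed
  thus ?thesis by blast
qed

lemma representation: "\<exists>h. AE s in lebesgue_on {0<..}. u s = T s h + duhamel f s"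
proof -
  obtain h where h: "\<And>t y. t > 0 \<Longrightarrow> AE s in lebesgue_on {0<..<t}. rinner (T (t - s)
      (homogeneous_part s)) y = rinner (T t h) y"
    using exists_trace by blast
  have "AE s in lebesgue_on {0<..}. homogeneous_part s - T s h = 0"
  proof (rule AE_zero_of_orbits)
    show "strongly_measurable (lebesgue_on {0<..}) (\<lambda>s. homogeneous_part s - T s h)"
      by (intro strongly_measurable_diff homogeneous_part_sm continuous_imp_strongly_measurable
          continuous_on_T)
    fix t :: real and y assume t: "0 < t"
    have "AE s in lebesgue_on {0<..<t}. s \<in> {0<..<t}"
        by (rule AE_I2) (simp add: space_restrict_space)
    with h[OF t, of y] show "AE s in lebesgue_on {0<..<t}. rinner (T (t - s) (homogeneous_part s -
        T s h)) y = 0"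
    proof eventually_elim
      case (elim s)
      \<comment> \<open>The orbit of \<open>h\<close> is brought under the same operator as the
        homogeneous part, so the difference is annihilated for every later time
        \<open>t\<close>.\<close>
      have "T t h = T (t - s) (T s h)" using T_add[of "t - s" s h] elim by simp
      thus ?case using elim by (simp add: T_lin rinner_simps)
    qed
  qed
  hence "AE s in lebesgue_on {0<..}. u s = T s h + duhamel f s"
    by eventually_elim (simp add: homogeneous_part_def algebra_simps)
  thus ?thesis by blast
qed

end
end

section \<open>From the hypotheses on the generator to the final statement\<close>

lemma generator_imp_analytic_generator:
  assumes "neg_generates_bounded_analytic_semigroup D A S"
  obtains \<delta> C where "analytic_generator S \<delta> C D A"
proof -
  obtain \<delta> where \<delta>: "0 < \<delta>" "bounded_analytic_semigroup \<delta> S"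
    and cd: "closed_densely_defined D A"
    and gen: "\<And>x y. ((\<lambda>t. (1 / t) *\<^sub>R (S (complex_of_real t) x - x)) \<longlongrightarrow> y) (at_right 0) \<longleftrightarrow> x \<in> D
        \<and> y = - A x"
    using assms unfolding neg_generates_bounded_analytic_semigroup_def by blast
  obtain C where C: "\<And>z x. z \<in> sector \<delta> \<Longrightarrow> norm (S z x) \<le> C * norm x"
    using \<delta>(2) unfolding bounded_analytic_semigroup_def by blast
  \<comment> \<open>Enlarging the bound to at least \<open>1\<close> keeps it valid and meets the
    condition on \<open>C\<close>.\<close>
  have "analytic_generator S \<delta> (max C 1) D A"
  proof (unfold_locales; (fact \<delta>(1))?)
    show "norm (S z x) \<le> max C 1 * norm x" if "z \<in> sector \<delta>" for z x
      using C[OF that, of x] mult_right_mono[of C "max C 1" "norm x"] by simp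
    show "clinear_operator D A" "closure D = UNIV" using cd
        by (auto simp: closed_densely_defined_def)
    show "((\<lambda>t. (1 / t) *\<^sub>R (S (complex_of_real t) x - x)) \<longlongrightarrow> - A x) (at_right 0)" if "x \<in> D" for x
      using gen that by blast
  qed (use \<delta>(2) in \<open>auto simp: bounded_analytic_semigroup_def\<close>)
  thus ?thesis by (rule that)
qed

theorem proposition2p2:
  fixes D :: "'a::complex_hilbert_space set"
    and A :: "'a \<Rightarrow> 'a"
    and S :: "complex \<Rightarrow> 'a \<Rightarrow> 'a"
    and \<beta> :: real
    and f u v :: "real \<Rightarrow> 'a"
  assumes "neg_generates_bounded_analytic_semigroup D A S"
    and "\<beta> < 1"
    and "f \<in> L2_weighted \<beta>"
    and "weak_solution D A f u"
    and v_def: "\<And>t. t > 0 \<Longrightarrow>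
      v t = bochner_integral (lebesgue_on {0<..<t}) (\<lambda>s. S (complex_of_real (t - s)) (f s))"
  shows "(\<forall>t>0. bochner_integrable (lebesgue_on {0<..<t}) (\<lambda>s. S (complex_of_real (t - s)) (f s))) \<and>
    (\<exists>h. (AE t in lebesgue_on {0<..}. u t = S (complex_of_real t) h + v t) \<and>
         (\<exists>w. continuous_on {0..} w \<and> w 0 = h \<and> (AE t in lebesgue_on {0<..}. u t = w t)))"
proof -
  obtain \<delta> C where "analytic_generator S \<delta> C D A"
    using generator_imp_analytic_generator[OF assms(1)] by blast
  then interpret analytic_generator S \<delta> C D A .
  have f_sm: "strongly_measurable (lebesgue_on {0<..}) f"
    using assms(3) by (simp add: L2_weighted_def)
  have f_int: "integrable (lebesgue_on {0<..<t}) (\<lambda>s. norm (f s))" for t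
    by (rule L2_weighted_norm_integrable[OF assms(3,2)])
  \<comment> \<open>The values of \<open>v\<close> are prescribed for positive times; the continuous
    representative uses \<open>duhamel\<close>, whose value at \<open>0\<close> is an integral over
    the empty set.\<close>
  have v: "v t = duhamel f t" if "t > 0" for t
    unfolding v_def[OF that] duhamel_def[OF f_sm f_int] T_def ..
  obtain h where h: "AE t in lebesgue_on {0<..}. u t = T t h + duhamel f t"
    using representation[OF f_sm f_int assms(4)] by blast
  show ?thesis
  proof (intro conjI exI allI impI)
    show "bochner_integrable (lebesgue_on {0<..<t}) (\<lambda>s. S (complex_of_real (t - s)) (f s))" for t
      using duhamel_bochner_integrable[OF f_sm f_int, of t] by (simp add: T_def)
    have "AE t::real in lebesgue_on {0<..}. t > 0" by (rule AE_I2) (simp add: space_restrict_space)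
    with h show "AE t in lebesgue_on {0<..}. u t = S (complex_of_real t) h + v t"
      by eventually_elim (simp add: v T_def)
    show "continuous_on {0..} (\<lambda>t. T t h + duhamel f t)"
      by (intro continuous_on_add continuous_on_T continuous_on_duhamel[OF f_sm f_int])
    show "T 0 h + duhamel f 0 = h" by (simp add: T_0 duhamel_0[OF f_sm f_int])
  qed (fact h)
qed

end
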